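(* Let $K:\mathbb{R}^2\to[0,\infty)$ satisfy: $K\in L^1(\mathbb{R}^2)\cap L^2(\mathbb{R}^2)$, $\int K\,d\lambda^2=1$, $\operatorname{supp}(\mathcal{F}K)\subseteq[-1,1]^2$, and $\mathcal{F}K$ is Lipschitz continuous. Let $X=(X_t)_{t\ge0}$ be a two-dimensional Lévy process with Lévy triplet $(\Sigma,\nu,\alpha)$ such that (i) $\nu(\mathbb{R}^2\setminus[0,\infty)^2)=0$; (ii) there is $\gamma>0$ with $\int|x|^{8+\gamma}\,\nu(dx)<\infty$; (iii) there is $c>0$ with $|\mathcal{F}((x_1^4+x_2^4)\nu)(u)|\le c\,(1+|u_1|)^{-1}(1+|u_2|)^{-1}$ for all $u\in\mathbb{R}^2$. Let $\widehat N_n(a,b)$ be the estimator defined in the context, based on $X_1,\dots,X_n$, with bandwidth $h=h_n=\frac{\log\log n}{\sqrt{\log n}}$. Then $$\sup_{(a,b)\in\mathfrak{R}}\big(|(a,b)|^2\wedge|(a,b)|^4\big)\,\big|\nu([a,\infty)\times[b,\infty))-\widehat N_n(a,b)\big|=O_{P_{\Sigma,\nu,\alpha}}\Big(\frac{(\log\log n)^2}{\sqrt{\log n}}\Big),\qquad n\to\infty .$$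
   Context: Notation: $\mathfrak{R}=[0,\infty)^2\setminus\{(0,0)\}$; $|\cdot|$ is the Euclidean norm; $\lambda^2$ is Lebesgue measure on $\mathbb{R}^2$; $(\mathcal{F}f)(u)=\int e^{i\langle u,x\rangle}f(x)\,\lambda^2(dx)$ and $(\mathcal{F}\mu)(u)=\int e^{i\langle u,x\rangle}\mu(dx)$ for integrable functions $f$ and finite measures $\mu$; $\mathcal{F}^{-1}$ is the inverse Fourier transform, $(\mathcal{F}^{-1}f)(x)=(2\pi)^{-2}\int e^{-i\langle u,x\rangle}f(u)\,\lambda^2(du)$. $(x_1^4+x_2^4)\nu$ is the measure with $\nu$-density $x_1^4+x_2^4$. $K_h(x)=h^{-2}K(h^{-1}x)$ for $h>0$. $Y_n=O_P(r_n)$ means: for every $\delta>0$ there is $M>0$ with $P(|Y_n/r_n|\ge M)\le\delta$ for all $n$ (for which the quantities are defined, here $n\ge3$). Under $P_{\Sigma,\nu,\alpha}$ the variable $X_1$ has characteristic function $$\varphi(u)=\exp\Big(-\tfrac12\langle u,\Sigma u\rangle+i\langle u,\alpha\rangle+\int_{\mathbb{R}^2}(e^{i\langle u,x\rangle}-1-i\langle u,x\rangle)\,\nu(dx)\Big).$$ Estimator. With $X_0=0$, put $\widehat\varphi_n(u)=\frac1n\sum_{t=1}^n e^{i\langle u,X_t-X_{t-1}\rangle}$, $u\in\mathbb{R}^2$. For $k=1,2$, writing $\partial_k=\partial/\partial u_k$, define (wherever $\widehat\varphi_n\ne0$) the function denoted $\frac{\partial^4\widehat\Psi_n}{\partial u_k^4}$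 by $$\frac{\partial^4\widehat\Psi_n}{\partial u_k^4}=\frac{\partial_k^4\widehat\varphi_n}{\widehat\varphi_n}-4\frac{\partial_k\widehat\varphi_n\,\partial_k^3\widehat\varphi_n}{\widehat\varphi_n^2}-3\Big(\frac{\partial_k^2\widehat\varphi_n}{\widehat\varphi_n}\Big)^2+12\frac{(\partial_k\widehat\varphi_n)^2\,\partial_k^2\widehat\varphi_n}{\widehat\varphi_n^3}-6\Big(\frac{\partial_k\widehat\varphi_n}{\widehat\varphi_n}\Big)^4 .$$ Let $A_{h,n}=\{|\widehat\varphi_n(u)|>\frac12|\varphi(u)|\text{ for all }u\in[-\frac1h,\frac1h]^2\}$ and $g_{a,b}(x)=\frac{1}{x_1^4+x_2^4}\mathbf{1}_{[a,\infty)\times[b,\infty)}(x_1,x_2)$. For $(a,b)\in\mathfrak{R}$, $$\widehat N_n(a,b)=\int_{\mathbb{R}^2}g_{a,b}(x)\,\mathcal{F}^{-1}\Big(\Big(\frac{\partial^4\widehat\Psi_n}{\partial u_1^4}+\frac{\partial^4\widehat\Psi_n}{\partial u_2^4}\Big)\mathcal{F}K_h\Big)(x)\,\lambda^2(dx)\ \text{ on }A_{h,n},\qquad \widehat N_n(a,b)=0\ \text{ on }A_{h,n}^c ,$$ where the product with $\mathcal{F}K_h$ is understood as $0$ outside $[-\frac1h,\frac1h]^2$. *)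

theory Defs
  imports "HOL-Probability.Probability"
begin

section \<open>Fourier transforms on the plane\<close>

text \<open>The sign convention is that of characteristic functions; \<open>iexp s\<close> is \<open>exp (\<i> s)\<close>.\<close>

definition fourier :: "(real^2 \<Rightarrow> complex) \<Rightarrow> real^2 \<Rightarrow> complex" where
  "fourier f u = (\<integral>x. iexp (u \<bullet> x) * f x \<partial>lborel)"

definition fourier_measure :: "(real^2) measure \<Rightarrow> real^2 \<Rightarrow> complex" where
  "fourier_measure \<mu> u = (\<integral>x. iexp (u \<bullet> x) \<partial>\<mu>)"

definition inv_fourier :: "(real^2 \<Rightarrow> complex) \<Rightarrow> real^2 \<Rightarrow> complex" where
  "inv_fourier f x =
     complex_of_real (1 / (2 * pi)\<^sup>2) * (\<integral>u. iexp (- (u \<bullet> x)) * f u \<partial>lborel)"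

definition square :: "real \<Rightarrow> (real^2) set" where
  "square r = {u. \<bar>u $ 1\<bar> \<le> r \<and> \<bar>u $ 2\<bar> \<le> r}"

definition partial :: "2 \<Rightarrow> (real^2 \<Rightarrow> complex) \<Rightarrow> real^2 \<Rightarrow> complex" where
  "partial k f u = vector_derivative (\<lambda>s. f (u + s *\<^sub>R axis k 1)) (at 0)"


section \<open>L\'evy processes\<close>

locale levy_process = prob_space M for M :: "'a measure" +
  fixes X :: "real \<Rightarrow> 'a \<Rightarrow> 'b::euclidean_space"
  assumes random_variable: "\<And>t. 0 \<le> t \<Longrightarrow> X t \<in> borel_measurable M"
    and start: "AE \<omega> in M. X 0 \<omega> = 0"
    and independent_increments:
      "\<And>(m::nat) (t::nat \<Rightarrow> real). 0 \<le> t 0 \<Longrightarrow> (\<And>i. i < m \<Longrightarrow> t i < t (Suc i)) \<Longrightarrow>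
         indep_vars (\<lambda>_. borel) (\<lambda>i \<omega>. X (t (Suc i)) \<omega> - X (t i) \<omega>) {..<m}"
    and stationary_increments:
      "\<And>s t. 0 \<le> s \<Longrightarrow> 0 \<le> t \<Longrightarrow>
         distr M borel (\<lambda>\<omega>. X (s + t) \<omega> - X s \<omega>) = distr M borel (X t)"
    and stochastically_continuous:
      "\<And>t \<epsilon>. 0 \<le> t \<Longrightarrow> 0 < \<epsilon> \<Longrightarrow>
         ((\<lambda>s. prob {\<omega> \<in> space M. \<epsilon> < norm (X s \<omega> - X t \<omega>)}) \<longlongrightarrow> 0) (at t within {0..})"
    and cadlag:
      "AE \<omega> in M. \<forall>t\<ge>0. continuous (at_right t) (\<lambda>s. X s \<omega>) \<and>
         (0 < t \<longrightarrow> (\<exists>l. ((\<lambda>s. X s \<omega>) \<longlongrightarrow> l) (at_left t)))"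

definition levy_measure :: "(real^2) measure \<Rightarrow> bool" where
  "levy_measure \<nu> \<longleftrightarrow> sets \<nu> = sets borel \<and> emeasure \<nu> {0} = 0 \<and>
     (\<integral>\<^sup>+x. ennreal (min 1 ((norm x)\<^sup>2)) \<partial>\<nu>) < \<infinity>"

text \<open>The L\'evy--Khintchine formula at time 1 without truncation function, so the drift \<open>\<alpha>\<close> is
  the mean of the process at time 1. It is meaningful only if \<open>\<nu>\<close> has a finite first moment away
  from the origin; otherwise the Bochner integral is 0 by convention.\<close>

definition levy_char :: "real^2^2 \<Rightarrow> (real^2) measure \<Rightarrow> real^2 \<Rightarrow> real^2 \<Rightarrow> complex" where
  "levy_char \<Sigma> \<nu> \<alpha> u =
     exp (- complex_of_real ((u \<bullet> (\<Sigma> *v u)) / 2) + \<i> * complex_of_real (u \<bullet> \<alpha>)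
          + (\<integral>x. iexp (u \<bullet> x) - 1 - \<i> * complex_of_real (u \<bullet> x) \<partial>\<nu>))"

definition levy_triplet ::
  "'a measure \<Rightarrow> (real \<Rightarrow> 'a \<Rightarrow> real^2) \<Rightarrow> real^2^2 \<Rightarrow> (real^2) measure \<Rightarrow> real^2 \<Rightarrow> bool" where
  "levy_triplet M X \<Sigma> \<nu> \<alpha> \<longleftrightarrow>
     transpose \<Sigma> = \<Sigma> \<and> (\<forall>u. 0 \<le> u \<bullet> (\<Sigma> *v u)) \<and> levy_measure \<nu> \<and>
     (\<forall>u. fourier_measure (distr M borel (X 1)) u = levy_char \<Sigma> \<nu> \<alpha> u)"


section \<open>The estimator\<close>

text \<open>In this section \<open>x 0, x 1, \<dots>\<close> is a sequence of observed positions with \<open>x 0 = 0\<close>.\<close>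

definition emp_char :: "(nat \<Rightarrow> real^2) \<Rightarrow> nat \<Rightarrow> real^2 \<Rightarrow> complex" where
  "emp_char x n u = (\<Sum>t=1..n. iexp (u \<bullet> (x t - x (t - 1)))) / of_nat n"

text \<open>The formal fourth partial derivative of the logarithm of the empirical characteristic
  function; no branch of the logarithm is involved.\<close>

definition psi4 :: "2 \<Rightarrow> (nat \<Rightarrow> real^2) \<Rightarrow> nat \<Rightarrow> real^2 \<Rightarrow> complex" where
  "psi4 k x n u =
     (let \<phi> = emp_char x n; d = (\<lambda>j. (partial k ^^ j) \<phi> u) in
        d 4 / \<phi> u
        - 4 * (d 1 * d 3 / (\<phi> u)\<^sup>2)
        - 3 * (d 2 / \<phi> u)\<^sup>2
        + 12 * ((d 1)\<^sup>2 * d 2 / (\<phi> u)^3)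
        - 6 * (d 1 / \<phi> u)^4)"

definition kernel_scale :: "(real^2 \<Rightarrow> real) \<Rightarrow> real \<Rightarrow> real^2 \<Rightarrow> real" where
  "kernel_scale K h x = K ((1 / h) *\<^sub>R x) / h\<^sup>2"

definition upper_orthant :: "real^2 \<Rightarrow> (real^2) set" where
  "upper_orthant p = {x. p $ 1 \<le> x $ 1 \<and> p $ 2 \<le> x $ 2}"

definition g_fun :: "real^2 \<Rightarrow> real^2 \<Rightarrow> real" where
  "g_fun p x = indicator (upper_orthant p) x / ((x $ 1)^4 + (x $ 2)^4)"

definition good_event :: "(real^2 \<Rightarrow> complex) \<Rightarrow> real \<Rightarrow> nat \<Rightarrow> (nat \<Rightarrow> real^2) \<Rightarrow> bool" where
  "good_event \<phi> h n x \<longleftrightarrow> (\<forall>u \<in> square (1 / h). cmod (emp_char x n u) > cmod (\<phi> u) / 2)"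

text \<open>The value is a complex number, since the inverse Fourier transform is complex-valued; it is
  real because the function under the inverse transform is Hermitian.\<close>

definition N_hat ::
  "(real^2 \<Rightarrow> real) \<Rightarrow> (real^2 \<Rightarrow> complex) \<Rightarrow> real \<Rightarrow> nat \<Rightarrow> (nat \<Rightarrow> real^2) \<Rightarrow> real^2 \<Rightarrow> complex" where
  "N_hat K \<phi> h n x p =
     (if good_event \<phi> h n x
      then \<integral>y. complex_of_real (g_fun p y) *
             inv_fourier (\<lambda>u. indicator (square (1 / h)) u *
               ((psi4 1 x n u + psi4 2 x n u) *
                fourier (\<lambda>z. complex_of_real (kernel_scale K h z)) u)) y \<partial>lborel
      else 0)"

text \<open>The index set \<open>[0,\<infinity>)\<^sup>2\<close> without the origin.\<close>

definition pointed_quadrant :: "(real^2) set" where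
  "pointed_quadrant = {p. 0 \<le> p $ 1 \<and> 0 \<le> p $ 2} - {0}"


section \<open>Stochastic boundedness\<close>

text \<open>The extended reals allow \<open>Y n\<close> to be a supremum. Measurability of \<open>Y n\<close> is part of the
  notion, because \<open>measure\<close> vanishes on non-measurable sets.\<close>

definition bigO_P :: "'a measure \<Rightarrow> nat \<Rightarrow> (nat \<Rightarrow> 'a \<Rightarrow> ereal) \<Rightarrow> (nat \<Rightarrow> real) \<Rightarrow> bool" where
  "bigO_P M n0 Y r \<longleftrightarrow>
     (\<forall>n\<ge>n0. Y n \<in> borel_measurable M) \<and>
     (\<forall>\<delta>>0. \<exists>C>0. \<forall>n\<ge>n0.
        measure M {\<omega> \<in> space M. ereal C \<le> \<bar>Y n \<omega> / ereal (r n)\<bar>} \<le> \<delta>)"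

end

theory Submission
  imports Defs "HOL-Real_Asymp.Real_Asymp"
begin

text \<open>
  Put \<open>\<mu> = (x\<^sub>1^4 + x\<^sub>2^4) \<nu>\<close>. Then \<open>\<nu>\<close> of the orthant at \<open>p\<close> is the integral of \<open>g_fun p\<close> against \<open>\<mu>\<close>,
  and by Parseval both this number and the estimator are integrals of the Fourier transform of
  \<open>g_fun p\<close>, against the transform of \<open>\<mu>\<close> and against the smoothed empirical cumulant. Since
  \<open>1 / (s^4 + t^4)\<close> is a positive mixture of indicators of rectangles, the transform of \<open>g_fun p\<close> is at most
  a constant times \<open>1 / ((1 + |u\<^sub>1|) (1 + |u\<^sub>2|))\<close> after multiplication by the weight in \<open>p\<close>, uniformly in \<open>p\<close>.

  The bias is therefore at most a constant times the integral of
  \<open>min (2, L h |u|) / ((1 + |u\<^sub>1|) (1 + |u\<^sub>2|))^2\<close>, which is of order \<open>h log (1 / h)\<close>; this is the stated rate.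
  The stochastic error is negligible: the modulus of the characteristic function on the square of side
  \<open>2 / h\<close> is at least \<open>exp (- C / h^2)\<close>, larger than every negative power of \<open>n\<close>, while the empirical
  derivatives up to order four have mean square error of order \<open>1 / n\<close>. The latter needs eight moments
  of the process at time 1; they exist because its characteristic function is the exponential of an
  eight times differentiable function.
\<close>


subsection \<open>Lebesgue measure on the plane\<close>

text \<open>Absolute convergence on the Fourier side needs two factors
  \<open>1 / cross_weight\<close>: assumption (iii) supplies one, the product shape of orthants the
  other. The bound for the transform of \<open>g_fun p\<close> grows like \<open>max_coord p\<close>
  to the power -4 near the origin and decays with power -2 far away, which is why the weight is a
  minimum of a square and a fourth power. The bandwidth is fitted to the Gaussian lower bound of the
  characteristic function: \<open>1 / h^2 = ln n / (ln ln n)^2\<close> makes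
  \<open>exp (B / h^2)\<close> a power of \<open>n\<close> with exponent tending to 0, so any
  polynomial gain absorbs it. The good event is a uniform statement over a growing square. No
  maximal inequality for the empirical process is used: only the mean square deviation integrated
  over the square is controlled, and the loss in passing from there to a uniform bound is again a
  factor \<open>exp (B / h^2)\<close>. The form of the conclusion adds two obligations: a supremum
  over an uncountable index set has to be measurable, and the tail bound has to hold for every
  \<open>n \<ge> 3\<close>, not only for large \<open>n\<close>.\<close>

definition vec2 :: "real \<times> real \<Rightarrow> real^2" where
  "vec2 z = vector [fst z, snd z]"

lemma vec2_nth [simp]: "vec2 (a, b) $ 1 = a" "vec2 (a, b) $ 2 = b"
  by (simp_all add: vec2_def)

lemma vec2_eta: "vec2 (x $ 1, x $ 2) = x"
  by (simp add: vec_eq_iff forall_2)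

lemma inner_real2: "x \<bullet> y = x $ 1 * y $ 1 + x $ 2 * (y :: real^2) $ 2"
  by (simp add: inner_vec_def sum_2)

lemma norm_real2_sq: "(norm (x :: real^2))\<^sup>2 = (x $ 1)\<^sup>2 + (x $ 2)\<^sup>2"
  unfolding power2_norm_eq_inner by (simp add: inner_real2 power2_eq_square)

lemma measurable_nth_real2 [measurable]: "(\<lambda>x :: real^2. x $ k) \<in> borel_measurable borel"
  by (rule borel_measurable_nth)

lemma vec2_alt: "vec2 z = fst z *\<^sub>R axis 1 1 + snd z *\<^sub>R axis 2 1"
  by (cases z) (simp add: vec_eq_iff forall_2 axis_def)

lemma measurable_vec2 [measurable]: "vec2 \<in> borel_measurable borel"
proof -
  have "continuous_on UNIV vec2"
    unfolding vec2_alt[abs_def] by (intro continuous_intros)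
  then show ?thesis by (rule borel_measurable_continuous_onI)
qed

lemma measurable_vec2' [measurable]: "vec2 \<in> borel_measurable (lborel \<Otimes>\<^sub>M lborel)"
  using measurable_vec2 by (simp add: lborel_prod)

lemma Basis_real2: "(Basis :: (real^2) set) = {axis 1 1, axis 2 1}"
  by (auto simp: Basis_vec_def UNIV_2)

text \<open>A measure that gives every box its volume is Lebesgue measure
  (\<open>lborel_eqI\<close>). The product form is what makes iterated integrals available on
  \<open>real^2\<close>.\<close>

lemma lborel_real2: "(lborel :: (real^2) measure) = distr (lborel \<Otimes>\<^sub>M lborel) borel vec2"
proof (rule lborel_eqI)
  fix l u :: "real^2" assume le: "\<And>b. b \<in> Basis \<Longrightarrow> l \<bullet> b \<le> u \<bullet> b"
  have le': "l $ 1 \<le> u $ 1" "l $ 2 \<le> u $ 2"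
    using le[of "axis 1 1"] le[of "axis 2 1"] by (auto simp: Basis_real2 inner_axis)
  \<comment> \<open>The product over \<open>Basis\<close> has two factors only once the two axes are
    known to differ.\<close>
  have ne: "(axis 1 1 :: real^2) \<noteq> axis 2 1" by (simp add: axis_eq_axis)
  have "vec2 -` box l u \<inter> space (lborel \<Otimes>\<^sub>M lborel) = {l $ 1<..<u $ 1} \<times> {l $ 2<..<u $ 2}"
    by (auto simp: mem_box Basis_real2 inner_axis space_pair_measure)
  then have "emeasure (distr (lborel \<Otimes>\<^sub>M lborel) borel vec2) (box l u) =
      emeasure (lborel \<Otimes>\<^sub>M lborel) ({l $ 1<..<u $ 1} \<times> {l $ 2<..<u $ 2})"
    by (subst emeasure_distr) auto
  also have "\<dots> = ennreal (u $ 1 - l $ 1) * ennreal (u $ 2 - l $ 2)"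
    using le' by (subst lborel.emeasure_pair_measure_Times) auto
  also have "\<dots> = (\<Prod>b\<in>Basis. (u - l) \<bullet> b)"
    using le' ne by (simp add: Basis_real2 inner_axis ennreal_mult)
  finally show "emeasure (distr (lborel \<Otimes>\<^sub>M lborel) borel vec2) (box l u) = (\<Prod>b\<in>Basis. (u - l) \<bullet> b)" .
qed simp

lemma nn_integral_real2:
  assumes [measurable]: "f \<in> borel_measurable borel"
  shows "(\<integral>\<^sup>+x. f x \<partial>(lborel :: (real^2) measure)) = (\<integral>\<^sup>+a. \<integral>\<^sup>+b. f (vec2 (a, b)) \<partial>lborel \<partial>lborel)"
proof -
  have "(\<integral>\<^sup>+x. f x \<partial>(lborel :: (real^2) measure)) = (\<integral>\<^sup>+z. f (vec2 z) \<partial>(lborel \<Otimes>\<^sub>M lborel))"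
    by (subst lborel_real2, subst nn_integral_distr) auto
  also have "\<dots> = (\<integral>\<^sup>+a. \<integral>\<^sup>+b. f (vec2 (a, b)) \<partial>lborel \<partial>lborel)"
    by (subst lborel.nn_integral_fst[symmetric]) auto
  finally show ?thesis .
qed

lemma nn_integral_real2_mult:
  assumes [measurable]: "f \<in> borel_measurable borel" "g \<in> borel_measurable borel"
  shows "(\<integral>\<^sup>+x. f (x $ 1) * g (x $ 2) \<partial>(lborel :: (real^2) measure)) =
    (\<integral>\<^sup>+a. f a \<partial>lborel) * (\<integral>\<^sup>+b. g b \<partial>lborel)"
  by (subst nn_integral_real2) (auto simp: nn_integral_cmult nn_integral_multc)

lemma
  fixes f g :: "real \<Rightarrow> 'a :: {real_normed_field, banach, second_countable_topology}"
  assumes f: "integrable lborel f" and g: "integrable lborel g"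
  shows integrable_real2_mult: "integrable lborel (\<lambda>x :: real^2. f (x $ 1) * g (x $ 2))"
    and integral_real2_mult: "(\<integral>x. f (x $ 1) * g (x $ 2) \<partial>(lborel :: (real^2) measure)) =
      (\<integral>a. f a \<partial>lborel) * (\<integral>b. g b \<partial>lborel)"
proof -
  have [measurable]: "f \<in> borel_measurable borel" "g \<in> borel_measurable borel"
    using f g by auto
  have i: "integrable (lborel \<Otimes>\<^sub>M lborel) (\<lambda>(a, b). f a * g b)"
    using f g by (intro lborel_pair.Fubini_integrable) (auto simp: norm_mult)
  show "integrable lborel (\<lambda>x :: real^2. f (x $ 1) * g (x $ 2))"
    by (subst lborel_real2, subst integrable_distr_eq) (use i in \<open>auto simp: case_prod_beta' vec2_def\<close>)
  have "(\<integral>x. f (x $ 1) * g (x $ 2) \<partial>(lborel :: (real^2) measure)) = (\<integral>z. (\<lambda>(a, b). f a * g b) z \<partial>(lborel \<Otimes>\<^sub>M lborel))"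
    by (subst lborel_real2, subst integral_distr) (auto simp: case_prod_beta' vec2_def)
  also have "\<dots> = (\<integral>a. f a \<partial>lborel) * (\<integral>b. g b \<partial>lborel)"
    by (subst lborel_pair.integral_fst'[OF i, symmetric]) simp
  finally show "(\<integral>x. f (x $ 1) * g (x $ 2) \<partial>(lborel :: (real^2) measure)) =
      (\<integral>a. f a \<partial>lborel) * (\<integral>b. g b \<partial>lborel)" .
qed

subsection \<open>The weight function and its Fourier transform\<close>

text \<open>The scale of \<open>p\<close>: on the quadrant it is the maximum norm, and all bounds on
  \<open>g_fun p\<close> are expressed in it.\<close>

definition max_coord :: "real^2 \<Rightarrow> real" where
  "max_coord p = max (p $ 1) (p $ 2)"

lemma max_coord_pos: "p \<in> pointed_quadrant \<Longrightarrow> 0 < max_coord p"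
  by (auto simp: pointed_quadrant_def max_coord_def max_def vec_eq_iff forall_2)

text \<open>The mixed second derivative of \<open>1 / (s^4 + t^4)\<close>.\<close>

definition mixed_density :: "real \<Rightarrow> real \<Rightarrow> real" where
  "mixed_density s t = 32 * s^3 * t^3 / (s^4 + t^4)^3"

text \<open>The left side is a product of functions of one variable; this is what makes the two-dimensional
  integrals of \<open>g_fun p\<close> and \<open>mixed_density\<close> split into one-dimensional ones.\<close>

lemma quartic_ge:
  assumes p: "p \<in> pointed_quadrant" and x: "p $ 1 \<le> s" "p $ 2 \<le> t"
  shows "((max_coord p + (s - p $ 1)) * (max_coord p + (t - p $ 2)))\<^sup>2 \<le> 4 * (s^4 + t^4)"
proof -
  have *: "(x * (x' + y))\<^sup>2 \<le> 4 * (x^4 + y^4)" if "0 \<le> x'" "x' \<le> x" "0 \<le> y" for x x' y :: real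
  proof -
    have "(x * (x' + y))\<^sup>2 \<le> (x * (x + y))\<^sup>2"
      using that by (intro power_mono mult_mono) auto
    also have "\<dots> \<le> x\<^sup>2 * (2 * (x\<^sup>2 + y\<^sup>2))"
      using sum_squares_bound[of x y] by (auto simp: power_mult_distrib power2_sum intro!: mult_left_mono)
    also have "\<dots> \<le> 4 * (x^4 + y^4)"
    proof -
      have "x\<^sup>2 * (2 * (x\<^sup>2 + y\<^sup>2)) = 2 * x^4 + 2 * x\<^sup>2 * y\<^sup>2"
        by (simp add: algebra_simps power2_eq_square power4_eq_xxxx)
      also have "\<dots> \<le> 2 * x^4 + (x^4 + y^4)"
        using sum_squares_bound[of "x\<^sup>2" "y\<^sup>2"] by simp
      also have "\<dots> \<le> 4 * (x^4 + y^4)" by simp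
      finally show ?thesis .
    qed
    finally show ?thesis .
  qed
  have nn: "0 \<le> p $ 1" "0 \<le> p $ 2" using p by (auto simp: pointed_quadrant_def)
  \<comment> \<open>The factor belonging to the larger coordinate of \<open>p\<close> collapses to
    that coordinate of the point. The other factor exceeds its own coordinate by the gap between the
    coordinates of \<open>p\<close>, which is at most the first factor; this is the situation of the
    auxiliary inequality.\<close>
  show ?thesis
  proof (cases "p $ 2 \<le> p $ 1")
    case True
    then have "(max_coord p + (s - p $ 1)) * (max_coord p + (t - p $ 2)) = s * ((p $ 1 - p $ 2) + t)"
      by (simp add: max_coord_def)
    then show ?thesis
      using *[of "p $ 1 - p $ 2" s t] nn x True by simp
  next
    case False
    then have "(max_coord p + (s - p $ 1)) * (max_coord p + (t - p $ 2)) = t * ((p $ 2 - p $ 1) + s)"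
      by (simp add: max_coord_def)
    then show ?thesis
      using *[of "p $ 2 - p $ 1" t s] nn x False by (simp add: add.commute)
  qed
qed

lemma max_coord_shift:
  assumes p: "p \<in> pointed_quadrant" and x: "p $ 1 \<le> s" "p $ 2 \<le> t"
  shows "0 < max_coord p + (s - p $ 1)" "0 < max_coord p + (t - p $ 2)" "s \<le> max_coord p + (s - p $ 1)"
    "t \<le> max_coord p + (t - p $ 2)" "0 \<le> s" "0 \<le> t" "0 < s^4 + t^4"
proof -
  note q = max_coord_pos[OF p]
  show "0 < max_coord p + (s - p $ 1)" "0 < max_coord p + (t - p $ 2)" "s \<le> max_coord p + (s - p $ 1)"
    "t \<le> max_coord p + (t - p $ 2)" "0 \<le> s" "0 \<le> t"
    using p q x by (auto simp: pointed_quadrant_def max_coord_def)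
  have "s \<noteq> 0 \<or> t \<noteq> 0"
    using p x by (auto simp: pointed_quadrant_def vec_eq_iff forall_2)
  then show "0 < s^4 + t^4"
    by (metis add_nonneg_pos add_pos_nonneg even_numeral zero_le_even_power zero_less_power_eq)
qed

text \<open>In the numerator \<open>s\<close> and \<open>t\<close> are enlarged to the shifted
  coordinates; in the denominator \<open>quartic_ge\<close> is cubed, which costs
  \<open>4^3 = 64\<close>. The constant is \<open>32 * 64\<close>.\<close>

lemma mixed_density_bound:
  assumes p: "p \<in> pointed_quadrant" and x: "p $ 1 \<le> s" "p $ 2 \<le> t"
  shows "mixed_density s t \<le> 2048 * (1 / (max_coord p + (s - p $ 1))^3 * (1 / (max_coord p + (t - p $ 2))^3))"
    and "0 \<le> mixed_density s t"
proof -
  note sh = max_coord_shift[OF assms]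
  let ?S = "max_coord p + (s - p $ 1)" and ?T = "max_coord p + (t - p $ 2)"
  have "s^3 * t^3 \<le> ?S^3 * ?T^3"
    using sh by (intro mult_mono power_mono) auto
  then have 1: "32 * s^3 * t^3 \<le> 32 * (?S * ?T)^3"
    by (simp add: power_mult_distrib)
  have "((?S * ?T)\<^sup>2 / 4)^3 \<le> (s^4 + t^4)^3"
    using quartic_ge[OF assms] by (intro power_mono) auto
  then have 2: "(?S * ?T)^6 / 64 \<le> (s^4 + t^4)^3"
    by (simp add: power_divide flip: power_mult)
  have "mixed_density s t \<le> 32 * (?S * ?T)^3 / ((?S * ?T)^6 / 64)"
    unfolding mixed_density_def using 1 2 sh by (intro frac_le) auto
  also have "\<dots> = 2048 * (1 / ?S^3 * (1 / ?T^3))"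
    using sh by (simp add: divide_simps power_mult_distrib eval_nat_numeral)
  finally show "mixed_density s t \<le> 2048 * (1 / ?S^3 * (1 / ?T^3))" .
  show "0 \<le> mixed_density s t" using sh by (auto simp: mixed_density_def)
qed

lemma has_real_derivative_inverse_square:
  assumes "(R has_real_derivative R') (at t)" "R t \<noteq> 0"
  shows "((\<lambda>t. - (c / (R t)\<^sup>2)) has_real_derivative c * (2 * R') / (R t)^3) (at t)"
  using assms by (auto intro!: derivative_eq_intros simp: field_simps eval_nat_numeral)

lemma has_real_derivative_inverse_sum:
  assumes "(R has_real_derivative 1) (at t)" "R t \<noteq> 0"
  shows "((\<lambda>t. - (1 / R t + 1 / (R t)\<^sup>2)) has_real_derivative 1 / (R t)\<^sup>2 + 2 / (R t)^3) (at t)"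
  using assms by (auto intro!: derivative_eq_intros simp: field_simps eval_nat_numeral)

text \<open>The fundamental theorem of calculus, first in \<open>t\<close> with antiderivative
  \<open>- 4 s^3 / (s^4 + t^4)^2\<close>, then in \<open>s\<close> with
  \<open>- 1 / (s^4 + y^4)\<close>; both vanish at infinity.\<close>

lemma nn_integral_mixed_density:
  assumes "0 \<le> x" "0 \<le> y" "0 < x^4 + y^4"
  shows "(\<integral>\<^sup>+s. \<integral>\<^sup>+t. ennreal (mixed_density s t) * indicator {x..} s * indicator {y..} t \<partial>lborel \<partial>lborel) =
    ennreal (1 / (x^4 + y^4))"
proof -
  have lim1: "((\<lambda>t. - (4 * s^3 / (s^4 + t^4)^2)) \<longlongrightarrow> 0) at_top" for s :: real
  proof -
    have "filterlim (\<lambda>t::real. s^4 + t^4) at_top at_top"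
      by (intro filterlim_tendsto_add_at_top[OF tendsto_const] filterlim_pow_at_top filterlim_ident) auto
    then have "filterlim (\<lambda>t::real. (s^4 + t^4)^2) at_top at_top"
      by (intro filterlim_pow_at_top) auto
    from tendsto_minus[OF real_tendsto_divide_at_top[OF tendsto_const this, of "4 * s^3"]]
    show ?thesis by simp
  qed
  have in1: "(\<integral>\<^sup>+t. ennreal (mixed_density s t) * indicator {y..} t \<partial>lborel) = ennreal (4 * s^3 / (s^4 + y^4)^2)" if "0 < s" for s
  proof -
    have pos: "0 < s^4 + t^4" for t :: real using that by (simp add: add_pos_nonneg)
    have "(\<integral>\<^sup>+t. ennreal (mixed_density s t) * indicator {y..} t \<partial>lborel) = ennreal (0 - (- (4 * s^3 / (s^4 + y^4)^2)))"
    proof (rule nn_integral_FTC_atLeast[where F = "\<lambda>t. - (4 * s^3 / (s^4 + t^4)^2)"])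
      show "(\<lambda>t. mixed_density s t) \<in> borel_measurable borel" unfolding mixed_density_def by measurable
      show "((\<lambda>t. - (4 * s^3 / (s^4 + t^4)^2)) has_real_derivative mixed_density s t) (at t)" for t
      proof -
        have "((\<lambda>t. s^4 + t^4) has_real_derivative 4 * t^3) (at t)"
          by (auto intro!: derivative_eq_intros)
        from has_real_derivative_inverse_square[OF this, of "4 * s^3"] pos[of t]
        show ?thesis by (simp add: mixed_density_def mult_ac)
      qed
      show "0 \<le> mixed_density s t" if "y \<le> t" for t
        using that pos[of t] \<open>0 < s\<close> assms by (auto simp: mixed_density_def)
      show "((\<lambda>t. - (4 * s^3 / (s^4 + t^4)^2)) \<longlongrightarrow> 0) at_top" by (rule lim1)
    qed
    then show ?thesis by simp
  qed
  have "(\<integral>\<^sup>+s. \<integral>\<^sup>+t. ennreal (mixed_density s t) * indicator {x..} s * indicator {y..} t \<partial>lborel \<partial>lborel) =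
    (\<integral>\<^sup>+s. (\<integral>\<^sup>+t. ennreal (mixed_density s t) * indicator {y..} t \<partial>lborel) * indicator {x..} s \<partial>lborel)"
    by (intro nn_integral_cong) (auto simp: indicator_def)
  also have "\<dots> = (\<integral>\<^sup>+s. ennreal (4 * s^3 / (s^4 + y^4)^2) * indicator {x..} s \<partial>lborel)"
  proof (rule nn_integral_cong_AE)
    \<comment> \<open>The inner formula asks for \<open>s > 0\<close>: at \<open>s = 0\<close> the
      denominator vanishes when \<open>t = 0\<close>, and \<open>x = 0\<close> is allowed.\<close>
    have "AE s in lborel. s \<noteq> (0::real)" by (rule AE_lborel_singleton)
    then show "AE s in lborel. (\<integral>\<^sup>+t. ennreal (mixed_density s t) * indicator {y..} t \<partial>lborel) * indicator {x..} s =
      ennreal (4 * s^3 / (s^4 + y^4)^2) * indicator {x..} s"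
      by eventually_elim (use assms in1 in \<open>auto simp: indicator_def\<close>)
  qed
  also have "\<dots> = ennreal (0 - (- (1 / (x^4 + y^4))))"
  proof (rule nn_integral_FTC_atLeast[where F = "\<lambda>s. - (1 / (s^4 + y^4))"])
    show "(\<lambda>s. 4 * s^3 / (s^4 + y^4)^2) \<in> borel_measurable borel" by measurable
    have pos: "0 < s^4 + y^4" if "x \<le> s" for s
    proof -
      have "x^4 \<le> s^4" using that assms by (intro power_mono) auto
      then show ?thesis using assms by linarith
    qed
    show "((\<lambda>s. - (1 / (s^4 + y^4))) has_real_derivative 4 * s^3 / (s^4 + y^4)^2) (at s)" if "x \<le> s" for s
      using pos[OF that] by (auto intro!: derivative_eq_intros simp: field_simps eval_nat_numeral)
    show "0 \<le> 4 * s^3 / (s^4 + y^4)^2" if "x \<le> s" for s using that assms by auto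
    have "filterlim (\<lambda>s::real. y^4 + s^4) at_top at_top"
      by (intro filterlim_tendsto_add_at_top[OF tendsto_const] filterlim_pow_at_top filterlim_ident) auto
    from tendsto_minus[OF real_tendsto_divide_at_top[OF tendsto_const this, of 1]]
    show "((\<lambda>s. - (1 / (s^4 + y^4))) \<longlongrightarrow> 0) at_top" by (simp add: add.commute)
  qed
  finally show ?thesis by simp
qed

text \<open>Two estimates are added: the length bounds the integral itself, and the explicit
  antiderivative bounds \<open>\<bar>u\<bar>\<close> times it by 2.\<close>

lemma interval_iexp_bound:
  assumes "a \<le> s"
  shows "cmod (\<integral>x. indicator {a..s} x *\<^sub>R iexp (u * x) \<partial>lborel) * (1 + \<bar>u\<bar>) \<le> 2 + (s - a)"
proof -
  let ?I = "\<integral>x. indicator {a..s} x *\<^sub>R iexp (u * x) \<partial>lborel"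
  have "cmod ?I \<le> (\<integral>x. norm (indicator {a..s} x *\<^sub>R iexp (u * x)) \<partial>lborel)"
    by (rule integral_norm_bound)
  also have "\<dots> = (\<integral>x. indicator {a..s} x \<partial>lborel)" by simp
  also have "\<dots> = s - a" using assms by simp
  finally have 1: "cmod ?I \<le> s - a" .
  have 2: "cmod ?I * \<bar>u\<bar> \<le> 2"
  proof (cases "u = 0")
    case False
    have d: "((\<lambda>x. iexp (u * x) / (\<i> * u)) has_vector_derivative iexp (u * x)) (at x within {a..s})" for x
      using False by (auto intro!: derivative_eq_intros has_vector_derivative_real_field simp: field_simps)
    have "has_bochner_integral lborel (\<lambda>x. indicator {a..s} x *\<^sub>R iexp (u * x)) (iexp (u * s) / (\<i> * u) - iexp (u * a) / (\<i> * u))"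
      by (rule has_bochner_integral_FTC_Icc[OF assms d]) (intro continuous_intros)
    then have "?I = (iexp (u * s) - iexp (u * a)) / (\<i> * u)"
      by (simp add: has_bochner_integral_integral_eq diff_divide_distrib)
    then have "cmod ?I * \<bar>u\<bar> = cmod (iexp (u * s) - iexp (u * a))"
      using False by (simp add: norm_divide norm_mult)
    also have "\<dots> \<le> 2" using norm_triangle_ineq4[of "iexp (u * s)" "iexp (u * a)"] by simp
    finally show ?thesis .
  qed simp
  show ?thesis using 1 2 by (simp add: algebra_simps)
qed

text \<open>The numerator comes from \<open>interval_iexp_bound\<close>, the cube from
  \<open>mixed_density_bound\<close>. With \<open>w = q + (s - a)\<close> the numerator is at most
  \<open>w + 2\<close>, so the integrand splits into \<open>1 / w^2 + 2 / w^3\<close>, which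
  integrate to \<open>1 / q\<close> and \<open>1 / q^2\<close>.\<close>

lemma nn_integral_shift_cubic:
  assumes "0 < q"
  shows "(\<integral>\<^sup>+s. ennreal ((2 + (s - a)) / (q + (s - a))^3) * indicator {a..} s \<partial>lborel) \<le> ennreal (1 / q + 1 / q\<^sup>2)"
proof -
  have "(\<integral>\<^sup>+s. ennreal ((2 + (s - a)) / (q + (s - a))^3) * indicator {a..} s \<partial>lborel) \<le>
    (\<integral>\<^sup>+s. ennreal (1 / (q + (s - a))\<^sup>2 + 2 / (q + (s - a))^3) * indicator {a..} s \<partial>lborel)"
  proof (intro nn_integral_mono)
    fix s
    show "ennreal ((2 + (s - a)) / (q + (s - a))^3) * indicator {a..} s \<le> ennreal (1 / (q + (s - a))\<^sup>2 + 2 / (q + (s - a))^3) * indicator {a..} s"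
    proof (cases "a \<le> s")
      case True
      then have "(2 + (s - a)) / (q + (s - a))^3 \<le> 1 / (q + (s - a))\<^sup>2 + 2 / (q + (s - a))^3"
      proof -
        define w where "w = q + (s - a)"
        have "0 < w" "2 + (s - a) \<le> w + 2" using True assms by (auto simp: w_def)
        then have "(2 + (s - a)) / w^3 \<le> (w + 2) / w^3" by (intro divide_right_mono) auto
        also have "\<dots> = 1 / w\<^sup>2 + 2 / w^3"
          using \<open>0 < w\<close> by (simp add: field_simps eval_nat_numeral)
        finally show ?thesis by (simp add: w_def)
      qed
      then show ?thesis by (intro mult_right_mono ennreal_leI) auto
    qed simp
  qed
  also have "\<dots> = ennreal (0 - (- (1 / (q + (a - a)) + 1 / (q + (a - a))\<^sup>2)))"
  proof (rule nn_integral_FTC_atLeast[where F = "\<lambda>s. - (1 / (q + (s - a)) + 1 / (q + (s - a))\<^sup>2)"])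
    show "(\<lambda>s. 1 / (q + (s - a))\<^sup>2 + 2 / (q + (s - a))^3) \<in> borel_measurable borel" by measurable
    show "((\<lambda>s. - (1 / (q + (s - a)) + 1 / (q + (s - a))\<^sup>2)) has_real_derivative
      1 / (q + (s - a))\<^sup>2 + 2 / (q + (s - a))^3) (at s)" if "a \<le> s" for s
    proof -
      have "((\<lambda>s. q + (s - a)) has_real_derivative 1) (at s)"
        by (auto intro!: derivative_eq_intros)
      from has_real_derivative_inverse_sum[OF this] that assms show ?thesis by simp
    qed
    show "0 \<le> 1 / (q + (s - a))\<^sup>2 + 2 / (q + (s - a))^3" if "a \<le> s" for s using that assms by auto
    have l: "filterlim (\<lambda>s. (q - a) + s) at_top at_top"
      by (intro filterlim_tendsto_add_at_top[OF tendsto_const] filterlim_ident)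
    have l2: "filterlim (\<lambda>s. ((q - a) + s)\<^sup>2) at_top at_top"
      by (intro filterlim_pow_at_top l) auto
    have "((\<lambda>s. - (1 / ((q - a) + s) + 1 / ((q - a) + s)\<^sup>2)) \<longlongrightarrow> - (0 + 0)) at_top"
      by (intro tendsto_minus tendsto_add real_tendsto_divide_at_top[OF tendsto_const l] real_tendsto_divide_at_top[OF tendsto_const l2])
    then show "((\<lambda>s. - (1 / (q + (s - a)) + 1 / (q + (s - a))\<^sup>2)) \<longlongrightarrow> 0) at_top"
      by (simp add: algebra_simps)
  qed
  finally show ?thesis by (simp add: add.commute)
qed

text \<open>A function that is not integrable has Bochner integral 0, so the bound survives in that
  case too.\<close>

lemma norm_integral_le_nn_integral:
  fixes f :: "'a \<Rightarrow> 'b :: {banach, second_countable_topology}"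
  shows "ennreal (norm (\<integral>x. f x \<partial>M)) \<le> (\<integral>\<^sup>+x. ennreal (norm (f x)) \<partial>M)"
  by (cases "integrable M f") (auto simp: integral_norm_bound_ennreal not_integrable_integral_eq)

text \<open>Its reciprocal is the decay rate shared by the transforms of \<open>g_fun p\<close> and
  of the measure in assumption (iii); the square of the reciprocal is integrable over the
  plane.\<close>

definition cross_weight :: "real^2 \<Rightarrow> real" where
  "cross_weight u = (1 + \<bar>u $ 1\<bar>) * (1 + \<bar>u $ 2\<bar>)"

lemma cross_weight_ge1: "1 \<le> cross_weight u"
  using mult_mono[of 1 "1 + \<bar>u $ 1\<bar>" 1 "1 + \<bar>u $ 2\<bar>"] by (simp add: cross_weight_def)

lemma cross_weight_pos: "0 < cross_weight u" using cross_weight_ge1[of u] by linarith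

lemma measurable_cross_weight [measurable]: "cross_weight \<in> borel_measurable borel"
  unfolding cross_weight_def[abs_def] by measurable

lemma upper_orthant_in_borel [measurable]: "upper_orthant p \<in> sets borel"
proof -
  have "upper_orthant p = {x \<in> space borel. p $ 1 \<le> x $ 1} \<inter> {x \<in> space borel. p $ 2 \<le> x $ 2}"
    by (auto simp: upper_orthant_def)
  also have "\<dots> \<in> sets borel" by measurable
  finally show ?thesis .
qed

lemma g_fun_measurable [measurable]: "g_fun p \<in> borel_measurable borel"
  unfolding g_fun_def[abs_def] by measurable

lemma g_fun_nonneg: "0 \<le> g_fun p x" by (auto simp: g_fun_def)

text \<open>The constant of \<open>mixed_density_bound\<close> times one factor of
  \<open>nn_integral_shift_cubic\<close> per coordinate.\<close>

definition g_fourier_bound :: "real \<Rightarrow> real" where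
  "g_fourier_bound q = 2048 * (1 / q + 1 / q\<^sup>2)\<^sup>2"

text \<open>As a function of \<open>x\<close> the indicator of the rectangle between
  \<open>p\<close> and \<open>y\<close>; as a function of \<open>y\<close>, for \<open>x\<close>
  beyond \<open>p\<close>, the indicator of the orthant at \<open>x\<close>. The mixture rests on
  this exchange of roles.\<close>

definition box_pair :: "real^2 \<Rightarrow> real^2 \<Rightarrow> real^2 \<Rightarrow> real" where
  "box_pair p x y = indicator {p $ 1..y $ 1} (x $ 1) * indicator {p $ 2..y $ 2} (x $ 2)"

text \<open>For \<open>x\<close> in the orthant at \<open>p\<close> the integral runs over the
  orthant at \<open>x\<close> and returns the value there of the function whose mixed derivative is
  integrated; otherwise every rectangle misses \<open>x\<close>.\<close>

lemma g_fun_mixture: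
  assumes p: "p \<in> pointed_quadrant"
  shows "ennreal (g_fun p x) = (\<integral>\<^sup>+y. ennreal (box_pair p x y * mixed_density (y $ 1) (y $ 2)) \<partial>(lborel :: (real^2) measure))"
proof -
  have [measurable]: "(\<lambda>y::real^2. mixed_density (y $ 1) (y $ 2)) \<in> borel_measurable borel"
    unfolding mixed_density_def by measurable
  show ?thesis
  proof (cases "x \<in> upper_orthant p")
    case True
    then have x: "p $ 1 \<le> x $ 1" "p $ 2 \<le> x $ 2" by (auto simp: upper_orthant_def)
    note sh = max_coord_shift[OF p x]
    have "(\<integral>\<^sup>+y. ennreal (box_pair p x y * mixed_density (y $ 1) (y $ 2)) \<partial>(lborel :: (real^2) measure)) =
      (\<integral>\<^sup>+y. ennreal (mixed_density (y $ 1) (y $ 2)) * indicator {x $ 1..} (y $ 1) * indicator {x $ 2..} (y $ 2) \<partial>(lborel :: (real^2) measure))"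
      using x by (intro nn_integral_cong) (auto simp: box_pair_def indicator_def)
    also have "\<dots> = (\<integral>\<^sup>+s. \<integral>\<^sup>+t. ennreal (mixed_density s t) * indicator {x $ 1..} s * indicator {x $ 2..} t \<partial>lborel \<partial>lborel)"
      by (subst nn_integral_real2) auto
    also have "\<dots> = ennreal (1 / ((x $ 1)^4 + (x $ 2)^4))"
      by (rule nn_integral_mixed_density) (use sh in auto)
    finally show ?thesis using True by (simp add: g_fun_def)
  next
    case False
    then have "box_pair p x y = 0" for y
      by (auto simp: box_pair_def indicator_def upper_orthant_def)
    then show ?thesis using False by (simp add: g_fun_def)
  qed
qed

text \<open>\<open>mixed_density\<close> takes negative values off the quadrant, but there the
  rectangle is empty.\<close>

lemma box_pair_mixed_density_nonneg:
  assumes p: "p \<in> pointed_quadrant"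
  shows "0 \<le> box_pair p x y * mixed_density (y $ 1) (y $ 2)"
proof (cases "box_pair p x y = 0")
  case False
  then have "p $ 1 \<le> y $ 1" "p $ 2 \<le> y $ 2"
    by (auto simp: box_pair_def indicator_def split: if_splits)
  from mixed_density_bound(2)[OF p this] show ?thesis by (auto simp: box_pair_def)
qed auto

text \<open>The exponential of the inner product factorises over the coordinates, so a rectangle
  reduces to two intervals.\<close>

lemma box_pair_integral:
  "cmod (\<integral>x. box_pair p x y *\<^sub>R iexp (u \<bullet> x) \<partial>lborel) * cross_weight u
    \<le> (2 + (y $ 1 - p $ 1)) * (2 + (y $ 2 - p $ 2)) * indicator (upper_orthant p) y"
proof (cases "y \<in> upper_orthant p")
  case True
  then have le: "p $ 1 \<le> y $ 1" "p $ 2 \<le> y $ 2" by (auto simp: upper_orthant_def)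
  let ?f = "\<lambda>k t. indicator {p $ k..y $ k} t *\<^sub>R iexp (u $ k * t)"
  have i: "integrable lborel (?f k)" for k
    by (rule borel_integrable_compact) (auto intro!: continuous_intros)
  have "(\<integral>x. box_pair p x y *\<^sub>R iexp (u \<bullet> x) \<partial>(lborel :: (real^2) measure)) = (\<integral>x. ?f 1 (x $ 1) * ?f 2 (x $ 2) \<partial>(lborel :: (real^2) measure))"
    by (intro Bochner_Integration.integral_cong)
      (auto simp: box_pair_def inner_real2 distrib_left exp_add scaleR_conv_of_real)
  also have "\<dots> = (\<integral>t. ?f 1 t \<partial>lborel) * (\<integral>t. ?f 2 t \<partial>lborel)"
    by (rule integral_real2_mult[OF i i])
  finally have "cmod (\<integral>x. box_pair p x y *\<^sub>R iexp (u \<bullet> x) \<partial>lborel) * cross_weight u =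
    (cmod (\<integral>t. ?f 1 t \<partial>lborel) * (1 + \<bar>u $ 1\<bar>)) * (cmod (\<integral>t. ?f 2 t \<partial>lborel) * (1 + \<bar>u $ 2\<bar>))"
    by (simp add: norm_mult cross_weight_def)
  also have "\<dots> \<le> (2 + (y $ 1 - p $ 1)) * (2 + (y $ 2 - p $ 2))"
    by (intro mult_mono interval_iexp_bound le) (use le in auto)
  finally show ?thesis using True by simp
next
  case False
  then have "box_pair p x y = 0" for x
    by (auto simp: box_pair_def indicator_def upper_orthant_def)
  then show ?thesis using False by simp
qed

text \<open>The integrand bounds \<open>cross_weight u\<close> times the transform of a rectangle,
  weighted with the mixture density; it is free of \<open>u\<close>.\<close>

lemma nn_integral_mixed_density_weight:
  assumes p: "p \<in> pointed_quadrant"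
  shows "(\<integral>\<^sup>+y. ennreal ((2 + (y $ 1 - p $ 1)) * (2 + (y $ 2 - p $ 2)) * indicator (upper_orthant p) y * mixed_density (y $ 1) (y $ 2)) \<partial>(lborel :: (real^2) measure))
    \<le> ennreal (g_fourier_bound (max_coord p))"
proof -
  let ?q = "max_coord p"
  let ?h = "\<lambda>a s. (2 + (s - a)) / (?q + (s - a))^3"
  note q = max_coord_pos[OF p]
  have "(\<integral>\<^sup>+y. ennreal ((2 + (y $ 1 - p $ 1)) * (2 + (y $ 2 - p $ 2)) * indicator (upper_orthant p) y * mixed_density (y $ 1) (y $ 2)) \<partial>(lborel :: (real^2) measure))
    \<le> (\<integral>\<^sup>+y. ennreal 2048 * ((ennreal (?h (p $ 1) (y $ 1)) * indicator {p $ 1..} (y $ 1)) * (ennreal (?h (p $ 2) (y $ 2)) * indicator {p $ 2..} (y $ 2))) \<partial>(lborel :: (real^2) measure))"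
  proof (intro nn_integral_mono)
    fix y :: "real^2"
    show "ennreal ((2 + (y $ 1 - p $ 1)) * (2 + (y $ 2 - p $ 2)) * indicator (upper_orthant p) y * mixed_density (y $ 1) (y $ 2))
      \<le> ennreal 2048 * ((ennreal (?h (p $ 1) (y $ 1)) * indicator {p $ 1..} (y $ 1)) * (ennreal (?h (p $ 2) (y $ 2)) * indicator {p $ 2..} (y $ 2)))"
    proof (cases "y \<in> upper_orthant p")
      case True
      then have le: "p $ 1 \<le> y $ 1" "p $ 2 \<le> y $ 2" by (auto simp: upper_orthant_def)
      have "(2 + (y $ 1 - p $ 1)) * (2 + (y $ 2 - p $ 2)) * mixed_density (y $ 1) (y $ 2) \<le>
        (2 + (y $ 1 - p $ 1)) * (2 + (y $ 2 - p $ 2)) * (2048 * (1 / (?q + (y $ 1 - p $ 1))^3 * (1 / (?q + (y $ 2 - p $ 2))^3)))"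
        using le by (intro mult_left_mono mixed_density_bound(1)[OF p le] mult_nonneg_nonneg) auto
      also have "\<dots> = 2048 * (?h (p $ 1) (y $ 1) * ?h (p $ 2) (y $ 2))"
        by simp
      finally have "ennreal ((2 + (y $ 1 - p $ 1)) * (2 + (y $ 2 - p $ 2)) * mixed_density (y $ 1) (y $ 2)) \<le>
         ennreal (2048 * (?h (p $ 1) (y $ 1) * ?h (p $ 2) (y $ 2)))" by (rule ennreal_leI)
      also have "\<dots> = ennreal 2048 * (ennreal (?h (p $ 1) (y $ 1)) * ennreal (?h (p $ 2) (y $ 2)))"
        using le q by (subst ennreal_mult, simp, simp, subst ennreal_mult) auto
      finally show ?thesis using True le by simp
    qed simp
  qed
  also have "\<dots> = ennreal 2048 * ((\<integral>\<^sup>+s. ennreal (?h (p $ 1) s) * indicator {p $ 1..} s \<partial>lborel) * (\<integral>\<^sup>+s. ennreal (?h (p $ 2) s) * indicator {p $ 2..} s \<partial>lborel))"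
    by (subst nn_integral_cmult, measurable, subst nn_integral_real2_mult) auto
  also have "\<dots> \<le> ennreal 2048 * (ennreal (1 / ?q + 1 / ?q\<^sup>2) * ennreal (1 / ?q + 1 / ?q\<^sup>2))"
    by (intro mult_left_mono mult_mono nn_integral_shift_cubic q) auto
  also have "\<dots> = ennreal (g_fourier_bound ?q)"
    using q by (subst ennreal_mult'[symmetric], simp, subst ennreal_mult'[symmetric])
      (auto simp: g_fourier_bound_def power2_eq_square)
  finally show ?thesis .
qed

text \<open>The decay in \<open>u\<close> is lost if absolute values of \<open>g_fun p\<close> are
  taken. It appears when each rectangle of the mixture is transformed first and the results are
  integrated over the mixture afterwards.\<close>

lemma
  assumes p: "p \<in> pointed_quadrant"
  shows g_fun_integrable: "integrable lborel (g_fun p)"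
    and fourier_g_fun_bound: "cmod (fourier (\<lambda>x. complex_of_real (g_fun p x)) u) * cross_weight u \<le> g_fourier_bound (max_coord p)"
proof -
  have [measurable]: "(\<lambda>y::real^2. mixed_density (y $ 1) (y $ 2)) \<in> borel_measurable borel"
    unfolding mixed_density_def by measurable
  have [measurable]: "(\<lambda>(x, y). box_pair p x y) \<in> borel_measurable (borel \<Otimes>\<^sub>M borel)"
  proof -
    have "(\<lambda>(x, y). box_pair p x y) = (\<lambda>z. (if p $ 1 \<le> fst z $ 1 \<and> fst z $ 1 \<le> snd z $ 1 \<and> p $ 2 \<le> fst z $ 2 \<and> fst z $ 2 \<le> snd z $ 2 then 1 else 0))"
      by (auto simp: box_pair_def indicator_def fun_eq_iff)
    then show ?thesis by simp
  qed
  have m [measurable]: "(\<lambda>(x, y). box_pair p x y * mixed_density (y $ 1) (y $ 2)) \<in> borel_measurable (lborel \<Otimes>\<^sub>M lborel)"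
    by measurable
  let ?k = "\<lambda>x y. box_pair p x y * mixed_density (y $ 1) (y $ 2)"
  have nk: "0 \<le> ?k x y" for x y by (rule box_pair_mixed_density_nonneg[OF p])
  have inner: "(\<integral>\<^sup>+x. ennreal (?k x y) \<partial>(lborel :: (real^2) measure)) \<le> ennreal ((2 + (y $ 1 - p $ 1)) * (2 + (y $ 2 - p $ 2)) * indicator (upper_orthant p) y * mixed_density (y $ 1) (y $ 2))" for y
  proof (cases "y \<in> upper_orthant p")
    case True
    then have le: "p $ 1 \<le> y $ 1" "p $ 2 \<le> y $ 2" by (auto simp: upper_orthant_def)
    have "(\<integral>\<^sup>+x. ennreal (?k x y) \<partial>(lborel :: (real^2) measure)) = (\<integral>\<^sup>+x. ennreal (mixed_density (y $ 1) (y $ 2)) * (indicator {p $ 1..y $ 1} (x $ 1) * indicator {p $ 2..y $ 2} (x $ 2)) \<partial>(lborel :: (real^2) measure))"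
      by (intro nn_integral_cong) (auto simp: box_pair_def indicator_def)
    also have "\<dots> = ennreal (mixed_density (y $ 1) (y $ 2)) * (ennreal (y $ 1 - p $ 1) * ennreal (y $ 2 - p $ 2))"
      using le by (subst nn_integral_cmult, measurable, subst nn_integral_real2_mult) auto
    also have "\<dots> = ennreal ((y $ 1 - p $ 1) * (y $ 2 - p $ 2) * mixed_density (y $ 1) (y $ 2))"
      using le mixed_density_bound(2)[OF p le] by (simp add: mult_ac flip: ennreal_mult)
    also have "\<dots> \<le> ennreal ((2 + (y $ 1 - p $ 1)) * (2 + (y $ 2 - p $ 2)) * mixed_density (y $ 1) (y $ 2))"
      using le mixed_density_bound(2)[OF p le] by (intro ennreal_leI mult_right_mono mult_mono) auto
    finally show ?thesis using True by simp
  next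
    case False
    then have "box_pair p x y = 0" for x
      by (auto simp: box_pair_def indicator_def upper_orthant_def)
    then show ?thesis by simp
  qed
  \<comment> \<open>The area of a rectangle is below the factor that bounds its transform, so one
    integral serves both claims.\<close>
  have tot: "(\<integral>\<^sup>+y. \<integral>\<^sup>+x. ennreal (?k x y) \<partial>lborel \<partial>lborel) \<le> ennreal (g_fourier_bound (max_coord p))"
    using nn_integral_mono[of lborel, OF inner] nn_integral_mixed_density_weight[OF p] by (rule order_trans)
  have g_eq: "ennreal (g_fun p x) = (\<integral>\<^sup>+y. ennreal (?k x y) \<partial>lborel)" for x
    by (rule g_fun_mixture[OF p])
  have "(\<integral>\<^sup>+x. ennreal (g_fun p x) \<partial>lborel) = (\<integral>\<^sup>+y. \<integral>\<^sup>+x. ennreal (?k x y) \<partial>lborel \<partial>lborel)"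
    unfolding g_eq by (rule lborel_pair.Fubini') measurable
  also have "\<dots> < \<infinity>" using tot by (simp add: le_less_trans)
  finally show gi: "integrable lborel (g_fun p)"
    by (intro integrableI_nonneg) (auto simp: g_fun_nonneg)
  have ik: "integrable lborel (?k x)" "(\<integral>y. ?k x y \<partial>lborel) = g_fun p x" for x
  proof -
    have "(\<integral>\<^sup>+y. ennreal (?k x y) \<partial>lborel) < \<infinity>" by (simp flip: g_eq)
    then show "integrable lborel (?k x)" using nk by (intro integrableI_nonneg) auto
    show "(\<integral>y. ?k x y \<partial>lborel) = g_fun p x"
      using nk by (subst integral_eq_nn_integral) (auto simp: g_fun_nonneg simp flip: g_eq)
  qed
  let ?F = "\<lambda>x y. ?k x y *\<^sub>R iexp (u \<bullet> x)"
  have iF: "integrable (lborel \<Otimes>\<^sub>M lborel) (\<lambda>(x, y). ?F x y)"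
  proof (rule lborel_pair.Fubini_integrable)
    show "(\<lambda>(x, y). ?F x y) \<in> borel_measurable (lborel \<Otimes>\<^sub>M lborel)"
      by measurable
    show "integrable lborel (\<lambda>x. \<integral>y. norm (case (x, y) of (x, y) \<Rightarrow> ?F x y) \<partial>lborel)"
      using gi ik(2) nk by (simp add: abs_mult[symmetric] del: abs_mult)
    show "AE x in lborel. integrable lborel (\<lambda>y. case (x, y) of (x, y) \<Rightarrow> ?F x y)"
      using ik(1) by auto
  qed
  have "fourier (\<lambda>x. complex_of_real (g_fun p x)) u = (\<integral>x. \<integral>y. ?F x y \<partial>lborel \<partial>lborel)"
  proof -
    have "(\<integral>y. ?F x y \<partial>lborel) = g_fun p x *\<^sub>R iexp (u \<bullet> x)" for x
      unfolding ik(2)[symmetric] by (rule integral_scaleR_left) (use ik(1) in auto)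
    then show ?thesis by (simp add: fourier_def scaleR_conv_of_real mult.commute)
  qed
  also have "\<dots> = (\<integral>y. \<integral>x. ?F x y \<partial>lborel \<partial>lborel)"
    using lborel_pair.Fubini_integral[OF iF] by simp
  also have "\<dots> = (\<integral>y. mixed_density (y $ 1) (y $ 2) *\<^sub>R (\<integral>x. box_pair p x y *\<^sub>R iexp (u \<bullet> x) \<partial>(lborel :: (real^2) measure)) \<partial>(lborel :: (real^2) measure))"
    by (subst integral_scaleR_right[symmetric]) (auto simp: mult.commute)
  finally have F: "fourier (\<lambda>x. complex_of_real (g_fun p x)) u = (\<integral>y. mixed_density (y $ 1) (y $ 2) *\<^sub>R (\<integral>x. box_pair p x y *\<^sub>R iexp (u \<bullet> x) \<partial>(lborel :: (real^2) measure)) \<partial>(lborel :: (real^2) measure))" .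
  \<comment> \<open>The factor \<open>cross_weight u\<close> is moved under the integral, where it
    meets the rectangles one by one.\<close>
  have "ennreal (cmod (fourier (\<lambda>x. complex_of_real (g_fun p x)) u) * cross_weight u) =
    ennreal (cmod (\<integral>y. cross_weight u *\<^sub>R (mixed_density (y $ 1) (y $ 2) *\<^sub>R (\<integral>x. box_pair p x y *\<^sub>R iexp (u \<bullet> x) \<partial>(lborel :: (real^2) measure))) \<partial>(lborel :: (real^2) measure)))"
    unfolding F integral_scaleR_right using cross_weight_pos[of u] by (simp add: mult.commute)
  also have "\<dots> \<le> (\<integral>\<^sup>+y. ennreal (cmod (cross_weight u *\<^sub>R (mixed_density (y $ 1) (y $ 2) *\<^sub>R (\<integral>x. box_pair p x y *\<^sub>R iexp (u \<bullet> x) \<partial>(lborel :: (real^2) measure))))) \<partial>(lborel :: (real^2) measure))"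
    by (rule norm_integral_le_nn_integral)
  also have "\<dots> \<le> (\<integral>\<^sup>+y. ennreal ((2 + (y $ 1 - p $ 1)) * (2 + (y $ 2 - p $ 2)) * indicator (upper_orthant p) y * mixed_density (y $ 1) (y $ 2)) \<partial>(lborel :: (real^2) measure))"
  proof (intro nn_integral_mono ennreal_leI)
    fix y :: "real^2"
    have b: "cmod (\<integral>x. box_pair p x y *\<^sub>R iexp (u \<bullet> x) \<partial>lborel) * cross_weight u
      \<le> (2 + (y $ 1 - p $ 1)) * (2 + (y $ 2 - p $ 2)) * indicator (upper_orthant p) y" by (rule box_pair_integral)
    show "cmod (cross_weight u *\<^sub>R (mixed_density (y $ 1) (y $ 2) *\<^sub>R (\<integral>x. box_pair p x y *\<^sub>R iexp (u \<bullet> x) \<partial>(lborel :: (real^2) measure)))) \<le>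
      (2 + (y $ 1 - p $ 1)) * (2 + (y $ 2 - p $ 2)) * indicator (upper_orthant p) y * mixed_density (y $ 1) (y $ 2)"
    proof (cases "y \<in> upper_orthant p")
      case True
      then have "0 \<le> mixed_density (y $ 1) (y $ 2)"
        using mixed_density_bound(2)[OF p] by (auto simp: upper_orthant_def)
      then show ?thesis using mult_right_mono[OF b, of "mixed_density (y $ 1) (y $ 2)"] cross_weight_pos[of u]
        by (simp add: mult_ac)
    next
      case False
      then have "box_pair p x y = 0" for x
        by (auto simp: box_pair_def indicator_def upper_orthant_def)
      then show ?thesis using False by simp
    qed
  qed
  also have "\<dots> \<le> ennreal (g_fourier_bound (max_coord p))" by (rule nn_integral_mixed_density_weight[OF p])
  finally show "cmod (fourier (\<lambda>x. complex_of_real (g_fun p x)) u) * cross_weight u \<le> g_fourier_bound (max_coord p)"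
    by (subst (asm) ennreal_le_iff) (auto simp: g_fourier_bound_def)
qed

definition norm_weight :: "real^2 \<Rightarrow> real" where
  "norm_weight p = min ((norm p)\<^sup>2) ((norm p)^4)"

text \<open>With \<open>q = max_coord p\<close> the bound is of order \<open>q^-4\<close> for
  \<open>q \<le> 1\<close> and of order \<open>q^-2\<close> for \<open>q > 1\<close>, while
  \<open>(norm p)^2 \<le> 2 q^2\<close>; hence the minimum of two powers in the weight. The first
  case gives the constant \<open>4 * 2048 * 4\<close>.\<close>

lemma norm_weight_g_fourier_bound:
  assumes p: "p \<in> pointed_quadrant"
  shows "norm_weight p * g_fourier_bound (max_coord p) \<le> 32768"
proof -
  let ?q = "max_coord p"
  note q = max_coord_pos[OF p]
  have nn: "0 \<le> p $ 1" "0 \<le> p $ 2" using p by (auto simp: pointed_quadrant_def)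
  have "(p $ 1)\<^sup>2 \<le> ?q\<^sup>2" "(p $ 2)\<^sup>2 \<le> ?q\<^sup>2"
    using nn by (auto simp: max_coord_def intro!: power_mono)
  then have n2: "(norm p)\<^sup>2 \<le> 2 * ?q\<^sup>2" by (simp add: norm_real2_sq)
  from power_mono[OF this, of 2] have n4: "(norm p)^4 \<le> 4 * ?q^4"
    by (simp add: power_mult_distrib flip: power_mult)
  show ?thesis
  proof (cases "?q \<le> 1")
    case True
    have "g_fourier_bound ?q \<le> 2048 * (2 / ?q\<^sup>2)\<^sup>2"
      unfolding g_fourier_bound_def using q True
      by (intro mult_left_mono power_mono) (auto simp: field_simps power2_eq_square intro!: add_nonneg_nonneg)
    then have "norm_weight p * g_fourier_bound ?q \<le> (4 * ?q^4) * (2048 * (2 / ?q\<^sup>2)\<^sup>2)"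
      using n4 by (intro mult_mono) (auto simp: norm_weight_def g_fourier_bound_def)
    also have "\<dots> = 32768" using q by (simp add: power_divide flip: power_mult)
    finally show ?thesis .
  next
    case False
    have "g_fourier_bound ?q \<le> 2048 * (2 / ?q)\<^sup>2"
      unfolding g_fourier_bound_def using q False
      by (intro mult_left_mono power_mono) (auto simp: field_simps power2_eq_square intro!: add_nonneg_nonneg)
    then have "norm_weight p * g_fourier_bound ?q \<le> (2 * ?q\<^sup>2) * (2048 * (2 / ?q)\<^sup>2)"
      using n2 by (intro mult_mono) (auto simp: norm_weight_def g_fourier_bound_def)
    also have "\<dots> \<le> 32768" using q by (simp add: power_divide)
    finally show ?thesis .
  qed
qed

subsection \<open>A Parseval identity for finite measures\<close>

definition gauss2 :: "real^2 \<Rightarrow> real" where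
  "gauss2 x = std_normal_density (x $ 1) * std_normal_density (x $ 2)"

lemma gauss2_pos: "0 < gauss2 x"
  by (simp add: gauss2_def normal_density_pos)

lemma continuous_gauss2: "continuous_on UNIV gauss2"
  unfolding gauss2_def[abs_def] std_normal_density_def by (intro continuous_intros) auto

lemma measurable_gauss2 [measurable]: "gauss2 \<in> borel_measurable borel"
  by (rule borel_measurable_continuous_onI[OF continuous_gauss2])

lemma gauss2_0: "gauss2 0 = 1 / (2 * pi)"
  by (simp add: gauss2_def std_normal_density_def)

lemma gauss2_bound: "gauss2 x \<le> gauss2 0"
proof -
  have "std_normal_density t \<le> std_normal_density 0" for t
    by (simp add: std_normal_density_def divide_right_mono)
  then show ?thesis unfolding gauss2_def by (intro mult_mono) auto
qed

lemma
  shows integrable_std_normal_density: "integrable lborel std_normal_density"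
    and integral_std_normal_density: "(\<integral>x. std_normal_density x \<partial>lborel) = 1"
  using integrable_std_normal_distribution_moment[of 0] prob_space.prob_space[OF prob_space_normal_density[of 1 0]]
  by (auto simp: integrable_density integral_normal_density)

text \<open>Up to scaling the Gaussian density is its own Fourier transform, so no inversion theorem is
  needed below.\<close>

lemma has_bochner_integral_gauss2:
  assumes "0 < e"
  shows "has_bochner_integral lborel (\<lambda>u. gauss2 (e *\<^sub>R u) *\<^sub>R iexp (u \<bullet> z)) ((2 * pi / e\<^sup>2) *\<^sub>R gauss2 ((1 / e) *\<^sub>R z))"
proof -
  have 1: "has_bochner_integral lborel (\<lambda>v. std_normal_density (e * v) *\<^sub>R iexp (v * t))
      ((sqrt (2 * pi) / e) * std_normal_density (t / e))" for t :: real
  proof -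
    have i0: "integrable lborel (\<lambda>v. std_normal_density v *\<^sub>R iexp (t / e * v))"
      by (rule Bochner_Integration.integrable_bound[OF integrable_std_normal_density]) auto
    have "(\<integral>v. std_normal_density v *\<^sub>R iexp (t / e * v) \<partial>lborel) = exp (- ((t / e)\<^sup>2) / 2)"
      using fun_cong[OF char_std_normal_distribution, of "t / e"]
      by (simp add: char_def integral_density)
    then have "has_bochner_integral lborel (\<lambda>v. std_normal_density v *\<^sub>R iexp (t / e * v)) (exp (- ((t / e)\<^sup>2) / 2))"
      using i0 by (simp add: has_bochner_integral_iff)
    from lborel_has_bochner_integral_real_affine_iff[THEN iffD1, OF _ this, of e 0]
    have "has_bochner_integral lborel (\<lambda>v. std_normal_density (e * v) *\<^sub>R iexp (t / e * (e * v))) (exp (- ((t / e)\<^sup>2) / 2) /\<^sub>R e)"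
      using assms by (simp add: scaleR_conv_of_real)
    moreover have "t / e * (e * v) = v * t" for v using assms by simp
    moreover have "exp (- ((t / e)\<^sup>2) / 2) /\<^sub>R e = complex_of_real ((sqrt (2 * pi) / e) * std_normal_density (t / e))"
      using assms by (simp add: std_normal_density_def scaleR_conv_of_real exp_of_real field_simps flip: of_real_exp)
    ultimately show ?thesis by (simp only:)
  qed
  let ?f = "\<lambda>t v. std_normal_density (e * v) *\<^sub>R iexp (v * t)"
  have eq: "gauss2 (e *\<^sub>R u) *\<^sub>R iexp (u \<bullet> z) = ?f (z $ 1) (u $ 1) * ?f (z $ 2) (u $ 2)" for u
  proof -
    have "gauss2 (e *\<^sub>R u) = std_normal_density (e * u $ 1) * std_normal_density (e * u $ 2)"
      by (simp add: gauss2_def)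
    then show ?thesis
      by (simp add: inner_real2 distrib_left exp_add scaleR_conv_of_real)
  qed
  have "integrable lborel (\<lambda>u::real^2. ?f (z $ 1) (u $ 1) * ?f (z $ 2) (u $ 2))"
    using 1 by (intro integrable_real2_mult) (auto simp: has_bochner_integral_iff)
  moreover have "(\<integral>u. ?f (z $ 1) (u $ 1) * ?f (z $ 2) (u $ 2) \<partial>(lborel :: (real^2) measure)) =
     ((sqrt (2 * pi) / e) * std_normal_density (z $ 1 / e)) * ((sqrt (2 * pi) / e) * std_normal_density (z $ 2 / e))"
    using 1 by (subst integral_real2_mult) (auto simp: has_bochner_integral_iff)
  moreover have "\<dots> = (2 * pi / e\<^sup>2) *\<^sub>R gauss2 ((1 / e) *\<^sub>R z)"
  proof -
    have "sqrt (2 * pi) * sqrt (2 * pi) = 2 * pi" by simp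
    then have "(sqrt (2 * pi) / e) * std_normal_density (z $ 1 / e) * ((sqrt (2 * pi) / e) * std_normal_density (z $ 2 / e))
      = (2 * pi / e\<^sup>2) * gauss2 ((1 / e) *\<^sub>R z)"
      by (simp add: gauss2_def power2_eq_square field_simps)
    then show ?thesis by (simp flip: of_real_mult)
  qed
  ultimately show ?thesis unfolding eq by (simp add: has_bochner_integral_iff)
qed

lemma
  shows integrable_gauss2: "integrable lborel gauss2"
    and integral_gauss2: "(\<integral>x. gauss2 x \<partial>lborel) = 1"
proof -
  show "integrable lborel gauss2" "(\<integral>x. gauss2 x \<partial>lborel) = 1"
    unfolding gauss2_def[abs_def] using integrable_std_normal_density integral_std_normal_density
    by (auto simp: integrable_real2_mult integral_real2_mult)
qed

lemma lborel_reflect_scale: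
  fixes f :: "real^2 \<Rightarrow> 'b :: {banach, second_countable_topology}"
  assumes [measurable]: "f \<in> borel_measurable borel" and e: "0 < e"
  shows "(\<integral>x. f x \<partial>lborel) = e\<^sup>2 *\<^sub>R (\<integral>z. f (y - e *\<^sub>R z) \<partial>lborel)"
proof -
  have "(\<integral>x. f x \<partial>lborel) = (\<integral>x. f x \<partial>density (distr lborel borel (\<lambda>x::real^2. y + (- e) *\<^sub>R x)) (\<lambda>_. ennreal (\<bar>- e\<bar> ^ DIM(real^2))))"
    using e by (subst lborel_affine[of "- e" y]) auto
  also have "\<dots> = e\<^sup>2 *\<^sub>R (\<integral>z. f (y - e *\<^sub>R z) \<partial>lborel)"
    using e by (simp add: integral_density integral_distr)
  finally show ?thesis .
qed

text \<open>The Gaussian factor makes the integral over \<open>u\<close>, \<open>x\<close> and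
  \<open>y\<close> absolutely convergent, so \<open>u\<close> may be integrated first. By
  \<open>has_bochner_integral_gauss2\<close> this leaves a Gaussian of width \<open>e\<close> in
  \<open>y - x\<close>, that is an average of \<open>g\<close> around \<open>y\<close>. The argument
  \<open>- u\<close> merges the two exponentials into one of \<open>y - x\<close>.\<close>

lemma fourier_smoothed:
  fixes g :: "real^2 \<Rightarrow> real"
  assumes fin: "finite_measure \<mu>" and sets_mu: "sets \<mu> = sets borel"
    and g: "integrable lborel g" and e: "0 < e"
  shows "(\<integral>u. gauss2 (e *\<^sub>R u) *\<^sub>R (fourier (\<lambda>x. complex_of_real (g x)) (- u) * fourier_measure \<mu> u) \<partial>lborel) =
    complex_of_real (2 * pi * (\<integral>y. (\<integral>z. g (y - e *\<^sub>R z) * gauss2 z \<partial>lborel) \<partial>\<mu>))"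
proof -
  interpret mu: finite_measure \<mu> by (rule fin)
  note [measurable_cong] = sets_mu
  have [measurable]: "g \<in> borel_measurable borel" using g by auto
  interpret P: pair_sigma_finite lborel \<mu> ..
  let ?N = "lborel \<Otimes>\<^sub>M \<mu>"
  interpret N: sigma_finite_measure ?N by (rule P.P.sigma_finite_measure_axioms)
  interpret Q: pair_sigma_finite lborel ?N ..
  have gN: "integrable ?N (\<lambda>(x, y). g x)"
  proof (rule P.Fubini_integrable)
    show "(\<lambda>(x, y). g x) \<in> borel_measurable ?N" by measurable
    show "integrable lborel (\<lambda>x. LINT y|\<mu>. norm (case (x, y) of (x, y) \<Rightarrow> g x))"
      using g by simp
    show "AE x in lborel. integrable \<mu> (\<lambda>y. case (x, y) of (x, y) \<Rightarrow> g x)" by simp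
  qed
  have ig: "integrable ?N (\<lambda>(x, y). g x *\<^sub>R iexp (u \<bullet> (y - x)))" for u
    by (rule Bochner_Integration.integrable_bound[OF gN]) (auto simp: split_beta' norm_mult)
  have prodN: "fourier (\<lambda>x. complex_of_real (g x)) (- u) * fourier_measure \<mu> u = (\<integral>z. (case z of (x, y) \<Rightarrow> g x *\<^sub>R iexp (u \<bullet> (y - x))) \<partial>?N)" for u
  proof -
    have "(\<integral>z. (case z of (x, y) \<Rightarrow> g x *\<^sub>R iexp (u \<bullet> (y - x))) \<partial>?N) = (\<integral>x. \<integral>y. g x *\<^sub>R iexp (u \<bullet> (y - x)) \<partial>\<mu> \<partial>lborel)"
      using P.integral_fst'[OF ig[of u]] by simp
    also have "\<dots> = (\<integral>x. (iexp (- u \<bullet> x) * complex_of_real (g x)) * (\<integral>y. iexp (u \<bullet> y) \<partial>\<mu>) \<partial>lborel)"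
      by (subst integral_mult_right_zero[symmetric])
        (simp add: inner_diff_right right_diff_distrib exp_diff exp_minus scaleR_conv_of_real field_simps)
    also have "\<dots> = fourier (\<lambda>x. complex_of_real (g x)) (- u) * fourier_measure \<mu> u"
      by (simp add: fourier_def fourier_measure_def)
    finally show ?thesis by simp
  qed
  have ge: "integrable lborel (\<lambda>u. gauss2 (e *\<^sub>R u))"
  proof -
    have "integrable lborel (\<lambda>u. norm (gauss2 (e *\<^sub>R u) *\<^sub>R iexp (u \<bullet> 0)))"
      using has_bochner_integral_gauss2[OF e, of 0] by (intro integrable_norm) (simp only: has_bochner_integral_iff)
    then show ?thesis using gauss2_pos by (simp add: abs_of_pos)
  qed
  have iT: "integrable (lborel \<Otimes>\<^sub>M ?N) (\<lambda>(u, z). gauss2 (e *\<^sub>R u) *\<^sub>R (case z of (x, y) \<Rightarrow> g x *\<^sub>R iexp (u \<bullet> (y - x))))"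
  proof (rule Q.Fubini_integrable)
    show "(\<lambda>(u, z). gauss2 (e *\<^sub>R u) *\<^sub>R (case z of (x, y) \<Rightarrow> g x *\<^sub>R iexp (u \<bullet> (y - x)))) \<in> borel_measurable (lborel \<Otimes>\<^sub>M ?N)"
      by measurable
    have "norm (gauss2 (e *\<^sub>R u) *\<^sub>R (case z of (x, y) \<Rightarrow> g x *\<^sub>R iexp (u \<bullet> (y - x)))) = gauss2 (e *\<^sub>R u) * \<bar>g (fst z)\<bar>" for u :: "real^2" and z :: "(real^2) \<times> (real^2)"
      using gauss2_pos[of "e *\<^sub>R u"] by (cases z) (simp add: abs_mult)
    then show "integrable lborel (\<lambda>u. LINT z|?N. norm (case (u, z) of (u, z) \<Rightarrow> gauss2 (e *\<^sub>R u) *\<^sub>R (case z of (x, y) \<Rightarrow> g x *\<^sub>R iexp (u \<bullet> (y - x)))))"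
      using ge by simp
    show "AE u in lborel. integrable ?N (\<lambda>z. case (u, z) of (u, z) \<Rightarrow> gauss2 (e *\<^sub>R u) *\<^sub>R (case z of (x, y) \<Rightarrow> g x *\<^sub>R iexp (u \<bullet> (y - x))))"
      using ig by simp
  qed
  let ?H = "\<lambda>x y. g x * ((2 * pi / e\<^sup>2) * gauss2 ((1 / e) *\<^sub>R (y - x)))"
  have "(\<integral>u. gauss2 (e *\<^sub>R u) *\<^sub>R (fourier (\<lambda>x. complex_of_real (g x)) (- u) * fourier_measure \<mu> u) \<partial>lborel) =
    (\<integral>u. \<integral>z. gauss2 (e *\<^sub>R u) *\<^sub>R (case z of (x, y) \<Rightarrow> g x *\<^sub>R iexp (u \<bullet> (y - x))) \<partial>?N \<partial>lborel)"
    unfolding prodN by simp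
  also have "\<dots> = (\<integral>z. \<integral>u. gauss2 (e *\<^sub>R u) *\<^sub>R (case z of (x, y) \<Rightarrow> g x *\<^sub>R iexp (u \<bullet> (y - x))) \<partial>lborel \<partial>?N)"
    using Q.Fubini_integral[OF iT] by simp
  also have "\<dots> = (\<integral>z. complex_of_real (case z of (x, y) \<Rightarrow> ?H x y) \<partial>?N)"
  proof (intro Bochner_Integration.integral_cong refl)
    fix z :: "(real^2) \<times> (real^2)"
    obtain x y where z: "z = (x, y)" by force
    have "(\<integral>u. gauss2 (e *\<^sub>R u) *\<^sub>R (g x *\<^sub>R iexp (u \<bullet> (y - x))) \<partial>lborel) = (\<integral>u. g x *\<^sub>R (gauss2 (e *\<^sub>R u) *\<^sub>R iexp (u \<bullet> (y - x))) \<partial>lborel)"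
      by (simp add: mult_ac scaleR_conv_of_real)
    also have "\<dots> = g x *\<^sub>R ((2 * pi / e\<^sup>2) *\<^sub>R gauss2 ((1 / e) *\<^sub>R (y - x)))"
      unfolding integral_scaleR_right has_bochner_integral_integral_eq[OF has_bochner_integral_gauss2[OF e]]
      by (simp add: scaleR_conv_of_real)
    finally show "(\<integral>u. gauss2 (e *\<^sub>R u) *\<^sub>R (case z of (x, y) \<Rightarrow> g x *\<^sub>R iexp (u \<bullet> (y - x))) \<partial>lborel) = complex_of_real (case z of (x, y) \<Rightarrow> ?H x y)"
      by (simp add: z)
  qed
  also have "\<dots> = complex_of_real (\<integral>z. (case z of (x, y) \<Rightarrow> ?H x y) \<partial>?N)"
    by (rule integral_complex_of_real)
  also have "(\<integral>z. (case z of (x, y) \<Rightarrow> ?H x y) \<partial>?N) = (\<integral>y. \<integral>x. ?H x y \<partial>lborel \<partial>\<mu>)"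
  proof (rule P.integral_snd[symmetric])
    have "integrable ?N (\<lambda>z. (2 * pi / e\<^sup>2 * gauss2 0) * (case z of (x, y) \<Rightarrow> g x))"
      using gN by simp
    then show "integrable ?N (\<lambda>(x, y). ?H x y)"
    proof (rule Bochner_Integration.integrable_bound)
      show "(\<lambda>(x, y). ?H x y) \<in> borel_measurable ?N" by measurable
      show "AE z in ?N. norm (case z of (x, y) \<Rightarrow> ?H x y) \<le> norm (2 * pi / e\<^sup>2 * gauss2 0 * (case z of (x, y) \<Rightarrow> g x))"
      proof (rule AE_I2)
        fix z :: "(real^2) \<times> (real^2)"
        obtain x y where z: "z = (x, y)" by force
        have "\<bar>?H x y\<bar> = \<bar>g x\<bar> * ((2 * pi / e\<^sup>2) * gauss2 ((1 / e) *\<^sub>R (y - x)))"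
          using gauss2_pos[of "(1 / e) *\<^sub>R (y - x)"] by (simp add: abs_mult)
        also have "\<dots> \<le> \<bar>g x\<bar> * ((2 * pi / e\<^sup>2) * gauss2 0)"
          by (intro mult_left_mono gauss2_bound) auto
        also have "\<dots> = \<bar>2 * pi / e\<^sup>2 * gauss2 0 * g x\<bar>"
          using gauss2_pos[of 0] by (simp add: abs_mult)
        finally show "norm (case z of (x, y) \<Rightarrow> ?H x y) \<le> norm (2 * pi / e\<^sup>2 * gauss2 0 * (case z of (x, y) \<Rightarrow> g x))"
          by (simp add: z)
      qed
    qed
  qed
  also have "\<dots> = (\<integral>y. 2 * pi * (\<integral>z. g (y - e *\<^sub>R z) * gauss2 z \<partial>lborel) \<partial>\<mu>)"
  proof (intro Bochner_Integration.integral_cong refl)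
    fix y
    \<comment> \<open>After the substitution \<open>x = y - e z\<close> the Jacobian cancels the
      factor \<open>1 / e^2\<close>.\<close>
    have "(\<integral>x. ?H x y \<partial>lborel) = e\<^sup>2 *\<^sub>R (\<integral>z. ?H (y - e *\<^sub>R z) y \<partial>lborel)"
      by (rule lborel_reflect_scale[OF _ e]) measurable
    also have "\<dots> = e\<^sup>2 *\<^sub>R (\<integral>z. (2 * pi / e\<^sup>2) * (g (y - e *\<^sub>R z) * gauss2 z) \<partial>lborel)"
      using e by (simp add: mult_ac)
    also have "\<dots> = 2 * pi * (\<integral>z. g (y - e *\<^sub>R z) * gauss2 z \<partial>lborel)"
      unfolding integral_mult_right_zero using e by simp
    finally show "(\<integral>x. ?H x y \<partial>lborel) = 2 * pi * (\<integral>z. g (y - e *\<^sub>R z) * gauss2 z \<partial>lborel)" .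
  qed
  finally show ?thesis by simp
qed

text \<open>The width \<open>e\<close> of the Gaussian tends to 0. On the Fourier side the assumed
  integrability dominates; on the other side the averages of the bounded \<open>g\<close> tend to
  \<open>g y\<close> at every point of continuity. The constant comes from
  \<open>gauss2 0 = 1 / (2 pi)\<close> against the \<open>2 pi\<close> of
  \<open>fourier_smoothed\<close>.\<close>

lemma parseval_finite_measure:
  fixes g :: "real^2 \<Rightarrow> real"
  assumes fin: "finite_measure \<mu>" and sets_mu: "sets \<mu> = sets borel"
    and g: "integrable lborel g" and bnd: "\<And>x. \<bar>g x\<bar> \<le> B" and cont: "AE y in \<mu>. isCont g y"
    and int: "integrable lborel (\<lambda>u. fourier (\<lambda>x. complex_of_real (g x)) (- u) * fourier_measure \<mu> u)"
  shows "complex_of_real (\<integral>y. g y \<partial>\<mu>) = complex_of_real (1 / (2 * pi)\<^sup>2) *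
    (\<integral>u. fourier (\<lambda>x. complex_of_real (g x)) (- u) * fourier_measure \<mu> u \<partial>lborel)"
proof -
  interpret mu: finite_measure \<mu> by (rule fin)
  note [measurable_cong] = sets_mu
  have [measurable]: "g \<in> borel_measurable borel" using g by auto
  let ?F = "\<lambda>u. fourier (\<lambda>x. complex_of_real (g x)) (- u) * fourier_measure \<mu> u"
  define e where "e n = inverse (real (Suc n))" for n
  have e: "0 < e n" for n by (simp add: e_def)
  have e0: "e \<longlonglongrightarrow> 0" unfolding e_def by (rule LIMSEQ_inverse_real_of_nat)
  have L: "(\<lambda>n. \<integral>u. gauss2 (e n *\<^sub>R u) *\<^sub>R ?F u \<partial>lborel) \<longlonglongrightarrow> (\<integral>u. gauss2 0 *\<^sub>R ?F u \<partial>lborel)"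
  proof (rule integral_dominated_convergence)
    show "integrable lborel (\<lambda>u. gauss2 0 * norm (?F u))" using int by simp
    have "isCont gauss2 0" using continuous_gauss2 by (simp add: continuous_on_eq_continuous_at)
    then have "(\<lambda>n. gauss2 (e n *\<^sub>R u)) \<longlonglongrightarrow> gauss2 0" for u
      by (rule isCont_tendsto_compose) (use tendsto_scaleR[OF e0 tendsto_const, of u] in simp)
    then show "AE u in lborel. (\<lambda>n. gauss2 (e n *\<^sub>R u) *\<^sub>R ?F u) \<longlonglongrightarrow> gauss2 0 *\<^sub>R ?F u"
      by (intro AE_I2 tendsto_scaleR tendsto_const)
    show "AE u in lborel. norm (gauss2 (e n *\<^sub>R u) *\<^sub>R ?F u) \<le> gauss2 0 * norm (?F u)" for n
      using gauss2_bound gauss2_pos by (auto simp: abs_of_pos intro!: mult_right_mono)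
  qed (use int in \<open>auto intro!: borel_measurable_scaleR borel_measurable_integrable measurable_compose[OF _ measurable_gauss2]\<close>)
  have R: "(\<lambda>n. \<integral>y. (\<integral>z. g (y - e n *\<^sub>R z) * gauss2 z \<partial>lborel) \<partial>\<mu>) \<longlonglongrightarrow> (\<integral>y. g y \<partial>\<mu>)"
  proof (rule integral_dominated_convergence)
    show "integrable \<mu> (\<lambda>y. B)" by simp
    have ib: "integrable lborel (\<lambda>z. B * gauss2 z)" using integrable_gauss2 by simp
    have b: "norm (g (y - e n *\<^sub>R z) * gauss2 z) \<le> B * gauss2 z" for y n z
      using bnd gauss2_pos[of z] by (auto simp: abs_mult intro!: mult_right_mono)
    have integrable_norm_bound_gauss: "integrable lborel (\<lambda>z. g (y - e n *\<^sub>R z) * gauss2 z)" for y n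
      by (rule Bochner_Integration.integrable_bound[OF ib])
        (use b[of y n] in \<open>auto intro!: AE_I2 intro: order_trans[OF _ abs_ge_self]\<close>)
    show "AE y in \<mu>. (\<lambda>n. \<integral>z. g (y - e n *\<^sub>R z) * gauss2 z \<partial>lborel) \<longlonglongrightarrow> g y"
      using cont
    proof eventually_elim
      case (elim y)
      have "(\<lambda>n. \<integral>z. g (y - e n *\<^sub>R z) * gauss2 z \<partial>lborel) \<longlonglongrightarrow> (\<integral>z. g y * gauss2 z \<partial>lborel)"
      proof (rule integral_dominated_convergence[OF _ _ ib])
        have "(\<lambda>n. g (y - e n *\<^sub>R z)) \<longlonglongrightarrow> g y" for z
          by (rule isCont_tendsto_compose[OF elim])
            (use tendsto_diff[OF tendsto_const tendsto_scaleR[OF e0 tendsto_const], of y z] in simp)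
        then show "AE z in lborel. (\<lambda>n. g (y - e n *\<^sub>R z) * gauss2 z) \<longlonglongrightarrow> g y * gauss2 z"
          by (intro AE_I2 tendsto_mult tendsto_const)
      qed (use b in auto)
      then show ?case by (simp add: integral_gauss2)
    qed
    show "AE y in \<mu>. norm (\<integral>z. g (y - e n *\<^sub>R z) * gauss2 z \<partial>lborel) \<le> B" for n
    proof (rule AE_I2)
      fix y
      have "norm (\<integral>z. g (y - e n *\<^sub>R z) * gauss2 z \<partial>lborel) \<le> (\<integral>z. B * gauss2 z \<partial>lborel)"
        by (rule Bochner_Integration.integral_norm_bound_integral)
          (use ib b integrable_norm_bound_gauss in auto)
      then show "norm (\<integral>z. g (y - e n *\<^sub>R z) * gauss2 z \<partial>lborel) \<le> B" by (simp add: integral_gauss2)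
    qed
  qed (auto simp: measurable_cong_sets[OF sets_mu refl])
  have "(\<lambda>n. \<integral>u. gauss2 (e n *\<^sub>R u) *\<^sub>R ?F u \<partial>lborel) \<longlonglongrightarrow> complex_of_real (2 * pi * (\<integral>y. g y \<partial>\<mu>))"
    unfolding fourier_smoothed[OF fin sets_mu g e] by (intro tendsto_of_real tendsto_mult tendsto_const R)
  from LIMSEQ_unique[OF L this] have "complex_of_real (2 * pi * (\<integral>y. g y \<partial>\<mu>)) = (1 / (2 * pi)) *\<^sub>R (\<integral>u. ?F u \<partial>lborel)"
    by (simp add: gauss2_0)
  then show ?thesis
    by (simp add: scaleR_conv_of_real power2_eq_square field_simps)
qed

subsection \<open>Differentiation under the integral and moments\<close>

lemma norm_increment_le:
  fixes f :: "real \<Rightarrow> complex"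
  assumes d: "\<And>t. t \<in> ball s0 \<delta> \<Longrightarrow> (f has_vector_derivative f' t) (at t)"
    and b: "\<And>t. t \<in> ball s0 \<delta> \<Longrightarrow> norm (f' t) \<le> G" and s: "s \<in> ball s0 \<delta>" "r \<in> ball s0 \<delta>"
  shows "norm (f s - f r) \<le> G * \<bar>s - r\<bar>"
proof -
  have "norm (f s - f r) \<le> G * norm (s - r)"
  proof (rule differentiable_bound[of "ball s0 \<delta>" f "\<lambda>t h. h *\<^sub>R f' t"])
    show "(f has_derivative (\<lambda>h. h *\<^sub>R f' t)) (at t within ball s0 \<delta>)" if "t \<in> ball s0 \<delta>" for t
      using d[OF that] by (simp add: has_vector_derivative_def has_derivative_at_withinI)
    show "onorm (\<lambda>h. h *\<^sub>R f' t) \<le> G" if "t \<in> ball s0 \<delta>" for t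
      by (rule onorm_le) (use b[OF that] in \<open>simp add: mult.commute[of G] mult_left_mono\<close>)
  qed (use s in auto)
  then show ?thesis by simp
qed

lemma has_vector_derivative_at_iff:
  fixes f :: "real \<Rightarrow> 'a :: real_normed_vector"
  shows "(f has_vector_derivative D) (at x) \<longleftrightarrow> ((\<lambda>h. (f (x + h) - f x) /\<^sub>R h) \<longlongrightarrow> D) (at 0)"
proof -
  have "((\<lambda>h. (f (x + h) - f x) /\<^sub>R h) \<longlongrightarrow> D) (at 0) \<longleftrightarrow> ((\<lambda>h. norm ((f (x + h) - f x) /\<^sub>R h - D)) \<longlongrightarrow> 0) (at 0)"
    by (simp add: tendsto_norm_zero_iff LIM_zero_iff)
  also have "\<dots> \<longleftrightarrow> ((\<lambda>h. norm (f (x + h) - f x - h *\<^sub>R D) / norm h) \<longlongrightarrow> 0) (at 0)"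
  proof (rule filterlim_cong[OF refl refl])
    have "norm ((f (x + h) - f x) /\<^sub>R h - D) = norm (f (x + h) - f x - h *\<^sub>R D) / norm h" if "h \<noteq> 0" for h
    proof -
      have "(f (x + h) - f x) /\<^sub>R h - D = (f (x + h) - f x - h *\<^sub>R D) /\<^sub>R h"
        using that by (simp add: scaleR_diff_right)
      then show ?thesis by (simp add: divide_inverse mult.commute)
    qed
    then show "\<forall>\<^sub>F h in at 0. norm ((f (x + h) - f x) /\<^sub>R h - D) = norm (f (x + h) - f x - h *\<^sub>R D) / norm h"
      by (simp add: eventually_at_filter)
  qed
  finally show ?thesis
    by (simp add: has_vector_derivative_def has_derivative_at bounded_linear_scaleR_left)
qed

text \<open>Dominated convergence along an arbitrary sequence tending to 0: by the mean value
  inequality \<open>norm_increment_le\<close> the bound \<open>G\<close> on the derivatives also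
  bounds the difference quotients.\<close>

lemma
  fixes F F' :: "real \<Rightarrow> 'a \<Rightarrow> complex"
  assumes \<delta>: "0 < \<delta>" and int: "\<And>s. s \<in> ball s0 \<delta> \<Longrightarrow> integrable M (F s)"
    and d: "\<And>s x. s \<in> ball s0 \<delta> \<Longrightarrow> ((\<lambda>s. F s x) has_vector_derivative F' s x) (at s)"
    and b: "\<And>s x. s \<in> ball s0 \<delta> \<Longrightarrow> norm (F' s x) \<le> G x"
    and G: "integrable M G" and meas: "F' s0 \<in> borel_measurable M"
  shows has_vector_derivative_integral: "((\<lambda>s. \<integral>x. F s x \<partial>M) has_vector_derivative (\<integral>x. F' s0 x \<partial>M)) (at s0)"
    and integrable_vector_derivative: "integrable M (F' s0)"
proof -
  show "integrable M (F' s0)"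
    by (rule Bochner_Integration.integrable_bound[OF G meas])
      (use b[of s0] \<delta> in \<open>auto intro!: AE_I2 intro: order_trans[OF _ abs_ge_self]\<close>)
  show "((\<lambda>s. \<integral>x. F s x \<partial>M) has_vector_derivative (\<integral>x. F' s0 x \<partial>M)) (at s0)"
    unfolding has_vector_derivative_at_iff tendsto_at_iff_sequentially
  proof (intro allI impI)
    fix X :: "nat \<Rightarrow> real" assume X0: "\<forall>i. X i \<in> UNIV - {0}" and X: "X \<longlonglongrightarrow> 0"
    \<comment> \<open>Finitely many terms may leave the ball; they are cut off by the shift
      \<open>N\<close>.\<close>
    have "eventually (\<lambda>n. X n \<in> ball 0 \<delta>) sequentially"
      using X \<delta> by (intro topological_tendstoD) auto
    then obtain N where N: "\<And>n. N \<le> n \<Longrightarrow> X n \<in> ball 0 \<delta>" by (auto simp: eventually_sequentially)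
    have sb: "s0 + X (n + N) \<in> ball s0 \<delta>" for n using N[of "n + N"] by (simp add: dist_norm)
    have s0b: "s0 \<in> ball s0 \<delta>" using \<delta> by simp
    have "(\<lambda>n. \<integral>x. (F (s0 + X (n + N)) x - F s0 x) /\<^sub>R X (n + N) \<partial>M) \<longlonglongrightarrow> (\<integral>x. F' s0 x \<partial>M)"
    proof (rule integral_dominated_convergence[OF meas _ G])
      show "(\<lambda>x. (F (s0 + X (n + N)) x - F s0 x) /\<^sub>R X (n + N)) \<in> borel_measurable M" for n
        using int[OF sb] int[OF s0b] by measurable
      show "AE x in M. (\<lambda>n. (F (s0 + X (n + N)) x - F s0 x) /\<^sub>R X (n + N)) \<longlonglongrightarrow> F' s0 x"
      proof (rule AE_I2)
        fix x
        have "((\<lambda>h. (F (s0 + h) x - F s0 x) /\<^sub>R h) \<longlongrightarrow> F' s0 x) (at 0)"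
          using d[OF s0b, of x] by (simp add: has_vector_derivative_at_iff)
        then have "(\<lambda>n. (F (s0 + X n) x - F s0 x) /\<^sub>R X n) \<longlonglongrightarrow> F' s0 x"
          using X0 X unfolding tendsto_at_iff_sequentially by (auto simp: o_def)
        then show "(\<lambda>n. (F (s0 + X (n + N)) x - F s0 x) /\<^sub>R X (n + N)) \<longlonglongrightarrow> F' s0 x"
          by (rule LIMSEQ_ignore_initial_segment)
      qed
      show "AE x in M. norm ((F (s0 + X (n + N)) x - F s0 x) /\<^sub>R X (n + N)) \<le> G x" for n
      proof (rule AE_I2)
        fix x
        have "norm (F (s0 + X (n + N)) x - F s0 x) \<le> G x * \<bar>s0 + X (n + N) - s0\<bar>"
          by (rule norm_increment_le[OF d b sb s0b])
        show "norm ((F (s0 + X (n + N)) x - F s0 x) /\<^sub>R X (n + N)) \<le> G x"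
        proof -
          have "0 < \<bar>X (n + N)\<bar>" using X0 by auto
          moreover have "norm ((F (s0 + X (n + N)) x - F s0 x) /\<^sub>R X (n + N)) = norm (F (s0 + X (n + N)) x - F s0 x) / \<bar>X (n + N)\<bar>"
            by (simp add: divide_inverse mult.commute)
          ultimately show ?thesis using \<open>norm (F (s0 + X (n + N)) x - F s0 x) \<le> G x * \<bar>s0 + X (n + N) - s0\<bar>\<close>
            by (simp add: pos_divide_le_eq)
        qed
      qed
    qed
    then have "(\<lambda>n. ((\<integral>x. F (s0 + X (n + N)) x \<partial>M) - (\<integral>x. F s0 x \<partial>M)) /\<^sub>R X (n + N)) \<longlonglongrightarrow> (\<integral>x. F' s0 x \<partial>M)"
      using int[OF sb] int[OF s0b] by simp
    then show "((\<lambda>h. ((\<integral>x. F (s0 + h) x \<partial>M) - (\<integral>x. F s0 x \<partial>M)) /\<^sub>R h) \<circ> X) \<longlonglongrightarrow> (\<integral>x. F' s0 x \<partial>M)"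
      unfolding o_def by (rule LIMSEQ_offset)
  qed
qed

section \<open>Repeated differentiability of functions on the line\<close>

fun times_differentiable :: "nat \<Rightarrow> (real \<Rightarrow> complex) \<Rightarrow> bool" where
  "times_differentiable 0 f \<longleftrightarrow> True"
| "times_differentiable (Suc n) f \<longleftrightarrow> (\<exists>f'. (\<forall>x. (f has_vector_derivative f' x) (at x)) \<and> times_differentiable n f')"

lemma times_differentiable_SucI: "(\<And>x. (f has_vector_derivative f' x) (at x)) \<Longrightarrow> times_differentiable n f' \<Longrightarrow> times_differentiable (Suc n) f"
  by auto

lemma times_differentiable_SucD: "times_differentiable (Suc n) f \<Longrightarrow> times_differentiable n f"
proof (induction n arbitrary: f)
  case (Suc n)
  then obtain f' where "\<forall>x. (f has_vector_derivative f' x) (at x)" "times_differentiable (Suc n) f'"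
    unfolding times_differentiable.simps(2)[of "Suc n" f] by blast
  with Suc.IH[of f'] show ?case unfolding times_differentiable.simps(2)[of n f] by blast
qed simp

text \<open>Uniqueness of the derivative replaces the witness hidden in the definition by a
  derivative already known.\<close>

lemma times_differentiable_SucE:
  assumes "times_differentiable (Suc n) f" "\<And>x. (f has_vector_derivative f' x) (at x)"
  shows "times_differentiable n f'"
proof -
  obtain g where "\<And>x. (f has_vector_derivative g x) (at x)" "times_differentiable n g"
    using assms(1) unfolding times_differentiable.simps by blast
  moreover have "g = f'"
    by (rule ext, rule vector_derivative_unique_at[OF calculation(1) assms(2)])
  ultimately show ?thesis by simp
qed

lemma times_differentiable_const: "times_differentiable n (\<lambda>_. c)"
proof (induction n arbitrary: c)
  case (Suc n)
  show ?case by (rule times_differentiable_SucI[OF has_vector_derivative_const Suc.IH])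
qed simp

lemma times_differentiable_add: "times_differentiable n f \<Longrightarrow> times_differentiable n g \<Longrightarrow> times_differentiable n (\<lambda>x. f x + g x)"
proof (induction n arbitrary: f g)
  case (Suc n)
  from Suc.prems obtain f' g' where *: "\<And>x. (f has_vector_derivative f' x) (at x)" "times_differentiable n f'"
    "\<And>x. (g has_vector_derivative g' x) (at x)" "times_differentiable n g'" unfolding times_differentiable.simps by blast
  show ?case
    by (rule times_differentiable_SucI[OF has_vector_derivative_add[OF *(1,3)] Suc.IH[OF *(2,4)]])
qed simp

lemma times_differentiable_mult: "times_differentiable n f \<Longrightarrow> times_differentiable n g \<Longrightarrow> times_differentiable n (\<lambda>x. f x * g x)"
proof (induction n arbitrary: f g)
  case (Suc n)
  from Suc.prems obtain f' g' where *: "\<And>x. (f has_vector_derivative f' x) (at x)" "times_differentiable n f'"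
    "\<And>x. (g has_vector_derivative g' x) (at x)" "times_differentiable n g'" unfolding times_differentiable.simps by blast
  have "times_differentiable n f" "times_differentiable n g" by (rule times_differentiable_SucD; fact)+
  then have "times_differentiable n (\<lambda>x. f x * g' x + f' x * g x)"
    by (intro times_differentiable_add Suc.IH *)
  then show ?case by (rule times_differentiable_SucI[OF has_vector_derivative_mult[OF *(1,3)]])
qed simp

text \<open>Bootstrapping in \<open>f' = p f\<close>: as long as \<open>p\<close> permits, the
  product rule turns each order of smoothness of \<open>f\<close> into one more. The intended
  \<open>f\<close> is a characteristic function, with \<open>p\<close> the derivative of its
  exponent.\<close>

lemma times_differentiable_logarithmic_derivative:
  assumes "\<And>x. (f has_vector_derivative p x * f x) (at x)" "times_differentiable n p"
  shows "times_differentiable (Suc n) f"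
  using assms(2)
proof (induction n)
  case 0
  show ?case by (rule times_differentiable_SucI[OF assms(1)]) simp
next
  case (Suc n)
  have "times_differentiable (Suc n) f" by (rule Suc.IH[OF times_differentiable_SucD[OF Suc.prems]])
  then show ?case by (rule times_differentiable_SucI[OF assms(1) times_differentiable_mult[OF Suc.prems]])
qed

lemma has_vector_derivative_iexp_scaled:
  "((\<lambda>t. c * iexp (t * y)) has_vector_derivative c * (\<i> * y * iexp (t * y))) (at t within A)"
proof -
  have "((\<lambda>t. iexp (t * y)) has_vector_derivative y *\<^sub>R (\<i> * iexp (t * y))) (at t within A)"
  proof -
    have "((\<lambda>t. t * y) has_vector_derivative y) (at t within A)"
      unfolding has_real_derivative_iff_has_vector_derivative[symmetric]
      by (auto intro!: derivative_eq_intros)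
    from vector_diff_chain_within[OF this has_vector_derivative_iexp] show ?thesis by (simp add: o_def)
  qed
  from has_vector_derivative_mult_right[OF this, of c] show ?thesis
    by (simp add: scaleR_conv_of_real mult_ac)
qed

text \<open>Fatou's lemma for \<open>(1 - cos (e x)) / e^2\<close>, which tends to
  \<open>x^2 / 2\<close>. Its integral is \<open>(f 0 - f e) / e^2\<close> with \<open>f\<close> the
  real part of the characteristic function, and this stays bounded because \<open>f' 0 = 0\<close>
  and \<open>f'\<close> is differentiable at 0.\<close>

lemma second_moment_finite:
  fixes \<mu> :: "real measure"
  assumes fin: "finite_measure \<mu>" and sets_mu: "sets \<mu> = sets borel" and C2: "times_differentiable 2 (char \<mu>)"
  shows "integrable \<mu> (\<lambda>x. x\<^sup>2)"
proof -
  interpret finite_measure \<mu> by (rule fin)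
  note [measurable_cong] = sets_mu
  obtain f1 f2 where d1: "\<And>s. (char \<mu> has_vector_derivative f1 s) (at s)"
    and d2: "\<And>s. (f1 has_vector_derivative f2 s) (at s)"
    using C2 unfolding numeral_2_eq_2 times_differentiable.simps by blast
  let ?f = "\<lambda>s. Re (char \<mu> s)" and ?f' = "\<lambda>s. Re (f1 s)"
  have i: "integrable \<mu> (\<lambda>x. iexp (s * x))" for s
    by (rule integrable_const_bound[where B = 1]) auto
  have f: "?f s = (\<integral>x. cos (s * x) \<partial>\<mu>)" for s
    using integral_Re[OF i[of s]] by (simp add: char_def Re_exp)
  have D1: "(?f has_real_derivative ?f' s) (at s)" for s
    using bounded_linear.has_vector_derivative[OF bounded_linear_Re, OF d1[of s]] by (simp add: has_real_derivative_iff_has_vector_derivative)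
  have D2: "(?f' has_real_derivative Re (f2 0)) (at 0)"
    using bounded_linear.has_vector_derivative[OF bounded_linear_Re, OF d2[of 0]] by (simp add: has_real_derivative_iff_has_vector_derivative)
  \<comment> \<open>The cosine form makes the real part even, so its derivative at 0
    vanishes.\<close>
  have even: "?f (- s) = ?f s" for s by (simp add: f)
  have f'0: "?f' 0 = 0"
  proof -
    have "((\<lambda>s. ?f (- s)) has_real_derivative - ?f' 0) (at 0)"
      using DERIV_mirror[THEN iffD1, of ?f "?f' 0" 0] D1[of 0] by simp
    then have "(?f has_real_derivative - ?f' 0) (at 0)" unfolding even .
    from DERIV_unique[OF this D1[of 0]] show ?thesis by simp
  qed
  \<comment> \<open>\<open>f' s / s\<close> tends to the second derivative at 0, so \<open>C\<close>
    bounds it near 0.\<close>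
  define C where "C = \<bar>Re (f2 0)\<bar> + 1"
  have "((\<lambda>s. ?f' s / s) \<longlongrightarrow> Re (f2 0)) (at 0)"
    using D2 by (simp add: has_field_derivative_iff f'0)
  then have "eventually (\<lambda>s. dist (?f' s / s) (Re (f2 0)) < 1) (at 0)"
    by (rule tendstoD) simp
  then obtain \<delta> where \<delta>: "0 < \<delta>" "\<And>s. s \<noteq> 0 \<Longrightarrow> \<bar>s\<bar> < \<delta> \<Longrightarrow> \<bar>?f' s / s - Re (f2 0)\<bar> < 1"
    by (auto simp: eventually_at dist_real_def)
  have f'b: "\<bar>?f' s\<bar> \<le> C * s" if "0 < s" "s < \<delta>" for s
  proof -
    have "\<bar>?f' s / s\<bar> \<le> C" using \<delta>(2)[of s] that by (auto simp: C_def)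
    then show ?thesis using that by (simp add: field_simps)
  qed
  have fb: "?f 0 - ?f s \<le> C * s\<^sup>2" if s: "0 < s" "s < \<delta>" for s
  proof -
    obtain z where z: "0 < z" "z < s" "?f s - ?f 0 = (s - 0) * ?f' z"
      using MVT2[of 0 s ?f ?f'] D1 s by blast
    have "\<bar>?f s - ?f 0\<bar> = s * \<bar>?f' z\<bar>" using z s by (simp add: abs_mult)
    also have "\<dots> \<le> s * (C * s)"
      using f'b[of z] z s by (intro mult_left_mono order_trans[OF f'b]) (auto simp: C_def intro!: mult_left_mono)
    finally show ?thesis by (simp add: power2_eq_square mult_ac abs_le_iff)
  qed
  define e where "e n = inverse (real (Suc n))" for n
  have e: "0 < e n" "e \<longlonglongrightarrow> 0" for n
    unfolding e_def using LIMSEQ_inverse_real_of_nat by simp_all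
  let ?u = "\<lambda>n x. (1 - cos (e n * x)) / (e n)\<^sup>2"
  have lim: "(\<lambda>n. ?u n x) \<longlonglongrightarrow> x\<^sup>2 / 2" for x
  proof -
    have "((\<lambda>t::real. (1 - cos t) / t\<^sup>2) \<longlongrightarrow> 1 / 2) (at 0)"
      by real_asymp
    moreover have "filterlim (\<lambda>n. e n * x) (at 0) sequentially" if "x \<noteq> 0"
      using tendsto_mult[OF e(2) tendsto_const, of x] that e(1)
      by (auto simp: filterlim_at intro!: always_eventually less_imp_neq[symmetric])
    ultimately have "x \<noteq> 0 \<Longrightarrow> (\<lambda>n. (1 - cos (e n * x)) / (e n * x)\<^sup>2) \<longlonglongrightarrow> 1 / 2"
      by (rule filterlim_compose)
    then have "x \<noteq> 0 \<Longrightarrow> (\<lambda>n. x\<^sup>2 * ((1 - cos (e n * x)) / (e n * x)\<^sup>2)) \<longlonglongrightarrow> x\<^sup>2 * (1 / 2)"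
      by (intro tendsto_mult tendsto_const)
    then show ?thesis by (cases "x = 0") (auto simp: power_mult_distrib)
  qed
  have un: "0 \<le> ?u n x" for n x by simp
  have "(\<integral>\<^sup>+x. ennreal (x\<^sup>2 / 2) \<partial>\<mu>) = (\<integral>\<^sup>+x. liminf (\<lambda>n. ennreal (?u n x)) \<partial>\<mu>)"
    using lim by (intro nn_integral_cong) (auto intro!: lim_imp_Liminf[symmetric] tendsto_ennrealI)
  also have "\<dots> \<le> liminf (\<lambda>n. \<integral>\<^sup>+x. ennreal (?u n x) \<partial>\<mu>)"
    by (rule nn_integral_liminf) measurable
  also have "\<dots> \<le> ennreal C"
  proof (rule Liminf_le)
    have "eventually (\<lambda>n. e n < \<delta>) sequentially"
      using order_tendstoD(2)[OF e(2) \<delta>(1)] .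
    then show "\<forall>\<^sub>F n in sequentially. (\<integral>\<^sup>+x. ennreal (?u n x) \<partial>\<mu>) \<le> ennreal C"
    proof eventually_elim
      case (elim n)
      have iu: "integrable \<mu> (?u n)"
        by (rule integrable_const_bound[where B = "2 / (e n)\<^sup>2"])
          (auto simp: abs_divide intro!: divide_right_mono)
      have "(\<integral>\<^sup>+x. ennreal (?u n x) \<partial>\<mu>) = ennreal (\<integral>x. ?u n x \<partial>\<mu>)"
        by (rule nn_integral_eq_integral[OF iu]) (use un in auto)
      also have "(\<integral>x. ?u n x \<partial>\<mu>) = (?f 0 - ?f (e n)) / (e n)\<^sup>2"
      proof -
        have "integrable \<mu> (\<lambda>x. cos (e n * x))"
          by (rule integrable_const_bound[where B = 1]) auto
        then show ?thesis by (simp add: f)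
      qed
      also have "\<dots> \<le> C" using fb[OF e(1) elim] e(1)[of n] by (simp add: field_simps)
      finally show ?case by (auto intro: ennreal_leI)
    qed
  qed simp
  finally have "(\<integral>\<^sup>+x. ennreal (x\<^sup>2 / 2) \<partial>\<mu>) < \<infinity>" by (simp add: le_less_trans)
  then have "integrable \<mu> (\<lambda>x. x\<^sup>2 / 2)" by (intro integrableI_nonneg) auto
  then have "integrable \<mu> (\<lambda>x. 2 * (x\<^sup>2 / 2))" by (rule integrable_mult_right)
  then show ?thesis by simp
qed

text \<open>If \<open>\<mu>\<close> has a second moment, the characteristic function of \<open>x\<^sup>2 \<mu>\<close> is minus the second derivative
  of the one of \<open>\<mu>\<close>, so second moments suffice for the induction.\<close>

lemma even_moments_finite:
  fixes \<mu> :: "real measure"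
  assumes "finite_measure \<mu>" "sets \<mu> = sets borel" "times_differentiable (2 * m) (char \<mu>)"
  shows "integrable \<mu> (\<lambda>x. x^(2 * m))"
  using assms
proof (induction m arbitrary: \<mu>)
  case 0
  then show ?case using finite_measure.integrable_const[of \<mu> "1 :: real"] by simp
next
  case (Suc m)
  interpret finite_measure \<mu> by (rule Suc.prems)
  note [measurable_cong] = Suc.prems(2)
  have "times_differentiable 2 (char \<mu>)"
  proof -
    have "times_differentiable (k + j) f \<Longrightarrow> times_differentiable k f" for k j f by (induction j) (auto dest: times_differentiable_SucD simp del: times_differentiable.simps)
    from this[of 2 "2 * m"] Suc.prems(3) show ?thesis by (simp del: times_differentiable.simps)
  qed
  then have i2: "integrable \<mu> (\<lambda>x. x\<^sup>2)" by (rule second_moment_finite[OF Suc.prems(1,2)])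
  \<comment> \<open>The first moment dominates the first differentiation under the integral, the
    second moment the next one.\<close>
  have i1: "integrable \<mu> (\<lambda>x. \<bar>x\<bar>)"
  proof (rule Bochner_Integration.integrable_bound[of _ "\<lambda>x. 1 + x\<^sup>2"])
    show "AE x in \<mu>. norm \<bar>x\<bar> \<le> norm (1 + x\<^sup>2)"
    proof (rule AE_I2)
      fix x :: real
      have "2 * \<bar>x\<bar> \<le> 1 + x\<^sup>2" using sum_squares_bound[of 1 "\<bar>x\<bar>"] by simp
      then show "norm \<bar>x\<bar> \<le> norm (1 + x\<^sup>2)" by simp
    qed
  qed (use i2 in auto)
  have i0: "integrable \<mu> (\<lambda>x. iexp (s * x))" for s
    by (rule integrable_const_bound[where B = 1]) auto
  let ?f1 = "\<lambda>s. \<integral>x. 1 * (\<i> * x * iexp (s * x)) \<partial>\<mu>"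
  have d1: "(char \<mu> has_vector_derivative ?f1 s) (at s)" and i3: "integrable \<mu> (\<lambda>x. 1 * (\<i> * x * iexp (s * x)))" for s
  proof -
    have 1: "((\<lambda>t. iexp (t * x)) has_vector_derivative 1 * (\<i> * x * iexp (t * x))) (at t)" for x t
      using has_vector_derivative_iexp_scaled[of 1] by simp
    show "(char \<mu> has_vector_derivative ?f1 s) (at s)"
      unfolding char_def[abs_def]
      by (rule has_vector_derivative_integral[OF zero_less_one i0 1 _ i1]) (auto simp: norm_mult)
    show "integrable \<mu> (\<lambda>x. 1 * (\<i> * x * iexp (s * x)))"
      by (rule integrable_vector_derivative[OF zero_less_one i0 1 _ i1]) (auto simp: norm_mult)
  qed
  let ?f2 = "\<lambda>s. \<integral>x. (\<i> * x) * (\<i> * x * iexp (s * x)) \<partial>\<mu>"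
  have d2: "(?f1 has_vector_derivative ?f2 s) (at s)" for s
  proof (rule has_vector_derivative_integral[OF zero_less_one i3 _ _ i2])
    show "((\<lambda>t. 1 * (\<i> * complex_of_real x * iexp (t * x))) has_vector_derivative (\<i> * x) * (\<i> * x * iexp (t * x))) (at t)" for x t
      using has_vector_derivative_iexp_scaled[of "\<i> * x"] by simp
  qed (auto simp: norm_mult power2_eq_square)
  \<comment> \<open>Derivatives are unique, so of the \<open>2 * m + 2\<close> orders granted to
    \<open>char \<mu>\<close> the last \<open>2 * m\<close> belong to \<open>?f2\<close>.\<close>
  have "times_differentiable (2 * m) ?f2"
    by (rule times_differentiable_SucE[OF times_differentiable_SucE[OF _ d1] d2]) (use Suc.prems(3) in simp)
  then have "times_differentiable (2 * m) (\<lambda>s. (- 1) * ?f2 s)" by (intro times_differentiable_mult times_differentiable_const)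
  let ?\<mu> = "density \<mu> (\<lambda>x. ennreal (x\<^sup>2))"
  have "char ?\<mu> s = (- 1) * ?f2 s" for s
  proof -
    have "char ?\<mu> s = (\<integral>x. x\<^sup>2 *\<^sub>R iexp (s * x) \<partial>\<mu>)"
      by (simp add: char_def integral_density)
    also have "\<dots> = (- 1) * ?f2 s"
      by (subst integral_mult_right_zero[symmetric]) (auto simp: power2_eq_square scaleR_conv_of_real mult_ac intro!: Bochner_Integration.integral_cong)
    finally show ?thesis .
  qed
  then have "char ?\<mu> = (\<lambda>s. (- 1) * ?f2 s)" by (rule ext)
  with \<open>times_differentiable (2 * m) (\<lambda>s. (- 1) * ?f2 s)\<close> have C: "times_differentiable (2 * m) (char ?\<mu>)" by simp
  have "emeasure ?\<mu> (space ?\<mu>) = (\<integral>\<^sup>+x. ennreal (x\<^sup>2) \<partial>\<mu>)"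
    by (simp add: emeasure_density cong: nn_integral_cong)
  also have "\<dots> = ennreal (\<integral>x. x\<^sup>2 \<partial>\<mu>)" by (rule nn_integral_eq_integral[OF i2]) auto
  finally have "finite_measure ?\<mu>" by (intro finite_measureI) simp
  from Suc.IH[OF this _ C] have "integrable ?\<mu> (\<lambda>x. x^(2 * m))" using Suc.prems(2) by simp
  then have "integrable \<mu> (\<lambda>x. x\<^sup>2 *\<^sub>R x^(2 * m))" by (subst (asm) integrable_density) auto
  then show ?case by (simp add: power_add power2_eq_square mult.assoc)
qed

subsection \<open>Integral bounds\<close>

text \<open>With a standard normal variable \<open>Z\<close>, the mass of the line is at most the integral of
  \<open>E (exp (i n Z (x_k - a)))\<close> against \<open>\<mu>\<close>, which the decay of the Fourier transform sends to 0.\<close>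

lemma line_null:
  fixes \<mu> :: "(real^2) measure"
  assumes fin: "finite_measure \<mu>" and sets_mu: "sets \<mu> = sets borel"
    and dec: "\<And>u. cmod (fourier_measure \<mu> u) \<le> c / cross_weight u" and c: "0 < c"
  shows "emeasure \<mu> {x. x $ k = a} = 0"
proof -
  interpret mu: finite_measure \<mu> by (rule fin)
  note [measurable_cong] = sets_mu
  let ?N = std_normal_distribution
  interpret N: prob_space ?N by (rule prob_space_normal_density) simp
  interpret P: pair_sigma_finite ?N \<mu> ..
  have [measurable]: "{x. x $ k = a} \<in> sets \<mu>"
  proof -
    have "{x \<in> space borel. x $ k = a} \<in> sets (borel :: (real^2) measure)" by measurable
    then show ?thesis by (simp add: sets_mu)
  qed
  have decay_axis: "cmod (fourier_measure \<mu> (s *\<^sub>R axis k 1)) \<le> c / (1 + \<bar>s\<bar>)" for s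
  proof -
    have "cross_weight (s *\<^sub>R axis k 1) = 1 + \<bar>s\<bar>"
      using exhaust_2[of k] by (auto simp: cross_weight_def axis_def)
    then show ?thesis using dec[of "s *\<^sub>R axis k 1"] by simp
  qed
  have bound: "measure \<mu> {x. x $ k = a} \<le> (\<integral>z. c / (1 + \<bar>real n * z\<bar>) \<partial>?N)" for n :: nat
  proof -
    \<comment> \<open>The value of the Gaussian expectation: equal to 1 on the line and positive
      elsewhere, so it dominates the indicator of the line.\<close>
    let ?e = "\<lambda>x :: real^2. exp (- ((real n * (x $ k - a))\<^sup>2) / 2)"
    have ie: "integrable \<mu> ?e"
      by (rule mu.integrable_const_bound[where B = 1]) auto
    have iP: "integrable (?N \<Otimes>\<^sub>M \<mu>) (\<lambda>(z, x). iexp (real n * (x $ k - a) * z))"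
    proof (rule finite_measure.integrable_const_bound[where B = 1])
      show "finite_measure (?N \<Otimes>\<^sub>M \<mu>)"
        by (rule finite_measure_pair_measure) unfold_locales
    qed (auto intro!: AE_I2)
    have "measure \<mu> {x. x $ k = a} = (\<integral>x. indicator {x. x $ k = a} x \<partial>\<mu>)" by simp
    also have "\<dots> \<le> (\<integral>x. ?e x \<partial>\<mu>)"
    proof (rule integral_mono[OF _ ie])
      show "integrable \<mu> (indicat_real {x. x $ k = a})"
        by (rule integrable_real_indicator) (auto simp: less_top[symmetric] mu.emeasure_finite)
    qed (auto simp: indicator_def)
    also have "\<dots> \<le> cmod (complex_of_real (\<integral>x. ?e x \<partial>\<mu>))" by simp
    also have "complex_of_real (\<integral>x. ?e x \<partial>\<mu>) = (\<integral>x. (\<integral>z. iexp (real n * (x $ k - a) * z) \<partial>?N) \<partial>\<mu>)"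
    proof -
      have "(\<integral>z. iexp (t * z) \<partial>?N) = complex_of_real (exp (- (t\<^sup>2) / 2))" for t
        using fun_cong[OF char_std_normal_distribution, of t] by (simp add: char_def)
      then show ?thesis by (simp only: integral_complex_of_real)
    qed
    also have "\<dots> = (\<integral>z. (\<integral>x. iexp (real n * (x $ k - a) * z) \<partial>\<mu>) \<partial>?N)"
      using P.Fubini_integral[OF iP] by simp
    also have "cmod \<dots> \<le> (\<integral>z. c / (1 + \<bar>real n * z\<bar>) \<partial>?N)"
    proof (rule Bochner_Integration.integral_norm_bound_integral)
      show "integrable ?N (\<lambda>z. \<integral>x. iexp (real n * (x $ k - a) * z) \<partial>\<mu>)"
        using P.integrable_fst'[OF iP] by simp
      have "c / (1 + \<bar>real n * z\<bar>) \<le> c" for z using c by (simp add: field_simps)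
      then show "integrable ?N (\<lambda>z. c / (1 + \<bar>real n * z\<bar>))"
        using c by (intro N.integrable_const_bound[where B = c]) auto
      fix z
      have "(\<integral>x. iexp (real n * (x $ k - a) * z) \<partial>\<mu>) = (\<integral>x. iexp (- (real n * a * z)) * iexp ((real n * z) *\<^sub>R axis k 1 \<bullet> x) \<partial>\<mu>)"
      proof (intro Bochner_Integration.integral_cong refl)
        fix x :: "real^2"
        have "real n * (x $ k - a) * z = - (real n * a * z) + ((real n * z) *\<^sub>R axis k 1 \<bullet> x)"
          by (simp add: inner_axis' algebra_simps)
        then show "iexp (real n * (x $ k - a) * z) = iexp (- (real n * a * z)) * iexp ((real n * z) *\<^sub>R axis k 1 \<bullet> x)"
          by (simp only: of_real_add distrib_left exp_add)
      qed
      also have "\<dots> = iexp (- (real n * a * z)) * fourier_measure \<mu> ((real n * z) *\<^sub>R axis k 1)"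
        by (simp only: integral_mult_right_zero fourier_measure_def)
      finally show "cmod (\<integral>x. iexp (real n * (x $ k - a) * z) \<partial>\<mu>) \<le> c / (1 + \<bar>real n * z\<bar>)"
        using decay_axis[of "real n * z"] by (simp add: norm_mult)
    qed
    finally show ?thesis .
  qed
  have "(\<lambda>n. \<integral>z. c / (1 + \<bar>real n * z\<bar>) \<partial>?N) \<longlonglongrightarrow> (\<integral>z. 0 \<partial>?N)"
  proof (rule integral_dominated_convergence[where w = "\<lambda>_. c"])
    \<comment> \<open>At \<open>z = 0\<close> the integrand stays equal to \<open>c\<close>; a
      single point is null for the normal law.\<close>
    have "AE z in lborel. z \<noteq> (0 :: real)" by (rule AE_lborel_singleton)
    then have "AE z in ?N. z \<noteq> 0" by (subst AE_density) auto
    then show "AE z in ?N. (\<lambda>n. c / (1 + \<bar>real n * z\<bar>)) \<longlonglongrightarrow> 0"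
    proof eventually_elim
      case (elim z)
      have "filterlim (\<lambda>n. 1 + \<bar>z\<bar> * real n) at_top sequentially"
        using elim by (intro filterlim_tendsto_add_at_top[OF tendsto_const]
          filterlim_tendsto_pos_mult_at_top[OF tendsto_const _ filterlim_real_sequentially]) auto
      from real_tendsto_divide_at_top[OF tendsto_const this, of c] show ?case
        by (simp add: abs_mult mult.commute)
    qed
    have "c / (1 + \<bar>real n * z\<bar>) \<le> c" for n z using c by (simp add: field_simps)
    then show "AE z in ?N. norm (c / (1 + \<bar>real n * z\<bar>)) \<le> c" for n
      using c by auto
  qed auto
  then have "(\<lambda>n. \<integral>z. c / (1 + \<bar>real n * z\<bar>) \<partial>?N) \<longlonglongrightarrow> 0" by simp
  from LIMSEQ_le_const[OF this] bound have "measure \<mu> {x. x $ k = a} \<le> 0" by blast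
  then have "measure \<mu> {x. x $ k = a} = 0" by (simp add: measure_le_0_iff)
  then show ?thesis by (simp add: mu.emeasure_eq_measure)
qed

text \<open>\<open>quartic_ge\<close> with both factors lowered to \<open>max_coord p\<close>. The
  Parseval identity asks for a bounded function.\<close>

lemma g_fun_le:
  assumes p: "p \<in> pointed_quadrant"
  shows "g_fun p x \<le> 4 / (max_coord p)^4"
proof (cases "x \<in> upper_orthant p")
  case True
  then have le: "p $ 1 \<le> x $ 1" "p $ 2 \<le> x $ 2" by (auto simp: upper_orthant_def)
  note sh = max_coord_shift[OF p le] and q = max_coord_pos[OF p]
  have "max_coord p * max_coord p \<le> (max_coord p + (x $ 1 - p $ 1)) * (max_coord p + (x $ 2 - p $ 2))"
    using le q by (intro mult_mono) auto
  then have "(max_coord p * max_coord p)\<^sup>2 \<le> ((max_coord p + (x $ 1 - p $ 1)) * (max_coord p + (x $ 2 - p $ 2)))\<^sup>2"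
    using q by (intro power_mono) auto
  also have "\<dots> \<le> 4 * ((x $ 1)^4 + (x $ 2)^4)" by (rule quartic_ge[OF p le])
  finally have "(max_coord p)^4 \<le> 4 * ((x $ 1)^4 + (x $ 2)^4)" by (simp add: power2_eq_square power4_eq_xxxx mult_ac)
  then show ?thesis using True sh q by (simp add: g_fun_def field_simps)
qed (use max_coord_pos[OF p] in \<open>simp add: g_fun_def\<close>)

text \<open>Off the two lines through \<open>p\<close> the function is locally either 0 or
  \<open>1 / (x_1^4 + x_2^4)\<close>.\<close>

lemma isCont_g_fun:
  assumes p: "p \<in> pointed_quadrant" and y: "y $ 1 \<noteq> p $ 1" "y $ 2 \<noteq> p $ 2"
  shows "isCont (g_fun p) y"
proof -
  have op: "open {x :: real^2. x $ k < t}" "open {x :: real^2. t < x $ k}" for k t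
    by (auto intro!: open_Collect_less continuous_intros)
  consider k where "y $ k < p $ k" | "p $ 1 < y $ 1" "p $ 2 < y $ 2"
  proof (cases "y $ 1 < p $ 1 \<or> y $ 2 < p $ 2")
    case False
    then have "p $ 1 < y $ 1" "p $ 2 < y $ 2" using y by auto
    then show ?thesis by (rule that(2))
  qed (use that(1) in blast)
  then show ?thesis
  proof cases
    case (1 k)
    have "eventually (\<lambda>x. x \<in> {x. x $ k < p $ k}) (nhds y)"
      using op(1) 1 by (intro eventually_nhds_in_open) auto
    then have "eventually (\<lambda>x. g_fun p x = 0) (nhds y)"
      by eventually_elim (use exhaust_2[of k] in \<open>auto simp: g_fun_def upper_orthant_def indicator_def\<close>)
    from isCont_cong[OF this] show ?thesis by simp
  next
    case 2
    have "eventually (\<lambda>x. x \<in> {x. p $ 1 < x $ 1} \<inter> {x. p $ 2 < x $ 2}) (nhds y)"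
      using op(2) 2 by (intro eventually_nhds_in_open) auto
    then have "eventually (\<lambda>x. g_fun p x = 1 / ((x $ 1)^4 + (x $ 2)^4)) (nhds y)"
      by eventually_elim (auto simp: g_fun_def upper_orthant_def indicator_def)
    from isCont_cong[OF this] show ?thesis
      using max_coord_shift(7)[OF p, of "y $ 1" "y $ 2"] 2 by (auto intro!: continuous_intros)
  qed
qed

section \<open>Fourier transforms: measurability, pairing and scaling\<close>

lemma measurable_fourier:
  assumes [measurable]: "f \<in> borel_measurable borel"
  shows "fourier f \<in> borel_measurable borel"
proof -
  have "(\<lambda>u. \<integral>x. iexp (u \<bullet> x) * f x \<partial>lborel) \<in> borel_measurable borel"
    by (rule lborel.borel_measurable_lebesgue_integral) measurable
  then show ?thesis unfolding fourier_def[abs_def] .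
qed

lemma measurable_fourier_measure:
  assumes fin: "finite_measure \<mu>" and sets_mu: "sets \<mu> = sets borel"
  shows "fourier_measure \<mu> \<in> borel_measurable borel"
proof -
  interpret finite_measure \<mu> by (rule fin)
  note [measurable_cong] = sets_mu
  have "(\<lambda>u. \<integral>x. iexp (u \<bullet> x) \<partial>\<mu>) \<in> borel_measurable borel"
    by (rule borel_measurable_lebesgue_integral) measurable
  then show ?thesis unfolding fourier_measure_def[abs_def] .
qed

lemma fourier_minus_cnj:
  "cmod (fourier (\<lambda>x. complex_of_real (g x)) (- u)) = cmod (fourier (\<lambda>x. complex_of_real (g x)) u)"
proof -
  have "fourier (\<lambda>x. complex_of_real (g x)) (- u) = cnj (fourier (\<lambda>x. complex_of_real (g x)) u)"
  proof -
    have "cnj (iexp (u \<bullet> x) * complex_of_real (g x)) = iexp (- u \<bullet> x) * complex_of_real (g x)" for x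
      by (simp add: exp_cnj)
    then have "(\<integral>x. cnj (iexp (u \<bullet> x) * complex_of_real (g x)) \<partial>lborel) = fourier (\<lambda>x. complex_of_real (g x)) (- u)"
      by (simp only: fourier_def)
    with Bochner_Integration.integral_cnj[of lborel "\<lambda>x. iexp (u \<bullet> x) * complex_of_real (g x)"] show ?thesis
      unfolding fourier_def[of _ u] by metis
  qed
  then show ?thesis by simp
qed

text \<open>Fubini, with the product of the integrable \<open>g\<close> and \<open>G\<close> as
  majorant. It gives the estimator the same form as the Parseval identity, so that the two can be
  subtracted under one integral.\<close>

lemma inv_fourier_pairing:
  fixes g :: "real^2 \<Rightarrow> real"
  assumes G: "integrable lborel G" and g: "integrable lborel g"
  shows "(\<integral>y. complex_of_real (g y) * inv_fourier G y \<partial>lborel) =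
    complex_of_real (1 / (2 * pi)\<^sup>2) * (\<integral>u. fourier (\<lambda>x. complex_of_real (g x)) (- u) * G u \<partial>lborel)"
proof -
  have [measurable]: "G \<in> borel_measurable borel" "g \<in> borel_measurable borel" using G g by auto
  let ?F = "\<lambda>y u. (g y *\<^sub>R iexp (- (u \<bullet> y))) * G u"
  have nF: "norm (?F y u) = \<bar>g y\<bar> * norm (G u)" for y u by (simp add: norm_mult)
  have iF: "integrable (lborel \<Otimes>\<^sub>M lborel) (\<lambda>(y, u). ?F y u)"
  proof (rule lborel_pair.Fubini_integrable)
    show "(\<lambda>(y, u). ?F y u) \<in> borel_measurable (lborel \<Otimes>\<^sub>M lborel)" by measurable
    show "integrable lborel (\<lambda>y. \<integral>u. norm (case (y, u) of (y, u) \<Rightarrow> ?F y u) \<partial>lborel)"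
      unfolding prod.case nF using g by simp
    have "integrable lborel (\<lambda>u. ?F y u)" for y
      by (rule Bochner_Integration.integrable_bound[of _ "\<lambda>u. \<bar>g y\<bar> *\<^sub>R G u"])
        (use G in \<open>auto simp: norm_mult\<close>)
    then show "AE y in lborel. integrable lborel (\<lambda>u. case (y, u) of (y, u) \<Rightarrow> ?F y u)" by simp
  qed
  have "(\<integral>y. complex_of_real (g y) * inv_fourier G y \<partial>lborel) =
      (\<integral>y. complex_of_real (1 / (2 * pi)\<^sup>2) * (\<integral>u. ?F y u \<partial>lborel) \<partial>lborel)"
  proof (intro Bochner_Integration.integral_cong refl)
    fix y
    have "(\<integral>u. ?F y u \<partial>lborel) = (\<integral>u. complex_of_real (g y) * (iexp (- (u \<bullet> y)) * G u) \<partial>lborel)"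
      by (simp add: scaleR_conv_of_real mult.assoc)
    also have "\<dots> = complex_of_real (g y) * (\<integral>u. iexp (- (u \<bullet> y)) * G u \<partial>lborel)"
      by (rule integral_mult_right_zero)
    finally show "complex_of_real (g y) * inv_fourier G y = complex_of_real (1 / (2 * pi)\<^sup>2) * (\<integral>u. ?F y u \<partial>lborel)"
      by (simp add: inv_fourier_def)
  qed
  also have "\<dots> = complex_of_real (1 / (2 * pi)\<^sup>2) * (\<integral>y. \<integral>u. ?F y u \<partial>lborel \<partial>lborel)"
    by (rule integral_mult_right_zero)
  also have "(\<integral>y. \<integral>u. ?F y u \<partial>lborel \<partial>lborel) = (\<integral>u. \<integral>y. ?F y u \<partial>lborel \<partial>lborel)"
    using lborel_pair.Fubini_integral[OF iF] by simp
  also have "\<dots> = (\<integral>u. fourier (\<lambda>x. complex_of_real (g x)) (- u) * G u \<partial>lborel)"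
  proof (intro Bochner_Integration.integral_cong refl)
    fix u
    have "(\<integral>y. ?F y u \<partial>lborel) = (\<integral>y. g y *\<^sub>R iexp (- (u \<bullet> y)) \<partial>lborel) * G u"
      by (rule integral_mult_left_zero)
    then show "(\<integral>y. ?F y u \<partial>lborel) = fourier (\<lambda>x. complex_of_real (g x)) (- u) * G u"
      by (simp add: fourier_def scaleR_conv_of_real mult.commute)
  qed
  finally show ?thesis .
qed

text \<open>The Jacobian of \<open>x = h z\<close> cancels the factor \<open>1 / h^2\<close> of the
  scaled kernel.\<close>

lemma fourier_kernel_scale:
  assumes [measurable]: "K \<in> borel_measurable borel" and h: "0 < h"
  shows "fourier (\<lambda>z. complex_of_real (kernel_scale K h z)) u = fourier (\<lambda>z. complex_of_real (K z)) (h *\<^sub>R u)"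
proof -
  let ?f = "\<lambda>x. iexp (u \<bullet> x) * complex_of_real (kernel_scale K h x)"
  have [measurable]: "kernel_scale K h \<in> borel_measurable borel"
    unfolding kernel_scale_def[abs_def] by measurable
  have "(\<integral>x. ?f x \<partial>lborel) = (\<integral>x. ?f x \<partial>density (distr lborel borel (\<lambda>x::real^2. 0 + h *\<^sub>R x)) (\<lambda>_. ennreal (\<bar>h\<bar> ^ DIM(real^2))))"
    using h by (subst lborel_affine[of h 0]) auto
  also have "\<dots> = (\<integral>z. h\<^sup>2 *\<^sub>R ?f (h *\<^sub>R z) \<partial>lborel)"
    using h by (simp add: integral_density integral_distr)
  also have "\<dots> = (\<integral>z. iexp (h *\<^sub>R u \<bullet> z) * complex_of_real (K z) \<partial>lborel)"
  proof (intro Bochner_Integration.integral_cong refl)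
    fix z
    have "kernel_scale K h (h *\<^sub>R z) = K z / h\<^sup>2" using h by (simp add: kernel_scale_def)
    then show "h\<^sup>2 *\<^sub>R ?f (h *\<^sub>R z) = iexp (h *\<^sub>R u \<bullet> z) * complex_of_real (K z)"
      using h by (simp add: scaleR_conv_of_real[where 'a = complex])
  qed
  finally show ?thesis by (simp add: fourier_def)
qed

section \<open>Integrals behind the bias\<close>

lemma nn_integral_abs_le:
  fixes f :: "real \<Rightarrow> ennreal"
  assumes [measurable]: "f \<in> borel_measurable borel"
  shows "(\<integral>\<^sup>+t. f \<bar>t\<bar> \<partial>lborel) \<le> 2 * (\<integral>\<^sup>+t. f t * indicator {0..} t \<partial>lborel)"
proof -
  have "(\<integral>\<^sup>+t. f \<bar>t\<bar> \<partial>lborel) \<le> (\<integral>\<^sup>+t. f t * indicator {0..} t + f (- t) * indicator {0..} (- t) \<partial>lborel)"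
    by (intro nn_integral_mono) (auto simp: indicator_def)
  also have "\<dots> = (\<integral>\<^sup>+t. f t * indicator {0..} t \<partial>lborel) + (\<integral>\<^sup>+t. f (- t) * indicator {0..} (- t) \<partial>lborel)"
    by (rule nn_integral_add) measurable
  also have "(\<integral>\<^sup>+t. f (- t) * indicator {0..} (- t) \<partial>lborel) = (\<integral>\<^sup>+t. f t * indicator {0..} t \<partial>lborel)"
    by (subst nn_integral_real_affine[of "\<lambda>t. f t * indicator {0..} t" "- 1" 0]) auto
  finally show ?thesis by (simp add: mult_2)
qed

lemma nn_integral_inverse_square:
  fixes a :: real
  assumes "0 \<le> a"
  shows "(\<integral>\<^sup>+t. ennreal (1 / (1 + t)\<^sup>2) * indicator {a..} t \<partial>lborel) = ennreal (1 / (1 + a))"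
proof -
  have "(\<integral>\<^sup>+t. ennreal (1 / (1 + t)\<^sup>2) * indicator {a..} t \<partial>lborel) = ennreal (0 - (- (1 / (1 + a))))"
  proof (rule nn_integral_FTC_atLeast[where F = "\<lambda>t. - (1 / (1 + t))"])
    show "((\<lambda>t. - (1 / (1 + t))) has_real_derivative 1 / (1 + t)\<^sup>2) (at t)" if "a \<le> t" for t
      using that assms by (auto intro!: derivative_eq_intros simp: power2_eq_square)
    show "((\<lambda>t::real. - (1 / (1 + t))) \<longlongrightarrow> 0) at_top" by real_asymp
  qed auto
  then show ?thesis by simp
qed

lemma nn_integral_line_weight: "(\<integral>\<^sup>+t. ennreal (1 / (1 + \<bar>t\<bar>)\<^sup>2) \<partial>lborel) \<le> 2"
proof -
  have "(\<integral>\<^sup>+t. ennreal (1 / (1 + \<bar>t\<bar>)\<^sup>2) \<partial>lborel) \<le> 2 * (\<integral>\<^sup>+t. ennreal (1 / (1 + t)\<^sup>2) * indicator {0..} t \<partial>lborel)"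
    by (rule nn_integral_abs_le) measurable
  then show ?thesis by (simp add: nn_integral_inverse_square)
qed

text \<open>Split at \<open>t = 1 / h\<close>. Below, the linear bound leaves
  \<open>L h / (1 + t)\<close>, whose integral is the logarithm in the rate; above, the bound 2
  leaves a tail of order \<open>h\<close>.\<close>

lemma nn_integral_bias_line:
  assumes h: "0 < h" and L: "0 \<le> L"
  shows "(\<integral>\<^sup>+t. ennreal (min 2 (L * h * \<bar>t\<bar>) / (1 + \<bar>t\<bar>)\<^sup>2) \<partial>lborel) \<le> ennreal (2 * (L * h * ln (1 + 1 / h) + 2 * h))"
proof -
  have "(\<integral>\<^sup>+t. ennreal (min 2 (L * h * \<bar>t\<bar>) / (1 + \<bar>t\<bar>)\<^sup>2) \<partial>lborel) \<le>
    2 * (\<integral>\<^sup>+t. ennreal (min 2 (L * h * t) / (1 + t)\<^sup>2) * indicator {0..} t \<partial>lborel)"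
    by (rule nn_integral_abs_le) measurable
  also have "\<dots> \<le> 2 * (\<integral>\<^sup>+t. ennreal (L * h / (1 + t)) * indicator {0..1/h} t + 2 * (ennreal (1 / (1 + t)\<^sup>2) * indicator {1/h..} t) \<partial>lborel)"
  proof (rule mult_left_mono, rule nn_integral_mono)
    fix t :: real
    consider "t < 0" | "0 \<le> t" "t < 1 / h" | "1 / h \<le> t" by linarith
    then show "ennreal (min 2 (L * h * t) / (1 + t)\<^sup>2) * indicator {0..} t \<le>
      ennreal (L * h / (1 + t)) * indicator {0..1/h} t + 2 * (ennreal (1 / (1 + t)\<^sup>2) * indicator {1/h..} t)"
    proof cases
      case 2
      have "min 2 (L * h * t) / (1 + t)\<^sup>2 \<le> (L * h * (1 + t)) / (1 + t)\<^sup>2"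
        using 2 L h by (intro divide_right_mono min.coboundedI2 mult_left_mono) auto
      also have "\<dots> = L * h / (1 + t)" using 2 by (simp add: power2_eq_square)
      finally show ?thesis using 2 by (simp add: ennreal_leI)
    next
      case 3
      have "0 \<le> t" using 3 h by (meson divide_nonneg_pos order_trans zero_le_one)
      have "min 2 (L * h * t) / (1 + t)\<^sup>2 \<le> 2 / (1 + t)\<^sup>2" by (intro divide_right_mono) auto
      then have "ennreal (min 2 (L * h * t) / (1 + t)\<^sup>2) \<le> ennreal (2 * (1 / (1 + t)\<^sup>2))" by (intro ennreal_leI) simp
      also have "\<dots> = 2 * ennreal (1 / (1 + t)\<^sup>2)" by (subst ennreal_mult) auto
      finally show ?thesis using 3 \<open>0 \<le> t\<close> by (auto intro: add_increasing)
    qed simp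
  qed simp
  also have "\<dots> = 2 * ((\<integral>\<^sup>+t. ennreal (L * h / (1 + t)) * indicator {0..1/h} t \<partial>lborel) + 2 * (\<integral>\<^sup>+t. ennreal (1 / (1 + t)\<^sup>2) * indicator {1/h..} t \<partial>lborel))"
    by (subst nn_integral_add) (auto simp: nn_integral_cmult)
  also have "(\<integral>\<^sup>+t. ennreal (L * h / (1 + t)) * indicator {0..1/h} t \<partial>lborel) = ennreal (L * h * ln (1 + 1 / h) - L * h * ln (1 + 0))"
  proof (rule nn_integral_FTC_Icc[where F = "\<lambda>t. L * h * ln (1 + t)"])
    show "((\<lambda>t. L * h * ln (1 + t)) has_real_derivative L * h / (1 + t)) (at t)" if "t \<in> {0..1/h}" for t
      using that by (auto intro!: derivative_eq_intros)
  qed (use h L in auto)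
  also have "(\<integral>\<^sup>+t. ennreal (1 / (1 + t)\<^sup>2) * indicator {1/h..} t \<partial>lborel) = ennreal (1 / (1 + 1 / h))"
    using h by (intro nn_integral_inverse_square) auto
  also have "2 * (ennreal (L * h * ln (1 + 1 / h) - L * h * ln (1 + 0)) + 2 * ennreal (1 / (1 + 1 / h))) = ennreal (2 * (L * h * ln (1 + 1 / h) + 2 * (1 / (1 + 1 / h))))"
  proof -
    have "0 \<le> L * h * ln (1 + 1 / h)" "0 \<le> 1 / (1 + 1 / h)" using h L by auto
    moreover have "2 * (ennreal a + 2 * ennreal b) = ennreal (2 * (a + 2 * b))" if "0 \<le> a" "0 \<le> b" for a b
      using that by (simp add: ennreal_mult)
    ultimately show ?thesis by (metis add_0_right diff_zero ln_one mult_zero_right)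
  qed
  also have "\<dots> \<le> ennreal (2 * (L * h * ln (1 + 1 / h) + 2 * h))"
  proof -
    have "1 / (1 + 1 / h) \<le> h" using h by (simp add: field_simps)
    then show ?thesis by (intro ennreal_leI) simp
  qed
  finally show ?thesis .
qed

lemma integrable_inverse_cross_weight_sq: "integrable lborel (\<lambda>u. 1 / (cross_weight u)\<^sup>2)"
proof -
  have "integrable lborel (\<lambda>t::real. 1 / (1 + \<bar>t\<bar>)\<^sup>2)"
    using nn_integral_line_weight by (intro integrableI_nonneg) (auto intro: le_less_trans)
  from integrable_real2_mult[OF this this] show ?thesis
    by (simp add: cross_weight_def power_mult_distrib)
qed

text \<open>Since \<open>norm u\<close> is at most the sum of the absolute coordinates and
  truncation at 2 is subadditive, two products of functions of one variable dominate. The constant 8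
  collects the two products, the 2 of \<open>nn_integral_line_weight\<close> and the 2 of
  \<open>nn_integral_bias_line\<close>.\<close>

lemma nn_integral_bias:
  assumes h: "0 < h" and L: "0 \<le> L"
  shows "(\<integral>\<^sup>+u. ennreal (min 2 (L * h * norm u) / (cross_weight u)\<^sup>2) \<partial>lborel) \<le> ennreal (8 * (L * h * ln (1 + 1 / h) + 2 * h))"
proof -
  let ?w = "\<lambda>t::real. ennreal (1 / (1 + \<bar>t\<bar>)\<^sup>2)" and ?b = "\<lambda>t::real. ennreal (min 2 (L * h * \<bar>t\<bar>) / (1 + \<bar>t\<bar>)\<^sup>2)"
  let ?B = "ennreal (2 * (L * h * ln (1 + 1 / h) + 2 * h))"
  have "(\<integral>\<^sup>+u. ennreal (min 2 (L * h * norm u) / (cross_weight u)\<^sup>2) \<partial>(lborel :: (real^2) measure)) \<le>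
    (\<integral>\<^sup>+u. ?b (u $ 1) * ?w (u $ 2) + ?w (u $ 1) * ?b (u $ 2) \<partial>(lborel :: (real^2) measure))"
  proof (intro nn_integral_mono)
    fix u :: "real^2"
    have "norm u \<le> \<bar>u $ 1\<bar> + \<bar>u $ 2\<bar>" using norm_le_l1_cart[of u] by (simp add: sum_2)
    then have "L * h * norm u \<le> L * h * \<bar>u $ 1\<bar> + L * h * \<bar>u $ 2\<bar>"
      using L h by (metis distrib_left mult_left_mono mult_nonneg_nonneg less_imp_le)
    moreover have "0 \<le> L * h * \<bar>u $ 1\<bar>" "0 \<le> L * h * \<bar>u $ 2\<bar>" using L h by auto
    ultimately have "min 2 (L * h * norm u) \<le> min 2 (L * h * \<bar>u $ 1\<bar>) + min 2 (L * h * \<bar>u $ 2\<bar>)"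
      by (auto simp: min_def)
    then have "min 2 (L * h * norm u) / (cross_weight u)\<^sup>2 \<le> (min 2 (L * h * \<bar>u $ 1\<bar>) + min 2 (L * h * \<bar>u $ 2\<bar>)) / (cross_weight u)\<^sup>2"
      by (intro divide_right_mono) auto
    also have "\<dots> = min 2 (L * h * \<bar>u $ 1\<bar>) / (1 + \<bar>u $ 1\<bar>)\<^sup>2 * (1 / (1 + \<bar>u $ 2\<bar>)\<^sup>2) + 1 / (1 + \<bar>u $ 1\<bar>)\<^sup>2 * (min 2 (L * h * \<bar>u $ 2\<bar>) / (1 + \<bar>u $ 2\<bar>)\<^sup>2)"
      by (simp add: cross_weight_def power_mult_distrib add_divide_distrib)
    finally have "ennreal (min 2 (L * h * norm u) / (cross_weight u)\<^sup>2) \<le> ennreal \<dots>" by (rule ennreal_leI)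
    also have "\<dots> = ?b (u $ 1) * ?w (u $ 2) + ?w (u $ 1) * ?b (u $ 2)"
    proof -
      have "0 \<le> a \<Longrightarrow> 0 \<le> b \<Longrightarrow> 0 \<le> c \<Longrightarrow> 0 \<le> d \<Longrightarrow>
          ennreal (a * b + c * d) = ennreal a * ennreal b + ennreal c * ennreal d" for a b c d
        by (simp add: ennreal_mult ennreal_plus)
      note * = this
      show ?thesis by (rule *) (use L h in auto)
    qed
    finally show "ennreal (min 2 (L * h * norm u) / (cross_weight u)\<^sup>2) \<le> ?b (u $ 1) * ?w (u $ 2) + ?w (u $ 1) * ?b (u $ 2)" .
  qed
  also have "\<dots> = (\<integral>\<^sup>+t. ?b t \<partial>lborel) * (\<integral>\<^sup>+t. ?w t \<partial>lborel) + (\<integral>\<^sup>+t. ?w t \<partial>lborel) * (\<integral>\<^sup>+t. ?b t \<partial>lborel)"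
    by (subst nn_integral_add, measurable, measurable, subst (1 2) nn_integral_real2_mult) auto
  also have "\<dots> \<le> ?B * 2 + 2 * ?B"
    by (intro add_mono mult_mono nn_integral_bias_line nn_integral_line_weight h L) auto
  also have "\<dots> = ennreal (8 * (L * h * ln (1 + 1 / h) + 2 * h))"
  proof -
    have n: "0 \<le> 2 * (L * h * ln (1 + 1 / h) + 2 * h)" using h L by auto
    have "?B * 2 + 2 * ?B = ennreal 4 * ?B" by (simp add: mult.commute distrib_right[symmetric])
    also have "\<dots> = ennreal (4 * (2 * (L * h * ln (1 + 1 / h) + 2 * h)))" by (rule ennreal_mult[symmetric]) (use n in auto)
    finally show ?thesis by simp
  qed
  finally show ?thesis .
qed

subsection \<open>The characteristic function at time 1\<close>

lemma inner_line: "(u + s *\<^sub>R axis k 1) \<bullet> x = u \<bullet> x + s * (x :: real^2) $ k"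
  by (simp add: inner_add_left inner_axis')

lemma iexp_line: "iexp ((u + s *\<^sub>R axis k 1) \<bullet> x) = iexp (u \<bullet> x) * iexp (s * (x :: real^2) $ k)"
  unfolding inner_line by (simp add: distrib_left exp_add)

lemma has_vector_derivative_iexp_line:
  fixes x :: "real^2"
  shows "((\<lambda>s. c * iexp ((u + s *\<^sub>R axis k 1) \<bullet> x)) has_vector_derivative
    c * (\<i> * x $ k * iexp ((u + s *\<^sub>R axis k 1) \<bullet> x))) (at s)"
  using has_vector_derivative_iexp_scaled[of "c * iexp (u \<bullet> x)" "x $ k" s UNIV]
  unfolding iexp_line by (simp add: mult_ac)

text \<open>The \<open>j\<close>-th derivative in direction \<open>k\<close> of the transform of
  \<open>m\<close>, with the factor \<open>\<i>^j\<close> kept. For \<open>\<nu>\<close> it is used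
  only with \<open>j \<ge> 2\<close>, where the moments exist.\<close>

definition char_moment :: "(real^2) measure \<Rightarrow> 2 \<Rightarrow> nat \<Rightarrow> real^2 \<Rightarrow> complex" where
  "char_moment m k j u = (\<integral>x. (\<i> * complex_of_real (x $ k))^j * iexp (u \<bullet> x) \<partial>m)"

lemma integrable_char_moment:
  assumes s [measurable_cong]: "sets m = sets borel" and i: "integrable m (\<lambda>x. \<bar>x $ k\<bar>^j)"
  shows "integrable m (\<lambda>x. (\<i> * complex_of_real (x $ k))^j * iexp (u \<bullet> x))"
  by (rule Bochner_Integration.integrable_bound[OF i]) (auto simp: norm_mult norm_power)

lemma char_moment_bound:
  "cmod (char_moment m k j u) \<le> (\<integral>x. \<bar>x $ k\<bar>^j \<partial>m)"
proof -
  have "cmod (char_moment m k j u) \<le> (\<integral>x. cmod ((\<i> * complex_of_real (x $ k))^j * iexp (u \<bullet> x)) \<partial>m)"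
    unfolding char_moment_def by (rule integral_norm_bound)
  then show ?thesis by (simp add: norm_mult norm_power)
qed

text \<open>The differentiated integrand has modulus \<open>\<bar>x $ k\<bar>^Suc j\<close> at every
  frequency, and this is the dominating function.\<close>

lemma has_vector_derivative_char_moment:
  assumes s [measurable_cong]: "sets m = sets borel" and i: "integrable m (\<lambda>x. \<bar>x $ k\<bar>^j)" "integrable m (\<lambda>x. \<bar>x $ k\<bar>^Suc j)"
  shows "((\<lambda>s. char_moment m k j (u + s *\<^sub>R axis k 1)) has_vector_derivative char_moment m k (Suc j) (u + s *\<^sub>R axis k 1)) (at s)"
proof -
  have "((\<lambda>s. char_moment m k j (u + s *\<^sub>R axis k 1)) has_vector_derivative
    (\<integral>x. (\<i> * complex_of_real (x $ k))^j * (\<i> * x $ k * iexp ((u + s *\<^sub>R axis k 1) \<bullet> x)) \<partial>m)) (at s)"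
    unfolding char_moment_def
    by (rule has_vector_derivative_integral[OF zero_less_one integrable_char_moment[OF s i(1)] has_vector_derivative_iexp_line _ i(2)])
      (auto simp: norm_mult norm_power)
  then show ?thesis by (simp add: char_moment_def mult_ac)
qed

text \<open>The fourth cumulant as a polynomial in the normalised derivatives of a characteristic function.\<close>

definition cumulant4 :: "complex \<Rightarrow> complex \<Rightarrow> complex \<Rightarrow> complex \<Rightarrow> complex" where
  "cumulant4 a b c d = d - 4 * (a * c) - 3 * b\<^sup>2 + 12 * (a\<^sup>2 * b) - 6 * a^4"

text \<open>\<open>P\<close> is the law of the process at time 1. The moments of
  \<open>\<nu>\<close> start at order 2 because \<open>\<nu>\<close> may have infinite mass and
  infinite first moment near the origin.\<close>

locale levy_law =
  fixes \<Sigma> :: "real^2^2" and \<nu> :: "(real^2) measure" and \<alpha> :: "real^2" and P :: "(real^2) measure"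
  assumes sets_nu [measurable_cong]: "sets \<nu> = sets borel"
    and nu_moment: "\<And>j. 2 \<le> j \<Longrightarrow> j \<le> 8 \<Longrightarrow> integrable \<nu> (\<lambda>x. norm x ^ j)"
    and prob_P: "prob_space P" and sets_P [measurable_cong]: "sets P = sets borel"
    and law: "\<And>u. fourier_measure P u = levy_char \<Sigma> \<nu> \<alpha> u"
begin

interpretation P: prob_space P by (rule prob_P)

text \<open>The exponent of the characteristic function. Its first two derivatives
  \<open>psi1\<close> and \<open>psi2\<close> still contain contributions of drift, Gaussian part or
  compensator; from the third on only \<open>char_moment \<nu>\<close> is left.\<close>

definition psi0 :: "real^2 \<Rightarrow> complex" where
  "psi0 u = - complex_of_real ((u \<bullet> (\<Sigma> *v u)) / 2) + \<i> * complex_of_real (u \<bullet> \<alpha>)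
    + (\<integral>x. iexp (u \<bullet> x) - 1 - \<i> * complex_of_real (u \<bullet> x) \<partial>\<nu>)"

definition psi1 :: "2 \<Rightarrow> real^2 \<Rightarrow> complex" where
  "psi1 k u = - complex_of_real ((u \<bullet> (\<Sigma> *v axis k 1) + axis k 1 \<bullet> (\<Sigma> *v u)) / 2) + \<i> * complex_of_real (\<alpha> $ k)
    + (\<integral>x. \<i> * complex_of_real (x $ k) * (iexp (u \<bullet> x) - 1) \<partial>\<nu>)"

definition psi2 :: "2 \<Rightarrow> real^2 \<Rightarrow> complex" where
  "psi2 k u = - complex_of_real (axis k 1 \<bullet> (\<Sigma> *v axis k 1)) + char_moment \<nu> k 2 u"

lemma levy_char_psi0: "levy_char \<Sigma> \<nu> \<alpha> u = exp (psi0 u)"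
  by (simp add: levy_char_def psi0_def)

lemma nu_moment_comp: "2 \<le> j \<Longrightarrow> j \<le> 8 \<Longrightarrow> integrable \<nu> (\<lambda>x. \<bar>x $ k\<bar>^j)"
  by (rule Bochner_Integration.integrable_bound[OF nu_moment[of j]])
    (auto intro!: power_mono component_le_norm_cart)

lemma integrand0_bound: "cmod (iexp (u \<bullet> x) - 1 - \<i> * complex_of_real (u \<bullet> x)) \<le> (norm u)\<^sup>2 / 2 * norm x ^ 2"
proof -
  have "cmod (iexp (u \<bullet> x) - 1 - \<i> * complex_of_real (u \<bullet> x)) \<le> \<bar>u \<bullet> x\<bar>\<^sup>2 / 2"
    using iexp_approx1[of "u \<bullet> x" 1] by (simp add: numeral_2_eq_2 diff_diff_eq)
  also have "\<dots> \<le> (norm u * norm x)\<^sup>2 / 2"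
    by (intro divide_right_mono power_mono Cauchy_Schwarz_ineq2) auto
  finally show ?thesis by (simp add: power_mult_distrib)
qed

lemma integrand1_bound: "cmod (\<i> * complex_of_real (x $ k) * (iexp (u \<bullet> x) - 1)) \<le> norm u * norm x ^ 2"
proof -
  have "cmod (iexp (u \<bullet> x) - 1) \<le> \<bar>u \<bullet> x\<bar>" using iexp_approx1[of "u \<bullet> x" 0] by simp
  also have "\<dots> \<le> norm u * norm x" by (rule Cauchy_Schwarz_ineq2)
  finally have "\<bar>x $ k\<bar> * cmod (iexp (u \<bullet> x) - 1) \<le> norm x * (norm u * norm x)"
    by (intro mult_mono component_le_norm_cart) auto
  then show ?thesis by (simp add: norm_mult power2_eq_square mult_ac)
qed

lemma integrable_integrand0: "integrable \<nu> (\<lambda>x. iexp (u \<bullet> x) - 1 - \<i> * complex_of_real (u \<bullet> x))"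
proof -
  have i: "integrable \<nu> (\<lambda>x. (norm u)\<^sup>2 / 2 * norm x ^ 2)" using nu_moment[of 2] by simp
  show ?thesis
    by (rule Bochner_Integration.integrable_bound[OF i])
      (measurable, rule AE_I2, rule order_trans[OF integrand0_bound], simp)
qed

lemma integrable_integrand1: "integrable \<nu> (\<lambda>x. \<i> * complex_of_real (x $ k) * (iexp (u \<bullet> x) - 1))"
proof -
  have i: "integrable \<nu> (\<lambda>x. norm u * norm x ^ 2)" using nu_moment[of 2] by simp
  show ?thesis
    by (rule Bochner_Integration.integrable_bound[OF i])
      (measurable, rule AE_I2, rule order_trans[OF integrand1_bound], simp)
qed

lemma linear_line: "((\<lambda>s. complex_of_real (a + s * b)) has_vector_derivative complex_of_real b) (at s)"
  by (auto intro!: derivative_eq_intros simp: has_vector_derivative_def scaleR_conv_of_real)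

lemma deriv_psi1:
  "((\<lambda>s. psi1 k (u + s *\<^sub>R axis k 1)) has_vector_derivative psi2 k (u + s *\<^sub>R axis k 1)) (at s)"
proof -
  let ?e = "axis k 1 :: real^2"
  have lin: "((u + s *\<^sub>R ?e) \<bullet> (\<Sigma> *v ?e) + ?e \<bullet> (\<Sigma> *v (u + s *\<^sub>R ?e))) / 2 =
      (u \<bullet> (\<Sigma> *v ?e) + ?e \<bullet> (\<Sigma> *v u)) / 2 + s * (?e \<bullet> (\<Sigma> *v ?e))" for s
    by (simp add: matrix_vector_right_distrib matrix_vector_mult_scaleR inner_add_left inner_add_right field_simps)
  have i2: "integrable \<nu> (\<lambda>x. \<bar>x $ k\<bar>^2)" by (rule nu_moment_comp) auto
  have "((\<lambda>s. \<integral>x. \<i> * complex_of_real (x $ k) * (iexp ((u + s *\<^sub>R ?e) \<bullet> x) - 1) \<partial>\<nu>) has_vector_derivative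
    (\<integral>x. \<i> * complex_of_real (x $ k) * (\<i> * x $ k * iexp ((u + s *\<^sub>R ?e) \<bullet> x)) \<partial>\<nu>)) (at s)"
  proof (rule has_vector_derivative_integral[OF zero_less_one integrable_integrand1 _ _ i2])
    show "((\<lambda>s. \<i> * complex_of_real (x $ k) * (iexp ((u + s *\<^sub>R ?e) \<bullet> x) - 1)) has_vector_derivative
      \<i> * complex_of_real (x $ k) * (\<i> * x $ k * iexp ((u + s *\<^sub>R ?e) \<bullet> x))) (at s)" for s x
      using has_vector_derivative_diff[OF has_vector_derivative_iexp_line[of "\<i> * complex_of_real (x $ k)" u k x s]
        has_vector_derivative_const[of "\<i> * complex_of_real (x $ k)"]]
      by (simp add: right_diff_distrib)
  qed (auto simp: norm_mult power2_eq_square abs_mult)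
  then have "((\<lambda>s. \<integral>x. \<i> * complex_of_real (x $ k) * (iexp ((u + s *\<^sub>R ?e) \<bullet> x) - 1) \<partial>\<nu>) has_vector_derivative
    char_moment \<nu> k 2 (u + s *\<^sub>R ?e)) (at s)"
    by (simp add: char_moment_def power2_eq_square mult_ac)
  from has_vector_derivative_add[OF has_vector_derivative_add[OF has_vector_derivative_minus[OF linear_line[of "(u \<bullet> (\<Sigma> *v ?e) + ?e \<bullet> (\<Sigma> *v u)) / 2" "?e \<bullet> (\<Sigma> *v ?e)"]] has_vector_derivative_const[of "\<i> * complex_of_real (\<alpha> $ k)"]] this]
  show ?thesis unfolding psi1_def psi2_def lin by simp
qed

lemma deriv_psi0:
  "((\<lambda>s. psi0 (u + s *\<^sub>R axis k 1)) has_vector_derivative psi1 k (u + s *\<^sub>R axis k 1)) (at s)"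
proof -
  let ?e = "axis k 1 :: real^2"
  have quad: "(u + s *\<^sub>R ?e) \<bullet> (\<Sigma> *v (u + s *\<^sub>R ?e)) / 2 =
      (u \<bullet> (\<Sigma> *v u) + s * (u \<bullet> (\<Sigma> *v ?e) + ?e \<bullet> (\<Sigma> *v u)) + s\<^sup>2 * (?e \<bullet> (\<Sigma> *v ?e))) / 2" for s
    by (simp add: matrix_vector_right_distrib matrix_vector_mult_scaleR inner_add_left inner_add_right field_simps power2_eq_square)
  have lin: "((u + s *\<^sub>R ?e) \<bullet> (\<Sigma> *v ?e) + ?e \<bullet> (\<Sigma> *v (u + s *\<^sub>R ?e))) / 2 =
      (u \<bullet> (\<Sigma> *v ?e) + ?e \<bullet> (\<Sigma> *v u)) / 2 + s * (?e \<bullet> (\<Sigma> *v ?e))" for s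
    by (simp add: matrix_vector_right_distrib matrix_vector_mult_scaleR inner_add_left inner_add_right field_simps)
  have "((\<lambda>s. (a + s * b + s\<^sup>2 * c) / 2) has_real_derivative (b / 2 + s * c)) (at s)" for a b c :: real
    by (auto intro!: derivative_eq_intros)
  note dq0 = has_vector_derivative_of_real[OF this[of "u \<bullet> (\<Sigma> *v u)" "u \<bullet> (\<Sigma> *v ?e) + ?e \<bullet> (\<Sigma> *v u)" "?e \<bullet> (\<Sigma> *v ?e)"]]
  have dq: "((\<lambda>s. complex_of_real ((u + s *\<^sub>R ?e) \<bullet> (\<Sigma> *v (u + s *\<^sub>R ?e)) / 2)) has_vector_derivative
    complex_of_real (((u + s *\<^sub>R ?e) \<bullet> (\<Sigma> *v ?e) + ?e \<bullet> (\<Sigma> *v (u + s *\<^sub>R ?e))) / 2)) (at s)"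
    unfolding quad lin by (rule dq0)
  have da: "((\<lambda>s. \<i> * complex_of_real ((u + s *\<^sub>R ?e) \<bullet> \<alpha>)) has_vector_derivative \<i> * complex_of_real (\<alpha> $ k)) (at s)"
    unfolding inner_line by (rule has_vector_derivative_mult_right[OF linear_line])
  have di: "((\<lambda>s. \<integral>x. iexp ((u + s *\<^sub>R ?e) \<bullet> x) - 1 - \<i> * complex_of_real ((u + s *\<^sub>R ?e) \<bullet> x) \<partial>\<nu>) has_vector_derivative
    (\<integral>x. \<i> * complex_of_real (x $ k) * (iexp ((u + s *\<^sub>R ?e) \<bullet> x) - 1) \<partial>\<nu>)) (at s)"
  proof (rule has_vector_derivative_integral[OF zero_less_one integrable_integrand0])
    \<comment> \<open>\<open>integrand1_bound\<close> depends on the frequency; within distance 1 of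
      \<open>s\<close> the norm of the frequency grows by at most 1.\<close>
    show "integrable \<nu> (\<lambda>x. (norm (u + s *\<^sub>R ?e) + 1) * norm x ^ 2)" using nu_moment[of 2] by simp
    show "cmod (\<i> * complex_of_real (x $ k) * (iexp ((u + r *\<^sub>R ?e) \<bullet> x) - 1)) \<le> (norm (u + s *\<^sub>R ?e) + 1) * norm x ^ 2"
      if "r \<in> ball s 1" for r x
    proof -
      have "norm (u + r *\<^sub>R ?e) \<le> norm (u + s *\<^sub>R ?e) + norm ((r - s) *\<^sub>R ?e)"
        using norm_triangle_ineq[of "u + s *\<^sub>R ?e" "(r - s) *\<^sub>R ?e"] by (simp add: algebra_simps)
      also have "norm ((r - s) *\<^sub>R ?e) \<le> 1" using that by (simp add: dist_real_def norm_axis_1)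
      finally have "norm (u + r *\<^sub>R ?e) * norm x ^ 2 \<le> (norm (u + s *\<^sub>R ?e) + 1) * norm x ^ 2"
        by (intro mult_right_mono) auto
      then show ?thesis by (rule order_trans[OF integrand1_bound])
    qed
    show "((\<lambda>s. iexp ((u + s *\<^sub>R ?e) \<bullet> x) - 1 - \<i> * complex_of_real ((u + s *\<^sub>R ?e) \<bullet> x)) has_vector_derivative
      \<i> * complex_of_real (x $ k) * (iexp ((u + r *\<^sub>R ?e) \<bullet> x) - 1)) (at r)" for r x
    proof -
      have "((\<lambda>s. \<i> * complex_of_real ((u + s *\<^sub>R ?e) \<bullet> x)) has_vector_derivative \<i> * complex_of_real (x $ k)) (at r)"
        unfolding inner_line by (rule has_vector_derivative_mult_right[OF linear_line])
      from has_vector_derivative_diff[OF has_vector_derivative_diff[OF has_vector_derivative_iexp_line[of 1 u k x r] has_vector_derivative_const[of 1]] this]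
      show ?thesis by (simp add: right_diff_distrib)
    qed
  qed auto
  from has_vector_derivative_add[OF has_vector_derivative_add[OF has_vector_derivative_minus[OF dq] da] di]
  show ?thesis unfolding psi0_def psi1_def by simp
qed

lemma deriv_psi2:
  "((\<lambda>s. psi2 k (u + s *\<^sub>R axis k 1)) has_vector_derivative char_moment \<nu> k 3 (u + s *\<^sub>R axis k 1)) (at s)"
proof -
  have "((\<lambda>s. char_moment \<nu> k 2 (u + s *\<^sub>R axis k 1)) has_vector_derivative char_moment \<nu> k (Suc 2) (u + s *\<^sub>R axis k 1)) (at s)"
    by (rule has_vector_derivative_char_moment[OF sets_nu]) (rule nu_moment_comp; simp)+
  from has_vector_derivative_add[OF has_vector_derivative_const[of "- complex_of_real (axis k 1 \<bullet> (\<Sigma> *v axis k 1))"] this]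
  show ?thesis by (simp add: psi2_def)
qed

lemma deriv_char_moment_nu:
  "2 \<le> j \<Longrightarrow> j \<le> 7 \<Longrightarrow> ((\<lambda>s. char_moment \<nu> k j (u + s *\<^sub>R axis k 1)) has_vector_derivative char_moment \<nu> k (Suc j) (u + s *\<^sub>R axis k 1)) (at s)"
  by (rule has_vector_derivative_char_moment[OF sets_nu]) (rule nu_moment_comp; simp)+

lemma deriv_levy_char:
  "((\<lambda>s. levy_char \<Sigma> \<nu> \<alpha> (u + s *\<^sub>R axis k 1)) has_vector_derivative
    psi1 k (u + s *\<^sub>R axis k 1) * levy_char \<Sigma> \<nu> \<alpha> (u + s *\<^sub>R axis k 1)) (at s)"
  using field_vector_diff_chain_at[OF deriv_psi0 DERIV_exp]
  by (simp add: levy_char_psi0 o_def)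

text \<open>Along the axis \<open>k\<close> the characteristic function of \<open>P\<close> is that
  of the \<open>k\<close>-th marginal, and its logarithmic derivative is \<open>psi1\<close>.
  Moments of \<open>\<nu>\<close> thus become smoothness, and smoothness becomes moments of
  \<open>P\<close>.\<close>

lemma P_moment8: "integrable P (\<lambda>x. (x $ k)^8)"
proof -
  let ?Q = "distr P borel (\<lambda>x. x $ k)"
  let ?l = "\<lambda>s. 0 + s *\<^sub>R axis k (1 :: real)"
  \<comment> \<open>Moments of \<open>\<nu>\<close> up to order 8 leave \<open>8 - 3 = 5\<close>
    derivatives here; the steps to \<open>psi2\<close>, to \<open>psi1\<close> and to the
    characteristic function add one each and make eight.\<close>
  have C3: "times_differentiable 5 (\<lambda>s. char_moment \<nu> k 3 (?l s))"
  proof -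
    have "times_differentiable n (\<lambda>s. char_moment \<nu> k j (?l s))" if "2 \<le> j" "j + n \<le> 8" for n j
      using that
    proof (induction n arbitrary: j)
      case (Suc n)
      show ?case
        by (rule times_differentiable_SucI[OF deriv_char_moment_nu Suc.IH]) (use Suc.prems in auto)
    qed simp
    from this[of 3 5] show ?thesis by simp
  qed
  have "times_differentiable (Suc (Suc 5)) (\<lambda>s. psi1 k (?l s))"
    by (rule times_differentiable_SucI[OF deriv_psi1 times_differentiable_SucI[OF deriv_psi2 C3]])
  then have "times_differentiable (Suc (Suc (Suc 5))) (\<lambda>s. levy_char \<Sigma> \<nu> \<alpha> (?l s))"
    by (rule times_differentiable_logarithmic_derivative[OF deriv_levy_char])
  moreover have "levy_char \<Sigma> \<nu> \<alpha> (?l s) = char ?Q s" for s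
    by (simp add: law[symmetric] fourier_measure_def char_def integral_distr inner_axis')
  ultimately have "times_differentiable (2 * 4) (char ?Q)" by (simp add: eval_nat_numeral del: times_differentiable.simps)
  moreover have "finite_measure ?Q" by (intro P.finite_measure_distr) measurable
  ultimately have "integrable ?Q (\<lambda>x. x^(2 * 4))" by (intro even_moments_finite) auto
  then show ?thesis by (subst (asm) integrable_distr_eq) auto
qed

lemma P_moment:
  assumes "j \<le> 8"
  shows "integrable P (\<lambda>x. \<bar>x $ k\<bar>^j)"
proof (rule Bochner_Integration.integrable_bound[of _ "\<lambda>x. 1 + (x $ k)^8"])
  show "integrable P (\<lambda>x. 1 + (x $ k)^8)" using P_moment8 by simp
  have "\<bar>t\<bar>^j \<le> 1 + t^8" for t :: real
  proof (cases "\<bar>t\<bar> \<le> 1")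
    case True
    then have "\<bar>t\<bar>^j \<le> 1" by (simp add: power_le_one)
    then show ?thesis by (simp add: add_increasing2)
  next
    case False
    then have "\<bar>t\<bar>^j \<le> \<bar>t\<bar>^8" using assms by (intro power_increasing) auto
    then show ?thesis by simp
  qed
  then show "AE x in P. norm (\<bar>x $ k\<bar>^j) \<le> norm (1 + (x $ k)^8)"
    by (intro AE_I2) (auto intro: order_trans[OF _ abs_ge_self])
qed measurable

lemma char_moment_P_0: "char_moment P k 0 u = levy_char \<Sigma> \<nu> \<alpha> u"
  by (simp add: char_moment_def law[symmetric] fourier_measure_def)

lemma deriv_char_moment_P:
  "j \<le> 7 \<Longrightarrow> ((\<lambda>s. char_moment P k j (u + s *\<^sub>R axis k 1)) has_vector_derivative char_moment P k (Suc j) (u + s *\<^sub>R axis k 1)) (at s)"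
  by (rule has_vector_derivative_char_moment[OF sets_P]) (rule P_moment; simp)+

text \<open>The Leibniz rule applied to \<open>f' = psi1 f\<close>: each identity is the derivative
  of the one before, both sides being derivatives of the same function. The coefficients are
  binomial.\<close>

lemma char_moment_P_rec:
  shows "char_moment P k 1 u = psi1 k u * char_moment P k 0 u"
    and "char_moment P k 2 u = psi2 k u * char_moment P k 0 u + psi1 k u * char_moment P k 1 u"
    and "char_moment P k 3 u = char_moment \<nu> k 3 u * char_moment P k 0 u + 2 * psi2 k u * char_moment P k 1 u + psi1 k u * char_moment P k 2 u"
    and "char_moment P k 4 u = char_moment \<nu> k 4 u * char_moment P k 0 u + 3 * char_moment \<nu> k 3 u * char_moment P k 1 u + 3 * psi2 k u * char_moment P k 2 u + psi1 k u * char_moment P k 3 u"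
proof -
  let ?l = "\<lambda>u s. u + s *\<^sub>R axis k (1 :: real)"
  have P0: "((\<lambda>s. char_moment P k 0 (?l u s)) has_vector_derivative char_moment P k 1 (?l u s)) (at s)" for u s
    using deriv_char_moment_P[of 0 k u s] by simp
  have P1: "((\<lambda>s. char_moment P k 1 (?l u s)) has_vector_derivative char_moment P k 2 (?l u s)) (at s)" for u s
    using deriv_char_moment_P[of 1 k u s] by (simp add: numeral_2_eq_2)
  have P2: "((\<lambda>s. char_moment P k 2 (?l u s)) has_vector_derivative char_moment P k 3 (?l u s)) (at s)" for u s
    using deriv_char_moment_P[of 2 k u s] by (simp add: numeral_3_eq_3 numeral_2_eq_2)
  have P3: "((\<lambda>s. char_moment P k 3 (?l u s)) has_vector_derivative char_moment P k 4 (?l u s)) (at s)" for u s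
    using deriv_char_moment_P[of 3 k u s] by (simp add: eval_nat_numeral)
  have N3: "((\<lambda>s. char_moment \<nu> k 3 (?l u s)) has_vector_derivative char_moment \<nu> k 4 (?l u s)) (at s)" for u s
    using deriv_char_moment_nu[of 3 k u s] by (simp add: eval_nat_numeral)
  have at0: "a u = b u" if "\<And>s. (f has_vector_derivative a (?l u s)) (at s)" "\<And>s. (f has_vector_derivative b (?l u s)) (at s)"
    for f :: "real \<Rightarrow> complex" and a b and u :: "real^2"
    using vector_derivative_unique_at[OF that(1)[of 0] that(2)[of 0]] by simp
  show 1: "char_moment P k 1 u = psi1 k u * char_moment P k 0 u" for u
    by (rule at0[OF P0]) (use deriv_levy_char in \<open>simp add: char_moment_P_0\<close>)
  show 2: "char_moment P k 2 u = psi2 k u * char_moment P k 0 u + psi1 k u * char_moment P k 1 u" for u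
    by (rule at0[OF P1], subst 1)
      (use has_vector_derivative_mult[OF deriv_psi1[of k u] P0[of u]] in \<open>simp add: add.commute\<close>)
  show 3: "char_moment P k 3 u = char_moment \<nu> k 3 u * char_moment P k 0 u + 2 * psi2 k u * char_moment P k 1 u + psi1 k u * char_moment P k 2 u" for u
    by (rule at0[OF P2], subst 2)
      (use has_vector_derivative_add[OF has_vector_derivative_mult[OF deriv_psi2[of k u] P0[of u]] has_vector_derivative_mult[OF deriv_psi1[of k u] P1[of u]]]
        in \<open>simp add: algebra_simps\<close>)
  show "char_moment P k 4 u = char_moment \<nu> k 4 u * char_moment P k 0 u + 3 * char_moment \<nu> k 3 u * char_moment P k 1 u + 3 * psi2 k u * char_moment P k 2 u + psi1 k u * char_moment P k 3 u" for u
    by (rule at0[OF P3], subst 3)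
      (use has_vector_derivative_add[OF has_vector_derivative_add[OF has_vector_derivative_mult[OF N3[of u] P0[of u]]
          has_vector_derivative_mult[OF has_vector_derivative_mult_right[OF deriv_psi2[of k u], of 2] P1[of u]]] has_vector_derivative_mult[OF deriv_psi1[of k u] P2[of u]]]
        in \<open>simp add: algebra_simps\<close>)
qed

text \<open>Division by the characteristic function turns the recursion into polynomials in the
  derivatives of the exponent, and the cumulant polynomial inverts them at order four. Drift and
  Gaussian part disappear because they are of degree at most two in the exponent.\<close>

lemma cumulant4_P:
  "cumulant4 (char_moment P k 1 u / char_moment P k 0 u) (char_moment P k 2 u / char_moment P k 0 u) (char_moment P k 3 u / char_moment P k 0 u) (char_moment P k 4 u / char_moment P k 0 u)
    = char_moment \<nu> k 4 u"
proof -
  have n0: "char_moment P k 0 u \<noteq> 0" by (simp add: char_moment_P_0 levy_char_psi0)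
  have 1: "char_moment P k 1 u / char_moment P k 0 u = psi1 k u" unfolding char_moment_P_rec(1)[of k u] using n0 by simp
  have 2: "char_moment P k 2 u / char_moment P k 0 u = psi2 k u + psi1 k u * psi1 k u"
  proof -
    have "char_moment P k 2 u / char_moment P k 0 u = psi2 k u + psi1 k u * (char_moment P k 1 u / char_moment P k 0 u)"
      unfolding char_moment_P_rec(2)[of k u] using n0 by (simp add: add_divide_distrib)
    then show ?thesis unfolding 1 .
  qed
  have 3: "char_moment P k 3 u / char_moment P k 0 u = char_moment \<nu> k 3 u + 2 * psi2 k u * psi1 k u + psi1 k u * (psi2 k u + psi1 k u * psi1 k u)"
  proof -
    have "char_moment P k 3 u / char_moment P k 0 u = char_moment \<nu> k 3 u + 2 * psi2 k u * (char_moment P k 1 u / char_moment P k 0 u) + psi1 k u * (char_moment P k 2 u / char_moment P k 0 u)"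
      unfolding char_moment_P_rec(3)[of k u] using n0 by (simp add: add_divide_distrib)
    then show ?thesis unfolding 1 2 .
  qed
  have 4: "char_moment P k 4 u / char_moment P k 0 u = char_moment \<nu> k 4 u + 3 * char_moment \<nu> k 3 u * psi1 k u + 3 * psi2 k u * (psi2 k u + psi1 k u * psi1 k u)
     + psi1 k u * (char_moment \<nu> k 3 u + 2 * psi2 k u * psi1 k u + psi1 k u * (psi2 k u + psi1 k u * psi1 k u))"
  proof -
    have "char_moment P k 4 u / char_moment P k 0 u = char_moment \<nu> k 4 u + 3 * char_moment \<nu> k 3 u * (char_moment P k 1 u / char_moment P k 0 u)
        + 3 * psi2 k u * (char_moment P k 2 u / char_moment P k 0 u) + psi1 k u * (char_moment P k 3 u / char_moment P k 0 u)"
      unfolding char_moment_P_rec(4)[of k u] using n0 by (simp add: add_divide_distrib)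
    then show ?thesis unfolding 1 2 3 .
  qed
  show ?thesis unfolding 1 2 3 4 cumulant4_def
    by (simp add: algebra_simps power2_eq_square power4_eq_xxxx)
qed

text \<open>The modulus is \<open>exp (Re (psi0 u))\<close>. The operator norm of
  \<open>\<Sigma>\<close> bounds the quadratic form, and the second moment of \<open>\<nu>\<close>
  bounds the compensated integral, both by a multiple of \<open>(norm u)^2\<close>.\<close>

lemma levy_char_lower_bound: "\<exists>C\<ge>0. \<forall>u. exp (- (C * (norm u)\<^sup>2)) \<le> cmod (levy_char \<Sigma> \<nu> \<alpha> u)"
proof (intro exI conjI allI)
  let ?B = "onorm ((*v) \<Sigma>)" and ?M = "\<integral>x. norm x ^ 2 \<partial>\<nu>"
  have bl: "bounded_linear ((*v) \<Sigma>)" by (simp add: linear_linear[symmetric] matrix_vector_mul_linear)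
  have B: "0 \<le> ?B" by (rule onorm_pos_le[OF bl])
  show "0 \<le> (?B + ?M) / 2" using B by (intro divide_nonneg_nonneg add_nonneg_nonneg Bochner_Integration.integral_nonneg) auto
  fix u
  let ?I = "\<integral>x. iexp (u \<bullet> x) - 1 - \<i> * complex_of_real (u \<bullet> x) \<partial>\<nu>"
  have "cmod ?I \<le> (\<integral>x. (norm u)\<^sup>2 / 2 * norm x ^ 2 \<partial>\<nu>)"
    by (rule Bochner_Integration.integral_norm_bound_integral[OF integrable_integrand0 _ integrand0_bound])
      (use nu_moment[of 2] in simp)
  then have I: "cmod ?I \<le> (norm u)\<^sup>2 / 2 * ?M" by simp
  have "\<bar>u \<bullet> (\<Sigma> *v u)\<bar> \<le> norm u * norm (\<Sigma> *v u)" by (rule Cauchy_Schwarz_ineq2)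
  also have "\<dots> \<le> norm u * (?B * norm u)" by (intro mult_left_mono onorm[OF bl]) auto
  finally have q: "u \<bullet> (\<Sigma> *v u) \<le> ?B * (norm u)\<^sup>2" by (simp add: power2_eq_square mult_ac)
  have "- ((?B + ?M) / 2 * (norm u)\<^sup>2) \<le> Re (psi0 u)"
    using q I abs_Re_le_cmod[of ?I] by (simp add: psi0_def field_simps)
  then show "exp (- ((?B + ?M) / 2 * (norm u)\<^sup>2)) \<le> cmod (levy_char \<Sigma> \<nu> \<alpha> u)"
    by (simp add: levy_char_psi0)
qed

end

subsection \<open>Empirical moments\<close>

definition incr :: "(nat \<Rightarrow> real^2) \<Rightarrow> nat \<Rightarrow> real^2" where
  "incr x t = x t - x (t - 1)"

text \<open>The \<open>char_moment\<close> of the empirical law of the increments.\<close>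

definition emp_moment :: "(nat \<Rightarrow> real^2) \<Rightarrow> nat \<Rightarrow> 2 \<Rightarrow> nat \<Rightarrow> real^2 \<Rightarrow> complex" where
  "emp_moment x n k j u = (\<Sum>t=1..n. (\<i> * complex_of_real (incr x t $ k))^j * iexp (u \<bullet> incr x t)) / of_nat n"

lemma emp_moment_0: "emp_moment x n k 0 = emp_char x n"
  by (simp add: fun_eq_iff emp_moment_def emp_char_def incr_def)

lemma partial_emp_moment: "partial k (emp_moment x n k j) = emp_moment x n k (Suc j)"
proof
  fix u
  have "((\<lambda>s. (\<Sum>t=1..n. (\<i> * complex_of_real (incr x t $ k))^j * iexp ((u + s *\<^sub>R axis k 1) \<bullet> incr x t)) * inverse (of_nat n)) has_vector_derivative
    (\<Sum>t=1..n. (\<i> * complex_of_real (incr x t $ k))^j * (\<i> * (incr x t $ k) * iexp ((u + 0 *\<^sub>R axis k 1) \<bullet> incr x t))) * inverse (of_nat n)) (at 0)"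
    by (rule has_vector_derivative_mult_left, rule has_vector_derivative_sum, rule has_vector_derivative_iexp_line)
  from vector_derivative_at[OF this] show "partial k (emp_moment x n k j) u = emp_moment x n k (Suc j) u"
    by (simp add: partial_def emp_moment_def divide_inverse mult_ac)
qed

lemma partial_emp_char: "(partial k ^^ j) (emp_char x n) = emp_moment x n k j"
  by (induction j) (simp_all add: emp_moment_0[symmetric, of x n k] partial_emp_moment)

text \<open>At a zero of the empirical characteristic function both sides are 0 by the convention
  \<open>x / 0 = 0\<close>, so the identity can be used for measurability at all
  frequencies.\<close>

lemma psi4_cumulant4:
  "psi4 k x n u = cumulant4 (emp_moment x n k 1 u / emp_moment x n k 0 u) (emp_moment x n k 2 u / emp_moment x n k 0 u)
    (emp_moment x n k 3 u / emp_moment x n k 0 u) (emp_moment x n k 4 u / emp_moment x n k 0 u)"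
  unfolding psi4_def Let_def cumulant4_def partial_emp_char emp_moment_0
  by (simp add: power_divide power2_eq_square power3_eq_cube)

text \<open>Each monomial is telescoped factor by factor. Since \<open>d\<close> enters linearly,
  only \<open>a\<close>, \<open>b\<close>, \<open>c\<close> have to be bounded. The largest
  coefficient, that of \<open>a - a'\<close>, is \<open>4 B + 24 B^2 + 24 B^3 \<le> 52 B^3\<close>;
  60 is a round majorant.\<close>

lemma cumulant4_diff_bound:
  fixes a b c d a' b' c' d' :: complex
  assumes B: "1 \<le> B" and le: "cmod a \<le> B" "cmod b \<le> B" "cmod c \<le> B" "cmod a' \<le> B" "cmod b' \<le> B" "cmod c' \<le> B"
  shows "cmod (cumulant4 a b c d - cumulant4 a' b' c' d') \<le>
    60 * B^3 * (cmod (a - a') + cmod (b - b') + cmod (c - c') + cmod (d - d'))"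
proof -
  let ?da = "cmod (a - a')" and ?db = "cmod (b - b')" and ?dc = "cmod (c - c')" and ?dd = "cmod (d - d')"
  have prod: "cmod (p * q - p' * q') \<le> Q * cmod (p - p') + P' * cmod (q - q')" if "cmod q \<le> Q" "cmod p' \<le> P'" for p q p' q' Q P'
  proof -
    have "p * q - p' * q' = (p - p') * q + p' * (q - q')" by (simp add: algebra_simps)
    then have "cmod (p * q - p' * q') \<le> cmod (p - p') * cmod q + cmod p' * cmod (q - q')"
      by (metis norm_mult norm_triangle_ineq)
    also have "\<dots> \<le> cmod (p - p') * Q + P' * cmod (q - q')"
      using that by (intro add_mono mult_left_mono mult_right_mono) auto
    finally show ?thesis by (simp add: mult.commute)
  qed
  have ac: "cmod (a * c - a' * c') \<le> B * ?da + B * ?dc" by (rule prod) (use le in auto)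
  have bb: "cmod (b * b - b' * b') \<le> B * ?db + B * ?db" by (rule prod) (use le in auto)
  have aa: "cmod (a * a - a' * a') \<le> B * ?da + B * ?da" by (rule prod) (use le in auto)
  have n2: "cmod (a' * a') \<le> B * B" "cmod (a * a) \<le> B * B" using le B by (auto simp: norm_mult intro!: mult_mono)
  have aab: "cmod ((a * a) * b - (a' * a') * b') \<le> B * (B * ?da + B * ?da) + (B * B) * ?db"
    using prod[of b B "a' * a'" "B * B" "a * a" b'] le n2 mult_left_mono[OF aa, of B] B by linarith
  have a4: "cmod ((a * a) * (a * a) - (a' * a') * (a' * a')) \<le> (B * B) * (B * ?da + B * ?da) + (B * B) * (B * ?da + B * ?da)"
  proof -
    have "(B * B) * cmod (a * a - a' * a') \<le> (B * B) * (B * ?da + B * ?da)"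
      by (rule mult_left_mono[OF aa]) (use B in simp)
    with prod[OF n2(2) n2(1), of "a * a" "a' * a'"] show ?thesis by linarith
  qed
  have "cumulant4 a b c d - cumulant4 a' b' c' d' = (d - d') - 4 * (a * c - a' * c') - 3 * (b * b - b' * b')
    + 12 * ((a * a) * b - (a' * a') * b') - 6 * ((a * a) * (a * a) - (a' * a') * (a' * a'))"
    by (simp add: cumulant4_def power2_eq_square power4_eq_xxxx algebra_simps)
  also have "cmod \<dots> \<le> ?dd + 4 * cmod (a * c - a' * c') + 3 * cmod (b * b - b' * b') + 12 * cmod ((a * a) * b - (a' * a') * b')
    + 6 * cmod ((a * a) * (a * a) - (a' * a') * (a' * a'))"
  proof -
    have "cmod (p - q - r + s - t) \<le> cmod p + cmod q + cmod r + cmod s + cmod t" for p q r s t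
      using norm_triangle_ineq4[of "p - q - r + s" t] norm_triangle_ineq[of "p - q - r" s]
        norm_triangle_ineq4[of "p - q" r] norm_triangle_ineq4[of p q] by linarith
    note this[of "d - d'" "4 * (a * c - a' * c')" "3 * (b * b - b' * b')" "12 * ((a * a) * b - (a' * a') * b')"
      "6 * ((a * a) * (a * a) - (a' * a') * (a' * a'))"]
    moreover have "cmod (4 * z) = 4 * cmod z" "cmod (3 * z) = 3 * cmod z" "cmod (12 * z) = 12 * cmod z" "cmod (6 * z) = 6 * cmod z" for z
      by (simp_all only: norm_mult norm_numeral)
    ultimately show ?thesis by (simp only:)
  qed
  also have "\<dots> \<le> ?dd + 4 * (B * ?da + B * ?dc) + 3 * (B * ?db + B * ?db) + 12 * (B * (B * ?da + B * ?da) + (B * B) * ?db)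
    + 6 * ((B * B) * (B * ?da + B * ?da) + (B * B) * (B * ?da + B * ?da))"
    by (intro add_mono mult_left_mono order_refl ac bb aab a4) auto
  also have "\<dots> = ?dd + (4 * B) * ?dc + (6 * B + 12 * B\<^sup>2) * ?db + (4 * B + 24 * B\<^sup>2 + 24 * B^3) * ?da"
    by (simp add: algebra_simps power2_eq_square power3_eq_cube)
  also have "\<dots> \<le> (60 * B^3) * ?dd + (60 * B^3) * ?dc + (60 * B^3) * ?db + (60 * B^3) * ?da"
  proof -
    have "1 \<le> B^3" "B \<le> B^3" "B\<^sup>2 \<le> B^3"
      using B power_increasing[of 0 3 B] power_increasing[of 1 3 B] power_increasing[of 2 3 B] by simp_all
    then have "1 \<le> 60 * B^3" "4 * B \<le> 60 * B^3" "6 * B + 12 * B\<^sup>2 \<le> 60 * B^3" "4 * B + 24 * B\<^sup>2 + 24 * B^3 \<le> 60 * B^3"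
      by linarith+
    note * = this[THEN mult_right_mono]
    show ?thesis
      using add_mono[OF add_mono[OF add_mono[OF *(1)[of ?dd] *(2)[of ?dc]] *(3)[of ?db]] *(4)[of ?da]]
      by (simp only: mult_1 norm_ge_zero)
  qed
  finally show ?thesis by (simp add: algebra_simps)
qed

text \<open>From \<open>a' / f' - a / f = (a' - a) / f' + a (f - f') / (f f')\<close>. The
  hypothesis on \<open>f'\<close> gives \<open>1 / cmod f' \<le> 2 / cmod f\<close>, and
  \<open>cmod f \<le> 1 \<le> A\<close> brings both terms under one factor.\<close>

lemma ratio_diff_bound:
  fixes a a' f f' :: complex
  assumes A: "1 \<le> A" "cmod a \<le> A" and f: "f \<noteq> 0" "cmod f \<le> 1" and f': "cmod f / 2 < cmod f'"
  shows "cmod (a' / f' - a / f) \<le> 2 * A / (cmod f)\<^sup>2 * (cmod (a' - a) + cmod (f' - f))"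
proof -
  have nz: "f' \<noteq> 0" using f' by auto
  have f'i: "1 / cmod f' \<le> 2 / cmod f" 
  proof -
    have "1 / cmod f' \<le> 1 / (cmod f / 2)" using f f' nz by (intro divide_left_mono) auto
    then show ?thesis by simp
  qed
  have "a' / f' - a / f = (a' - a) * (1 / f') + (a * (f - f')) * (1 / f) * (1 / f')"
  proof -
    define i i' where "i = 1 / f" and "i' = 1 / f'"
    have ii: "f * i = 1" "f' * i' = 1" using nz f by (simp_all add: i_def i'_def)
    have "(a' - a) * i' + (a * (f - f')) * i * i' = a' * i' - a * i' + (a * i') * (f * i) - (a * i) * (f' * i')"
      by (simp add: algebra_simps)
    also have "\<dots> = a' * i' - a * i" unfolding ii by simp
    finally show ?thesis by (simp add: i_def i'_def)
  qed
  then have "cmod (a' / f' - a / f) \<le> cmod (a' - a) * (1 / cmod f') + (cmod a * cmod (f - f')) * (1 / cmod f) * (1 / cmod f')"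
    using norm_triangle_ineq[of "(a' - a) * (1 / f')" "(a * (f - f')) * (1 / f) * (1 / f')"]
    by (simp only: norm_mult norm_divide norm_one)
  also have "\<dots> \<le> cmod (a' - a) * (2 / cmod f) + (A * cmod (f - f')) * (1 / cmod f) * (2 / cmod f)"
    using A f'i by (intro add_mono mult_mono) auto
  also have "\<dots> \<le> cmod (a' - a) * (2 * A / (cmod f)\<^sup>2) + cmod (f' - f) * (2 * A / (cmod f)\<^sup>2)"
  proof (intro add_mono mult_left_mono)
    have "2 / cmod f = 2 * 1 * cmod f / (cmod f)\<^sup>2" using f by (simp add: power2_eq_square)
    also have "\<dots> \<le> 2 * A * 1 / (cmod f)\<^sup>2" using A f by (intro divide_right_mono mult_mono) auto
    finally show "2 / cmod f \<le> 2 * A / (cmod f)\<^sup>2" by simp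
    show "A * cmod (f - f') * (1 / cmod f) * (2 / cmod f) \<le> cmod (f' - f) * (2 * A / (cmod f)\<^sup>2)"
      by (simp add: power2_eq_square norm_minus_commute mult_ac)
  qed simp
  finally show ?thesis by (simp only: distrib_left distrib_right mult.commute)
qed

text \<open>The function \<open>1 + x_1^4 + x_2^4\<close> dominates all powers of a coordinate up to
  order 4 and half of the norm. One average therefore bounds every empirical derivative in use and
  the Lipschitz constant of the empirical characteristic function.\<close>

definition emp_quartic :: "(nat \<Rightarrow> real^2) \<Rightarrow> nat \<Rightarrow> real" where
  "emp_quartic x n = (\<Sum>t=1..n. 1 + ((incr x t $ 1)^4 + (incr x t $ 2)^4)) / real n"

definition quartic_moment :: "(real^2) measure \<Rightarrow> real" where
  "quartic_moment P = (\<integral>x. 1 + ((x $ 1)^4 + (x $ 2)^4) \<partial>P)"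

definition sq_deviation :: "(real^2) measure \<Rightarrow> (nat \<Rightarrow> real^2) \<Rightarrow> nat \<Rightarrow> real^2 \<Rightarrow> real" where
  "sq_deviation P x n u = (\<Sum>k\<in>UNIV. \<Sum>j\<le>4. (cmod (emp_moment x n k j u - char_moment P k j u))\<^sup>2)"

lemma power_le_quartic: "j \<le> 4 \<Longrightarrow> \<bar>x $ k\<bar>^j \<le> 1 + ((x $ 1)^4 + ((x :: real^2) $ 2)^4)"
proof -
  assume j: "j \<le> 4"
  have "\<bar>t\<bar>^j \<le> 1 + t^4" for t :: real
  proof (cases "\<bar>t\<bar> \<le> 1")
    case True
    then have "\<bar>t\<bar>^j \<le> 1" by (simp add: power_le_one)
    then show ?thesis by (simp add: add_increasing2)
  next
    case False
    then have "\<bar>t\<bar>^j \<le> \<bar>t\<bar>^4" using j by (intro power_increasing) auto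
    then show ?thesis by simp
  qed
  note * = this[of "x $ k"]
  show ?thesis
  proof -
    have "1 + (x $ k)^4 \<le> 1 + ((x $ 1)^4 + (x $ 2)^4)"
      using exhaust_2[of k] by auto
    with * show ?thesis by (rule order_trans)
  qed
qed

lemma norm_le_quartic: "norm x \<le> 2 * (1 + ((x $ 1)^4 + ((x :: real^2) $ 2)^4))"
  using norm_le_l1_cart[of x] power_le_quartic[of 1 x 1] power_le_quartic[of 1 x 2] by (simp add: sum_2)

lemma emp_moment_le_emp_quartic:
  assumes "j \<le> 4"
  shows "cmod (emp_moment x n k j u) \<le> emp_quartic x n"
proof -
  have "cmod (emp_moment x n k j u) = cmod (\<Sum>t=1..n. (\<i> * complex_of_real (incr x t $ k))^j * iexp (u \<bullet> incr x t)) / real n"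
    by (simp add: emp_moment_def norm_divide)
  also have "\<dots> \<le> (\<Sum>t=1..n. \<bar>incr x t $ k\<bar>^j) / real n"
    by (intro divide_right_mono order_trans[OF norm_sum]) (auto simp: norm_mult norm_power)
  also have "\<dots> \<le> emp_quartic x n"
    unfolding emp_quartic_def by (intro divide_right_mono sum_mono power_le_quartic assms) auto
  finally show ?thesis .
qed

lemma iexp_inner_lipschitz: "cmod (iexp (u \<bullet> x) - iexp (v \<bullet> x)) \<le> norm x * norm (u - v)"
proof -
  have "iexp (u \<bullet> x) - iexp (v \<bullet> x) = iexp (v \<bullet> x) * (iexp ((u - v) \<bullet> x) - 1)"
    by (simp add: right_diff_distrib inner_diff_left exp_diff)
  then have "cmod (iexp (u \<bullet> x) - iexp (v \<bullet> x)) = cmod (iexp ((u - v) \<bullet> x) - 1)"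
    by (simp add: norm_mult)
  also have "\<dots> \<le> \<bar>(u - v) \<bullet> x\<bar>" using iexp_approx1[of "(u - v) \<bullet> x" 0] by simp
  also have "\<dots> \<le> norm (u - v) * norm x" by (rule Cauchy_Schwarz_ineq2)
  finally show ?thesis by (simp add: mult.commute)
qed

lemma emp_char_lipschitz: "cmod (emp_char x n u - emp_char x n v) \<le> 2 * emp_quartic x n * norm (u - v)"
proof -
  have "emp_char x n u - emp_char x n v = (\<Sum>t=1..n. iexp (u \<bullet> incr x t) - iexp (v \<bullet> incr x t)) / of_nat n"
    by (simp add: emp_char_def incr_def sum_subtractf diff_divide_distrib)
  then have "cmod (emp_char x n u - emp_char x n v) = cmod (\<Sum>t=1..n. iexp (u \<bullet> incr x t) - iexp (v \<bullet> incr x t)) / real n"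
    by (simp add: norm_divide)
  also have "\<dots> \<le> (\<Sum>t=1..n. (2 * (1 + ((incr x t $ 1)^4 + (incr x t $ 2)^4))) * norm (u - v)) / real n"
  proof (intro divide_right_mono order_trans[OF norm_sum] sum_mono)
    fix t
    show "cmod (iexp (u \<bullet> incr x t) - iexp (v \<bullet> incr x t)) \<le> (2 * (1 + ((incr x t $ 1)^4 + (incr x t $ 2)^4))) * norm (u - v)"
      by (rule order_trans[OF iexp_inner_lipschitz]) (intro mult_right_mono norm_le_quartic, simp)
  qed simp
  also have "\<dots> = 2 * emp_quartic x n * norm (u - v)"
    unfolding emp_quartic_def sum_distrib_right[symmetric] sum_distrib_left[symmetric] by simp
  finally show ?thesis .
qed

lemma measurable_emp_moment [measurable]: "emp_moment x n k j \<in> borel_measurable borel"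
  unfolding emp_moment_def[abs_def] by measurable

lemma continuous_emp_moment: "continuous_on UNIV (emp_moment x n k j)"
  unfolding emp_moment_def[abs_def] divide_inverse by (intro continuous_intros)

context levy_law
begin

interpretation P: prob_space P by (rule prob_P)

lemma measurable_char_moment_P [measurable]: "char_moment P k j \<in> borel_measurable borel"
  unfolding char_moment_def[abs_def] by measurable

lemma measurable_sq_deviation [measurable]: "sq_deviation P x n \<in> borel_measurable borel"
  unfolding sq_deviation_def[abs_def] by measurable

lemma integrable_quartic_moment: "integrable P (\<lambda>x. 1 + ((x $ 1)^4 + (x $ 2)^4))"
  using P_moment[of 4 1] P_moment[of 4 2] by simp

lemma char_moment_le_quartic_moment: "j \<le> 4 \<Longrightarrow> cmod (char_moment P k j u) \<le> quartic_moment P"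
  unfolding quartic_moment_def
  by (rule order_trans[OF char_moment_bound integral_mono[OF P_moment integrable_quartic_moment power_le_quartic]]) auto

lemma levy_char_lipschitz: "cmod (levy_char \<Sigma> \<nu> \<alpha> u - levy_char \<Sigma> \<nu> \<alpha> v) \<le> 2 * quartic_moment P * norm (u - v)"
proof -
  have i: "integrable P (\<lambda>x. iexp (u \<bullet> x))" for u
    by (rule P.integrable_const_bound[where B = 1]) auto
  have "levy_char \<Sigma> \<nu> \<alpha> u - levy_char \<Sigma> \<nu> \<alpha> v = (\<integral>x. iexp (u \<bullet> x) - iexp (v \<bullet> x) \<partial>P)"
    by (simp add: law[symmetric] fourier_measure_def i)
  also have "cmod \<dots> \<le> (\<integral>x. 2 * norm (u - v) * (1 + ((x $ 1)^4 + (x $ 2)^4)) \<partial>P)"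
  proof (rule Bochner_Integration.integral_norm_bound_integral)
    show "integrable P (\<lambda>x. iexp (u \<bullet> x) - iexp (v \<bullet> x))" using i by simp
    show "integrable P (\<lambda>x. 2 * norm (u - v) * (1 + ((x $ 1)^4 + (x $ 2)^4)))"
      by (rule integrable_mult_right[OF integrable_quartic_moment])
    fix x :: "real^2"
    have "norm x * norm (u - v) \<le> (2 * (1 + ((x $ 1)^4 + (x $ 2)^4))) * norm (u - v)"
      by (intro mult_right_mono norm_le_quartic) simp
    also have "\<dots> = 2 * norm (u - v) * (1 + ((x $ 1)^4 + (x $ 2)^4))"
      by (simp only: mult_ac)
    finally show "cmod (iexp (u \<bullet> x) - iexp (v \<bullet> x)) \<le> 2 * norm (u - v) * (1 + ((x $ 1)^4 + (x $ 2)^4))"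
      by (rule order_trans[OF iexp_inner_lipschitz])
  qed
  also have "\<dots> = 2 * quartic_moment P * norm (u - v)"
    unfolding integral_mult_right_zero quartic_moment_def by simp
  finally show ?thesis .
qed

lemma levy_char_le_1: "cmod (levy_char \<Sigma> \<nu> \<alpha> u) \<le> 1"
proof -
  have "cmod (levy_char \<Sigma> \<nu> \<alpha> u) \<le> (\<integral>x. cmod (iexp (u \<bullet> x)) \<partial>P)"
    unfolding law[symmetric] fourier_measure_def by (rule integral_norm_bound)
  then show ?thesis by (simp add: P.prob_space)
qed

text \<open>With \<open>B = 2 A / cmod f\<close> for the normalised derivatives,
  \<open>cumulant4_diff_bound\<close> contributes \<open>60 B^3\<close> and
  \<open>ratio_diff_bound\<close> contributes \<open>2 A / (cmod f)^2\<close>; the deviation of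
  order 0 occurs four times. This gives \<open>60 * 8 * 2 * 4 = 3840\<close> and the fifth power of
  the modulus.\<close>

lemma psi4_error:
  assumes A: "1 \<le> A" "emp_quartic x n \<le> A" "quartic_moment P \<le> A"
    and good: "cmod (levy_char \<Sigma> \<nu> \<alpha> u) / 2 < cmod (emp_char x n u)"
  shows "cmod (psi4 k x n u - char_moment \<nu> k 4 u) \<le>
    3840 * A^4 / (cmod (levy_char \<Sigma> \<nu> \<alpha> u))^5 * (\<Sum>j\<le>4. cmod (emp_moment x n k j u - char_moment P k j u))"
proof -
  let ?f = "char_moment P k 0 u" and ?g = "emp_moment x n k 0 u"
  let ?d = "\<lambda>j. cmod (emp_moment x n k j u - char_moment P k j u)"
  let ?r = "\<lambda>j. emp_moment x n k j u / ?g" and ?s = "\<lambda>j. char_moment P k j u / ?f"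
  have f: "?f \<noteq> 0" "cmod ?f \<le> 1" and fg: "cmod ?f / 2 < cmod ?g"
    using good levy_char_le_1[of u] by (auto simp: char_moment_P_0 emp_moment_0 levy_char_psi0)
  have f0: "0 < cmod ?f" using f by simp
  have le: "cmod (char_moment P k j u) \<le> A" "cmod (emp_moment x n k j u) \<le> A" if "j \<le> 4" for j
    using order_trans[OF char_moment_le_quartic_moment[OF that] A(3)] order_trans[OF emp_moment_le_emp_quartic[OF that] A(2)] by auto
  let ?B = "2 * A / cmod ?f"
  have B1: "1 \<le> ?B" using f A f0 by (simp add: field_simps)
  have s: "cmod (?s j) \<le> ?B" if "j \<le> 4" for j
  proof -
    have "cmod (?s j) \<le> A / cmod ?f" using le(1)[OF that] f0 by (simp add: norm_divide divide_right_mono)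
    also have "\<dots> \<le> ?B" using A f0 by (intro divide_right_mono) auto
    finally show ?thesis .
  qed
  have r: "cmod (?r j) \<le> ?B" if "j \<le> 4" for j
  proof -
    have "cmod (?r j) \<le> A / (cmod ?f / 2)"
      unfolding norm_divide using le(2)[OF that] fg f0 A by (intro frac_le) auto
    then show ?thesis by (simp add: mult.commute)
  qed
  have rs: "cmod (?r j - ?s j) \<le> 2 * A / (cmod ?f)\<^sup>2 * (?d j + ?d 0)" if "j \<le> 4" for j
    by (rule ratio_diff_bound) (use A le[OF that] f fg in auto)
  have "cmod (psi4 k x n u - char_moment \<nu> k 4 u) \<le> 60 * ?B^3 * (cmod (?r 1 - ?s 1) + cmod (?r 2 - ?s 2) + cmod (?r 3 - ?s 3) + cmod (?r 4 - ?s 4))"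
    unfolding psi4_cumulant4 cumulant4_P[of k u, symmetric]
    by (rule cumulant4_diff_bound[OF B1]) (use r s in auto)
  also have "\<dots> \<le> 60 * ?B^3 * (2 * A / (cmod ?f)\<^sup>2 * (?d 1 + ?d 0) + 2 * A / (cmod ?f)\<^sup>2 * (?d 2 + ?d 0)
      + 2 * A / (cmod ?f)\<^sup>2 * (?d 3 + ?d 0) + 2 * A / (cmod ?f)\<^sup>2 * (?d 4 + ?d 0))"
    using A by (intro mult_left_mono add_mono rs) auto
  also have "\<dots> = (60 * ?B^3 * (2 * A / (cmod ?f)\<^sup>2)) * ((?d 1 + ?d 0) + (?d 2 + ?d 0) + (?d 3 + ?d 0) + (?d 4 + ?d 0))"
  proof -
    have "m * (c * x + c * y + c * z + c * w) = (m * c) * (x + y + z + w)" for m c x y z w :: real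
      by (simp add: algebra_simps)
    then show ?thesis .
  qed
  also have "\<dots> \<le> (60 * ?B^3 * (2 * A / (cmod ?f)\<^sup>2)) * (4 * (\<Sum>j\<le>4. ?d j))"
    using A by (intro mult_left_mono) (auto simp: eval_nat_numeral)
  also have "60 * ?B^3 * (2 * A / (cmod ?f)\<^sup>2) = 960 * A^4 / (cmod ?f)^5"
    by (simp add: power_divide power_mult_distrib eval_nat_numeral)
  finally show ?thesis by (simp add: char_moment_P_0)
qed

end

subsection \<open>Stochastic error and the good event\<close>

lemma emeasure_rectangle:
  assumes "a \<le> b" "c \<le> d"
  shows "emeasure lborel {v :: real^2. a \<le> v $ 1 \<and> v $ 1 \<le> b \<and> c \<le> v $ 2 \<and> v $ 2 \<le> d} = ennreal ((b - a) * (d - c))"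
proof -
  have m: "{v :: real^2. a \<le> v $ 1 \<and> v $ 1 \<le> b \<and> c \<le> v $ 2 \<and> v $ 2 \<le> d} \<in> sets borel"
  proof -
    have "{v \<in> space (borel :: (real^2) measure). a \<le> v $ 1 \<and> v $ 1 \<le> b \<and> c \<le> v $ 2 \<and> v $ 2 \<le> d} \<in> sets borel" by measurable
    then show ?thesis by simp
  qed
  let ?S = "{v :: real^2. a \<le> v $ 1 \<and> v $ 1 \<le> b \<and> c \<le> v $ 2 \<and> v $ 2 \<le> d}"
  have "emeasure lborel ?S = (\<integral>\<^sup>+v. indicator ?S v \<partial>lborel)" using m by simp
  also have "\<dots> = (\<integral>\<^sup>+v. indicator {a..b} (v $ 1) * indicator {c..d} (v $ 2) \<partial>(lborel :: (real^2) measure))"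
    by (intro nn_integral_cong) (auto split: split_indicator)
  also have "\<dots> = ennreal ((b - a) * (d - c))"
    using assms by (subst nn_integral_real2_mult) (auto simp: ennreal_mult)
  finally show ?thesis .
qed

lemma square_measurable [measurable]: "square r \<in> sets borel"
proof -
  have "{u \<in> space (borel :: (real^2) measure). \<bar>u $ 1\<bar> \<le> r \<and> \<bar>u $ 2\<bar> \<le> r} \<in> sets borel" by measurable
  then show ?thesis by (simp add: square_def)
qed

lemma emeasure_square:
  assumes "0 \<le> r"
  shows "emeasure lborel (square r) = ennreal (4 * r\<^sup>2)"
proof -
  have "square r = {v. - r \<le> v $ 1 \<and> v $ 1 \<le> r \<and> - r \<le> v $ 2 \<and> v $ 2 \<le> r}"
    by (auto simp: square_def)
  then show ?thesis using emeasure_rectangle[of "- r" r "- r" r] assms by (simp add: power2_eq_square)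
qed

lemma square_norm_sq: "u \<in> square r \<Longrightarrow> (norm u)\<^sup>2 \<le> 2 * r\<^sup>2"
proof -
  assume "u \<in> square r"
  then have "\<bar>u $ 1\<bar> \<le> \<bar>r\<bar>" "\<bar>u $ 2\<bar> \<le> \<bar>r\<bar>" by (auto simp: square_def)
  then have "(u $ 1)\<^sup>2 \<le> r\<^sup>2" "(u $ 2)\<^sup>2 \<le> r\<^sup>2" by (simp_all only: abs_le_square_iff)
  then show ?thesis by (simp add: norm_real2_sq)
qed

lemma compact_square: "compact (square r)"
proof -
  have "square r \<subseteq> cball 0 (2 * \<bar>r\<bar>)"
  proof
    fix u assume u: "u \<in> square r"
    then have "norm u \<le> \<bar>u $ 1\<bar> + \<bar>u $ 2\<bar>" using norm_le_l1_cart[of u] by (simp add: sum_2)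
    with u show "u \<in> cball 0 (2 * \<bar>r\<bar>)" by (auto simp: square_def)
  qed
  then have "bounded (square r)" using bounded_cball bounded_subset by blast
  moreover have "closed (square r)"
    unfolding square_def by (intro closed_Collect_conj closed_Collect_le continuous_intros)
  ultimately show ?thesis by (simp add: compact_eq_bounded_closed)
qed

text \<open>The square is one unit larger on each side than that of the good event, to leave room
  for a small square around a point on its boundary. Being an integral and not a supremum, it lets
  the expectation act at each frequency separately.\<close>

definition total_deviation :: "(real^2) measure \<Rightarrow> real \<Rightarrow> (nat \<Rightarrow> real^2) \<Rightarrow> nat \<Rightarrow> ennreal" where
  "total_deviation P h x n = (\<integral>\<^sup>+u. ennreal (sq_deviation P x n u) * indicator (square (1 / h + 1)) u \<partial>lborel)"

lemma sq_deviation_nonneg: "0 \<le> sq_deviation P x n u" by (auto simp: sq_deviation_def intro!: sum_nonneg)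

text \<open>\<open>d \<le> l / 2 + d^2 / (2 l)\<close> for each of the ten deviations, two
  directions times five orders. First powers bound the cumulant error, but it is the squares whose
  expectation is known; \<open>l\<close> will be \<open>n\<close> to the power
  \<open>-1/4\<close>.\<close>

lemma sum_sq_deviation_le:
  assumes l: "0 < l"
  shows "(\<Sum>k\<in>UNIV. \<Sum>j\<le>4. cmod (emp_moment x n k j u - char_moment P k j u)) \<le> 5 * l + sq_deviation P x n u / (2 * l)"
proof -
  have "d \<le> l / 2 + d\<^sup>2 / (2 * l)" for d :: real
  proof -
    have "2 * d * l \<le> l * l + d\<^sup>2" using sum_squares_bound[of d l] by (simp add: power2_eq_square add.commute)
    then have "(2 * d * l) / (2 * l) \<le> (l * l + d\<^sup>2) / (2 * l)" using l by (intro divide_right_mono) auto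
    then show ?thesis using l by (simp add: add_divide_distrib)
  qed
  then have "(\<Sum>k\<in>UNIV. \<Sum>j\<le>4. cmod (emp_moment x n k j u - char_moment P k j u)) \<le>
    (\<Sum>k\<in>(UNIV :: 2 set). \<Sum>j\<le>(4::nat). l / 2 + (cmod (emp_moment x n k j u - char_moment P k j u))\<^sup>2 / (2 * l))"
    by (intro sum_mono)
  also have "\<dots> = 5 * l + sq_deviation P x n u / (2 * l)"
    by (simp add: sq_deviation_def sum.distrib sum_divide_distrib)
  finally show ?thesis .
qed

text \<open>\<open>L\<close>, \<open>c\<close> and \<open>C\<close> name constants from existential
  statements: \<open>lower\<close> is the conclusion of \<open>levy_char_lower_bound\<close>, and
  \<open>decay\<close> is assumption (iii) in terms of \<open>cross_weight\<close>.\<close>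

locale levy_est = levy_law +
  fixes K :: "real^2 \<Rightarrow> real" and L c C :: real
  assumes K_nonneg: "\<And>x. 0 \<le> K x"
    and K_L1: "integrable lborel K" and K_int: "(\<integral>x. K x \<partial>lborel) = 1"
    and K_supp: "\<And>u. u \<notin> square 1 \<Longrightarrow> fourier (\<lambda>x. complex_of_real (K x)) u = 0"
    and K_lip: "L-lipschitz_on UNIV (fourier (\<lambda>x. complex_of_real (K x)))"
    and c: "0 < c"
    and decay: "\<And>u. cmod (fourier_measure (density \<nu> (\<lambda>x. ennreal ((x $ 1)^4 + (x $ 2)^4))) u) \<le> c / cross_weight u"
    and C: "0 \<le> C" and lower: "\<And>u. exp (- (C * (norm u)\<^sup>2)) \<le> cmod (levy_char \<Sigma> \<nu> \<alpha> u)"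
begin

abbreviation \<mu> :: "(real^2) measure" where
  "\<mu> \<equiv> density \<nu> (\<lambda>x. ennreal ((x $ 1)^4 + (x $ 2)^4))"

abbreviation FK :: "real^2 \<Rightarrow> complex" where
  "FK \<equiv> fourier (\<lambda>x. complex_of_real (K x))"

lemma L_nonneg: "0 \<le> L" using K_lip by (rule lipschitz_on_nonneg)

lemma nu_quartic_integrable: "integrable \<nu> (\<lambda>x. (x $ 1)^4 + (x $ 2)^4)"
  using nu_moment_comp[of 4 1] nu_moment_comp[of 4 2] by simp

lemma finite_mu: "finite_measure \<mu>"
proof (rule finite_measureI)
  have "emeasure \<mu> (space \<mu>) = (\<integral>\<^sup>+x. ennreal ((x $ 1)^4 + (x $ 2)^4) \<partial>\<nu>)"
    by (simp add: emeasure_density cong: nn_integral_cong)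
  also have "\<dots> = ennreal (\<integral>x. (x $ 1)^4 + (x $ 2)^4 \<partial>\<nu>)"
    by (rule nn_integral_eq_integral[OF nu_quartic_integrable]) auto
  finally show "emeasure \<mu> (space \<mu>) \<noteq> \<infinity>" by simp
qed

lemma sets_mu: "sets \<mu> = sets borel" using sets_nu by simp

text \<open>\<open>\<i>^4 = 1\<close>, so at order four the derivatives of the exponent are
  transforms of positive measures, with no sign or imaginary unit left.\<close>

lemma fourier_mu: "fourier_measure \<mu> u = char_moment \<nu> 1 4 u + char_moment \<nu> 2 4 u"
proof -
  have i4: "(\<i> * complex_of_real t)^4 = complex_of_real (t^4)" for t
    by (simp add: power_mult_distrib)
  have "fourier_measure \<mu> u = (\<integral>x. ((x $ 1)^4 + (x $ 2)^4) *\<^sub>R iexp (u \<bullet> x) \<partial>\<nu>)"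
    unfolding fourier_measure_def by (subst integral_density) auto
  also have "\<dots> = (\<integral>x. (\<i> * complex_of_real (x $ 1))^4 * iexp (u \<bullet> x) + (\<i> * complex_of_real (x $ 2))^4 * iexp (u \<bullet> x) \<partial>\<nu>)"
    unfolding i4 by (simp add: scaleR_conv_of_real distrib_right)
  also have "\<dots> = char_moment \<nu> 1 4 u + char_moment \<nu> 2 4 u"
    unfolding char_moment_def
    by (rule Bochner_Integration.integral_add) (rule integrable_char_moment[OF sets_nu nu_moment_comp]; simp)+
  finally show ?thesis .
qed

text \<open>The density of \<open>\<mu>\<close> cancels the denominator of \<open>g_fun p\<close>,
  which is positive on the orthant because \<open>p\<close> is not the origin.\<close>

lemma integral_g_fun_mu:
  assumes p: "p \<in> pointed_quadrant"
  shows "(\<integral>y. g_fun p y \<partial>\<mu>) = measure \<nu> (upper_orthant p)"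
proof -
  have "(\<integral>y. g_fun p y \<partial>\<mu>) = (\<integral>x. ((x $ 1)^4 + (x $ 2)^4) *\<^sub>R g_fun p x \<partial>\<nu>)"
    by (rule integral_density) auto
  also have "\<dots> = (\<integral>x. indicator (upper_orthant p) x \<partial>\<nu>)"
  proof (intro Bochner_Integration.integral_cong refl)
    fix x
    show "((x $ 1)^4 + (x $ 2)^4) *\<^sub>R g_fun p x = indicator (upper_orthant p) x"
      using max_coord_shift(7)[OF p, of "x $ 1" "x $ 2"]
      by (cases "x \<in> upper_orthant p") (auto simp: g_fun_def upper_orthant_def)
  qed
  also have "\<dots> = measure \<nu> (upper_orthant p)"
    using sets_eq_imp_space_eq[OF sets_nu] by simp
  finally show ?thesis .
qed

lemma measurable_Fg [measurable]: "fourier (\<lambda>x. complex_of_real (g_fun p x)) \<in> borel_measurable borel"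
  by (rule measurable_fourier) measurable

lemma measurable_Fmu [measurable]: "fourier_measure \<mu> \<in> borel_measurable borel"
  by (rule measurable_fourier_measure[OF finite_mu sets_mu])

lemma Fg_bound:
  assumes p: "p \<in> pointed_quadrant"
  shows "cmod (fourier (\<lambda>x. complex_of_real (g_fun p x)) (- u)) \<le> g_fourier_bound (max_coord p) / cross_weight u"
  using fourier_g_fun_bound[OF p, of u] cross_weight_pos[of u] by (simp add: fourier_minus_cnj field_simps)

lemma integrable_Fg_Fmu:
  assumes p: "p \<in> pointed_quadrant"
  shows "integrable lborel (\<lambda>u. fourier (\<lambda>x. complex_of_real (g_fun p x)) (- u) * fourier_measure \<mu> u)"
proof (rule Bochner_Integration.integrable_bound[of _ "\<lambda>u. (g_fourier_bound (max_coord p) * c) * (1 / (cross_weight u)\<^sup>2)"])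
  show "integrable lborel (\<lambda>u. (g_fourier_bound (max_coord p) * c) * (1 / (cross_weight u)\<^sup>2))"
    by (rule integrable_mult_right[OF integrable_inverse_cross_weight_sq])
  show "AE u in lborel. norm (fourier (\<lambda>x. complex_of_real (g_fun p x)) (- u) * fourier_measure \<mu> u) \<le> norm ((g_fourier_bound (max_coord p) * c) * (1 / (cross_weight u)\<^sup>2))"
  proof (rule AE_I2)
    fix u
    have "norm (fourier (\<lambda>x. complex_of_real (g_fun p x)) (- u) * fourier_measure \<mu> u) \<le> (g_fourier_bound (max_coord p) / cross_weight u) * (c / cross_weight u)"
      unfolding norm_mult by (intro mult_mono Fg_bound p decay) (auto simp: g_fourier_bound_def intro!: divide_nonneg_nonneg less_imp_le[OF cross_weight_pos])
    also have "\<dots> = (g_fourier_bound (max_coord p) * c) * (1 / (cross_weight u)\<^sup>2)" by (simp add: power2_eq_square)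
    finally show "norm (fourier (\<lambda>x. complex_of_real (g_fun p x)) (- u) * fourier_measure \<mu> u) \<le> norm ((g_fourier_bound (max_coord p) * c) * (1 / (cross_weight u)\<^sup>2))"
      unfolding real_norm_def by (rule order_trans[OF _ abs_ge_self])
  qed
qed measurable

text \<open>Assumption (iii) enters twice: in the integrability on the Fourier side and, through
  \<open>line_null\<close>, in the continuity of \<open>g_fun p\<close> almost everywhere.\<close>

lemma measure_orthant_parseval:
  assumes p: "p \<in> pointed_quadrant"
  shows "complex_of_real (measure \<nu> (upper_orthant p)) = complex_of_real (1 / (2 * pi)\<^sup>2) *
    (\<integral>u. fourier (\<lambda>x. complex_of_real (g_fun p x)) (- u) * fourier_measure \<mu> u \<partial>lborel)"
  unfolding integral_g_fun_mu[OF p, symmetric]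
proof (rule parseval_finite_measure[OF finite_mu sets_mu g_fun_integrable[OF p] _ _ integrable_Fg_Fmu[OF p]])
  show "\<bar>g_fun p x\<bar> \<le> 4 / (max_coord p)^4" for x using g_fun_le[OF p] g_fun_nonneg by simp
  have "{x. x $ k = p $ k} \<in> null_sets \<mu>" for k
  proof (rule null_setsI)
    show "emeasure \<mu> {x. x $ k = p $ k} = 0" by (rule line_null[OF finite_mu sets_mu decay c])
    have "{x \<in> space (borel :: (real^2) measure). x $ k = p $ k} \<in> sets borel" by measurable
    then show "{x. x $ k = p $ k} \<in> sets \<mu>" using sets_mu by simp
  qed
  then have "AE y in \<mu>. y \<notin> {x. x $ k = p $ k}" for k by (rule AE_not_in)
  from this[of 1] this[of 2] show "AE y in \<mu>. isCont (g_fun p) y"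
    by eventually_elim (use isCont_g_fun[OF p] in auto)
qed

lemma FK_bound: "cmod (FK u) \<le> 1"
proof -
  have "cmod (FK u) \<le> (\<integral>x. cmod (iexp (u \<bullet> x) * complex_of_real (K x)) \<partial>lborel)"
    unfolding fourier_def by (rule integral_norm_bound)
  also have "\<dots> = 1" using K_int K_nonneg by (simp add: norm_mult)
  finally show ?thesis .
qed

lemma FK_0: "FK 0 = 1"
  using K_int by (simp add: fourier_def)

text \<open>\<open>FK 0 = 1\<close> because \<open>K\<close> is a probability density. The Lipschitz
  bound serves low frequencies, the trivial bound 2 high ones.\<close>

lemma FK_diff: "0 < h \<Longrightarrow> cmod (1 - FK (h *\<^sub>R u)) \<le> min 2 (L * h * norm u)"
proof -
  assume h: "0 < h"
  have "cmod (1 - FK (h *\<^sub>R u)) \<le> 2"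
    using norm_triangle_ineq4[of 1 "FK (h *\<^sub>R u)"] FK_bound[of "h *\<^sub>R u"] by simp
  moreover have "cmod (1 - FK (h *\<^sub>R u)) \<le> L * h * norm u"
    using lipschitz_onD[OF K_lip, of 0 "h *\<^sub>R u"] h by (simp add: FK_0 dist_norm)
  ultimately show ?thesis by simp
qed

lemma measurable_psi4 [measurable]: "psi4 k x n \<in> borel_measurable borel"
  unfolding psi4_cumulant4[abs_def] cumulant4_def by measurable

lemma measurable_K [measurable]: "K \<in> borel_measurable borel" using K_L1 by auto

lemma measurable_FK [measurable]: "FK \<in> borel_measurable borel"
  by (rule measurable_fourier) measurable

lemma lower_square:
  assumes h: "0 < h" and u: "u \<in> square (1 / h)"
  shows "exp (- (2 * C / h\<^sup>2)) \<le> cmod (levy_char \<Sigma> \<nu> \<alpha> u)"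
proof -
  have "C * (norm u)\<^sup>2 \<le> C * (2 * (1 / h)\<^sup>2)" by (intro mult_left_mono square_norm_sq u C)
  also have "\<dots> = 2 * C / h\<^sup>2" by (simp add: power_divide)
  finally have "exp (- (2 * C / h\<^sup>2)) \<le> exp (- (C * (norm u)\<^sup>2))" by simp
  then show ?thesis using lower by (rule order_trans)
qed

lemma psi4_error_square:
  assumes A: "1 \<le> A" "emp_quartic x n \<le> A" "quartic_moment P \<le> A" and h: "0 < h"
    and good: "good_event (levy_char \<Sigma> \<nu> \<alpha>) h n x" and u: "u \<in> square (1 / h)"
  shows "cmod (fourier_measure \<mu> u - (psi4 1 x n u + psi4 2 x n u)) \<le>
    3840 * A^4 * exp (10 * C / h\<^sup>2) * (\<Sum>k\<in>UNIV. \<Sum>j\<le>4. cmod (emp_moment x n k j u - char_moment P k j u))"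
proof -
  let ?f = "cmod (levy_char \<Sigma> \<nu> \<alpha> u)" and ?S = "\<lambda>k. \<Sum>j\<le>4. cmod (emp_moment x n k j u - char_moment P k j u)"
  have g: "?f / 2 < cmod (emp_char x n u)" using good u by (auto simp: good_event_def)
  \<comment> \<open>Five powers of the modulus stand in the denominator of
    \<open>psi4_error\<close>; the exponent becomes \<open>5 * 2 * C / h^2\<close>.\<close>
  have "exp (- (2 * C / h\<^sup>2)) ^ 5 \<le> ?f ^ 5" by (intro power_mono lower_square h u) simp
  then have e: "exp (- (10 * C / h\<^sup>2)) \<le> ?f^5" by (simp add: exp_of_nat_mult[symmetric])
  have "1 / ?f^5 \<le> 1 / exp (- (10 * C / h\<^sup>2))"
  proof (rule divide_left_mono[OF e])
    have "0 < ?f^5" using e exp_gt_zero less_le_trans by blast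
    then show "0 < ?f^5 * exp (- (10 * C / h\<^sup>2))" by simp
  qed simp
  then have fi: "1 / ?f^5 \<le> exp (10 * C / h\<^sup>2)" by (simp add: exp_minus field_simps)
  have k: "cmod (psi4 k x n u - char_moment \<nu> k 4 u) \<le> 3840 * A^4 * exp (10 * C / h\<^sup>2) * ?S k" for k
  proof -
    have "cmod (psi4 k x n u - char_moment \<nu> k 4 u) \<le> 3840 * A^4 / ?f^5 * ?S k" by (rule psi4_error[OF A g])
    also have "\<dots> = 3840 * A^4 * (1 / ?f^5) * ?S k" by simp
    also have "\<dots> \<le> 3840 * A^4 * exp (10 * C / h\<^sup>2) * ?S k"
      using A by (intro mult_right_mono mult_left_mono fi sum_nonneg) auto
    finally show ?thesis .
  qed
  have "fourier_measure \<mu> u - (psi4 1 x n u + psi4 2 x n u) = - ((psi4 1 x n u - char_moment \<nu> 1 4 u) + (psi4 2 x n u - char_moment \<nu> 2 4 u))"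
    by (simp only: fourier_mu) simp
  then have "cmod (fourier_measure \<mu> u - (psi4 1 x n u + psi4 2 x n u)) \<le> cmod (psi4 1 x n u - char_moment \<nu> 1 4 u) + cmod (psi4 2 x n u - char_moment \<nu> 2 4 u)"
    using norm_triangle_ineq[of "psi4 1 x n u - char_moment \<nu> 1 4 u"] by (simp only: norm_minus_cancel)
  also have "\<dots> \<le> 3840 * A^4 * exp (10 * C / h\<^sup>2) * ?S 1 + 3840 * A^4 * exp (10 * C / h\<^sup>2) * ?S 2"
    by (intro add_mono k)
  finally show ?thesis by (simp add: UNIV_2 distrib_left)
qed

definition stochastic_error :: "real \<Rightarrow> (nat \<Rightarrow> real^2) \<Rightarrow> nat \<Rightarrow> ennreal" where
  "stochastic_error h x n = (\<integral>\<^sup>+u. ennreal (cmod (fourier_measure \<mu> u - (psi4 1 x n u + psi4 2 x n u))) * indicator (square (1 / h)) u \<partial>lborel)"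

text \<open>The pointwise bound is integrated over a square of area \<open>4 / h^2\<close>, which
  turns \<open>5 l\<close> into \<open>20 l / h^2\<close>.\<close>

lemma stochastic_error_bound:
  assumes A: "1 \<le> A" "emp_quartic x n \<le> A" "quartic_moment P \<le> A" and h: "0 < h" and l: "0 < l"
    and good: "good_event (levy_char \<Sigma> \<nu> \<alpha>) h n x" and T: "total_deviation P h x n \<le> ennreal \<tau>" and \<tau>: "0 \<le> \<tau>"
  shows "stochastic_error h x n \<le> ennreal (3840 * A^4 * exp (10 * C / h\<^sup>2) * (20 * l / h\<^sup>2 + \<tau> / (2 * l)))"
proof -
  let ?D = "3840 * A^4 * exp (10 * C / h\<^sup>2)"
  have D: "0 \<le> ?D" by simp
  have "stochastic_error h x n \<le> (\<integral>\<^sup>+u. ennreal ?D * (ennreal (5 * l) * indicator (square (1 / h)) u + ennreal (1 / (2 * l)) * (ennreal (sq_deviation P x n u) * indicator (square (1 / h + 1)) u)) \<partial>lborel)"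
    unfolding stochastic_error_def
  proof (intro nn_integral_mono)
    fix u
    show "ennreal (cmod (fourier_measure \<mu> u - (psi4 1 x n u + psi4 2 x n u))) * indicator (square (1 / h)) u
      \<le> ennreal ?D * (ennreal (5 * l) * indicator (square (1 / h)) u + ennreal (1 / (2 * l)) * (ennreal (sq_deviation P x n u) * indicator (square (1 / h + 1)) u))"
    proof (cases "u \<in> square (1 / h)")
      case True
      then have True': "u \<in> square (1 / h + 1)" by (auto simp: square_def)
      have "cmod (fourier_measure \<mu> u - (psi4 1 x n u + psi4 2 x n u)) \<le> ?D * (5 * l + sq_deviation P x n u / (2 * l))"
        by (rule order_trans[OF psi4_error_square[OF A h good True]]) (intro mult_left_mono sum_sq_deviation_le l D)
      then have "ennreal (cmod (fourier_measure \<mu> u - (psi4 1 x n u + psi4 2 x n u))) \<le> ennreal (?D * (5 * l + (1 / (2 * l)) * sq_deviation P x n u))"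
        by (intro ennreal_leI) simp
      also have "\<dots> = ennreal ?D * (ennreal (5 * l) + ennreal (1 / (2 * l)) * ennreal (sq_deviation P x n u))"
      proof -
        have "ennreal (a * (b + e * f)) = ennreal a * (ennreal b + ennreal e * ennreal f)"
          if "0 \<le> a" "0 \<le> b" "0 \<le> e" "0 \<le> f" for a b e f
          using that by (simp add: ennreal_mult ennreal_plus)
        note * = this
        show ?thesis by (rule *) (use l D sq_deviation_nonneg in auto)
      qed
      finally show ?thesis using True True' by simp
    qed simp
  qed
  also have "\<dots> = ennreal ?D * (ennreal (5 * l) * emeasure lborel (square (1 / h)) + ennreal (1 / (2 * l)) * total_deviation P h x n)"
    by (simp add: nn_integral_cmult nn_integral_add total_deviation_def)
  also have "\<dots> \<le> ennreal ?D * (ennreal (5 * l) * ennreal (4 * (1 / h)\<^sup>2) + ennreal (1 / (2 * l)) * ennreal \<tau>)"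
    using h T by (intro mult_left_mono add_mono) (auto simp: emeasure_square)
  also have "\<dots> = ennreal (?D * (5 * l * (4 * (1 / h)\<^sup>2) + (1 / (2 * l)) * \<tau>))"
  proof -
    have "ennreal a * (ennreal b * ennreal d + ennreal e * ennreal f) = ennreal (a * (b * d + e * f))"
      if "0 \<le> a" "0 \<le> b" "0 \<le> d" "0 \<le> e" "0 \<le> f" for a b d e f
      using that by (simp add: ennreal_mult ennreal_plus)
    note * = this
    show ?thesis by (rule *) (use l \<tau> D in auto)
  qed
  also have "?D * (5 * l * (4 * (1 / h)\<^sup>2) + (1 / (2 * l)) * \<tau>) = ?D * (20 * l / h\<^sup>2 + \<tau> / (2 * l))"
    by (simp add: power_divide)
  finally show ?thesis .
qed

text \<open>Both characteristic functions are Lipschitz, so a deviation of size \<open>s\<close> at one point persists on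
  a square of side of order \<open>s\<close>; this turns an integral bound into a uniform one.\<close>

lemma good_event_of_total_deviation:
  assumes A: "1 \<le> A" "emp_quartic x n \<le> A" "quartic_moment P \<le> A" and h: "0 < h"
    and T: "total_deviation P h x n < ennreal (exp (- (8 * C / h\<^sup>2)) / (4096 * A\<^sup>2))"
  shows "good_event (levy_char \<Sigma> \<nu> \<alpha>) h n x"
proof (rule ccontr)
  assume "\<not> good_event (levy_char \<Sigma> \<nu> \<alpha>) h n x"
  then obtain w where w: "w \<in> square (1 / h)" "cmod (emp_char x n w) \<le> cmod (levy_char \<Sigma> \<nu> \<alpha> w) / 2"
    by (auto simp: good_event_def not_less)
  \<comment> \<open>At a bad point the two characteristic functions differ by at least half the
    modulus of the true one, hence by \<open>s\<close>.\<close>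
  define s where "s = exp (- (2 * C / h\<^sup>2)) / 2"
  \<comment> \<open>On \<open>?Q\<close> the distance to \<open>w\<close> is at most
    \<open>2 r\<close> and each of the two functions has Lipschitz constant at most
    \<open>2 A\<close>, so the difference loses at most \<open>8 A r = s / 2\<close>. Because of
    \<open>r \<le> 1\<close> the square \<open>?Q\<close> stays inside the enlarged square.\<close>
  define r where "r = s / (16 * A)"
  have "exp (- (2 * C / h\<^sup>2)) \<le> 1" using C by simp
  then have s: "0 < s" "s \<le> 1" unfolding s_def using exp_gt_zero[of "- (2 * C / h\<^sup>2)"] by linarith+
  have r: "0 < r" "r \<le> 1" using s A by (auto simp: r_def field_simps)
  let ?Q = "{v :: real^2. w $ 1 - r \<le> v $ 1 \<and> v $ 1 \<le> w $ 1 + r \<and> w $ 2 - r \<le> v $ 2 \<and> v $ 2 \<le> w $ 2 + r}"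
  let ?d = "\<lambda>v. emp_char x n v - levy_char \<Sigma> \<nu> \<alpha> v"
  have dw: "s \<le> cmod (?d w)"
  proof -
    have "cmod (levy_char \<Sigma> \<nu> \<alpha> w) \<le> cmod (emp_char x n w) + cmod (?d w)"
      using norm_triangle_ineq4[of "emp_char x n w" "?d w"] by simp
    then show ?thesis using w lower_square[OF h w(1)] by (simp add: s_def)
  qed
  have sq_deviation_ge: "s\<^sup>2 / 4 \<le> sq_deviation P x n v" if v: "v \<in> ?Q" for v
  proof -
    have "norm (w - v) \<le> \<bar>(w - v) $ 1\<bar> + \<bar>(w - v) $ 2\<bar>" using norm_le_l1_cart[of "w - v"] by (simp add: sum_2)
    also have "\<dots> \<le> 2 * r" using v by auto
    finally have nv: "norm (w - v) \<le> 2 * r" .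
    have "?d w - ?d v = (emp_char x n w - emp_char x n v) - (levy_char \<Sigma> \<nu> \<alpha> w - levy_char \<Sigma> \<nu> \<alpha> v)" by simp
    then have "cmod (?d w - ?d v) \<le> cmod (emp_char x n w - emp_char x n v) + cmod (levy_char \<Sigma> \<nu> \<alpha> w - levy_char \<Sigma> \<nu> \<alpha> v)"
      by (simp only: norm_triangle_ineq4)
    also have "\<dots> \<le> 2 * emp_quartic x n * norm (w - v) + 2 * quartic_moment P * norm (w - v)"
      by (intro add_mono emp_char_lipschitz levy_char_lipschitz)
    also have "\<dots> \<le> 2 * A * (2 * r) + 2 * A * (2 * r)"
    proof -
      have "0 \<le> emp_quartic x n" "0 \<le> quartic_moment P"
        using order_trans[OF norm_ge_zero emp_moment_le_emp_quartic[of 0 x n 1 0]] order_trans[OF norm_ge_zero char_moment_le_quartic_moment[of 0 1 0]] by auto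
      then show ?thesis using A nv by (intro add_mono mult_mono) auto
    qed
    also have "\<dots> = s / 2" using A by (simp add: r_def)
    finally have "s / 2 \<le> cmod (?d v)"
      using dw norm_triangle_ineq2[of "?d w" "?d v"] by linarith
    then have "(s / 2)\<^sup>2 \<le> (cmod (?d v))\<^sup>2" using s by (intro power_mono) auto
    also have "\<dots> = (cmod (emp_moment x n 1 0 v - char_moment P 1 0 v))\<^sup>2" by (simp add: emp_moment_0 char_moment_P_0)
    also have "\<dots> \<le> (\<Sum>j\<le>4. (cmod (emp_moment x n 1 j v - char_moment P 1 j v))\<^sup>2)"
      by (rule member_le_sum[of 0 "{..4}"]) auto
    also have "\<dots> \<le> sq_deviation P x n v"
      unfolding sq_deviation_def by (rule member_le_sum[of 1 UNIV "\<lambda>k. \<Sum>j\<le>4. (cmod (emp_moment x n k j v - char_moment P k j v))\<^sup>2"]) (auto intro: sum_nonneg)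
    finally show ?thesis by (simp add: power_divide)
  qed
  have Qm: "?Q \<in> sets borel"
  proof -
    have "{v \<in> space (borel :: (real^2) measure). w $ 1 - r \<le> v $ 1 \<and> v $ 1 \<le> w $ 1 + r \<and> w $ 2 - r \<le> v $ 2 \<and> v $ 2 \<le> w $ 2 + r} \<in> sets borel" by measurable
    then show ?thesis by simp
  qed
  have Qs: "v \<in> square (1 / h + 1)" if "v \<in> ?Q" for v
    using that w(1) r by (auto simp: square_def)
  \<comment> \<open>\<open>?Q\<close> has area \<open>4 r^2\<close> and carries squared deviation at
    least \<open>s^2 / 4\<close>. The product is \<open>s^4 / (256 A^2)\<close>, and
    \<open>s^4 = exp (- 8 C / h^2) / 16\<close> makes it the threshold.\<close>
  have "ennreal (s\<^sup>2 / 4) * ennreal ((2 * r) * (2 * r)) = ennreal (s\<^sup>2 / 4) * emeasure lborel ?Q"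
    using r by (subst emeasure_rectangle) auto
  also have "\<dots> = (\<integral>\<^sup>+v. ennreal (s\<^sup>2 / 4) * indicator ?Q v \<partial>lborel)"
    using Qm by (simp add: nn_integral_cmult_indicator)
  also have "\<dots> \<le> total_deviation P h x n"
    unfolding total_deviation_def
    by (intro nn_integral_mono) (auto simp: indicator_def Qs intro!: ennreal_leI sq_deviation_ge)
  finally have "ennreal (s\<^sup>2 / 4 * ((2 * r) * (2 * r))) \<le> total_deviation P h x n"
    by (subst ennreal_mult) (use r in auto)
  moreover have "s\<^sup>2 / 4 * ((2 * r) * (2 * r)) = exp (- (8 * C / h\<^sup>2)) / (4096 * A\<^sup>2)"
  proof -
    have "s\<^sup>2 / 4 * ((2 * r) * (2 * r)) = s^4 / (256 * A\<^sup>2)"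
      using A by (simp add: r_def power2_eq_square power4_eq_xxxx)
    also have "s^4 = exp (- (8 * C / h\<^sup>2)) / 16"
      by (simp add: s_def power_divide exp_of_nat_mult[symmetric])
    finally show ?thesis by simp
  qed
  ultimately show False using T by (simp add: not_less)
qed

end

subsection \<open>Error of the estimator\<close>

lemma norm_weight_nonneg: "0 \<le> norm_weight p" by (simp add: norm_weight_def)

lemma measurable_inv_fourier:
  assumes [measurable]: "f \<in> borel_measurable borel"
  shows "inv_fourier f \<in> borel_measurable borel"
proof -
  have "(\<lambda>x. complex_of_real (1 / (2 * pi)\<^sup>2) * (\<integral>u. iexp (- (u \<bullet> x)) * f u \<partial>lborel)) \<in> borel_measurable borel"
    by (intro borel_measurable_times borel_measurable_const lborel.borel_measurable_lebesgue_integral) measurable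
  then show ?thesis unfolding inv_fourier_def[abs_def] .
qed

lemma inverse_four_pi_sq_le_1: "1 / (2 * pi)\<^sup>2 \<le> 1"
proof -
  have "1\<^sup>2 \<le> (2 * pi)\<^sup>2" using pi_gt3 by (intro power_mono) auto
  then show ?thesis using pi_gt_zero by (simp add: divide_le_eq)
qed

context levy_est
begin

abbreviation \<phi> :: "real^2 \<Rightarrow> complex" where "\<phi> \<equiv> levy_char \<Sigma> \<nu> \<alpha>"

definition smoothed_psi4 :: "real \<Rightarrow> nat \<Rightarrow> (nat \<Rightarrow> real^2) \<Rightarrow> real^2 \<Rightarrow> complex" where
  "smoothed_psi4 h n x u = indicator (square (1 / h)) u * ((psi4 1 x n u + psi4 2 x n u) *
     fourier (\<lambda>z. complex_of_real (kernel_scale K h z)) u)"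

lemma smoothed_psi4_FK: "0 < h \<Longrightarrow> smoothed_psi4 h n x u = indicator (square (1 / h)) u * ((psi4 1 x n u + psi4 2 x n u) * FK (h *\<^sub>R u))"
  unfolding smoothed_psi4_def by (subst fourier_kernel_scale) auto

lemma measurable_smoothed_psi4: "0 < h \<Longrightarrow> smoothed_psi4 h n x \<in> borel_measurable borel"
proof -
  assume h: "0 < h"
  have "smoothed_psi4 h n x = (\<lambda>u. indicator (square (1 / h)) u * ((psi4 1 x n u + psi4 2 x n u) * FK (h *\<^sub>R u)))"
    by (rule ext) (rule smoothed_psi4_FK[OF h])
  also have "\<dots> \<in> borel_measurable borel" by measurable
  finally show ?thesis .
qed

text \<open>\<open>psi4_error_square\<close> with an \<open>A\<close> that depends on the sample.
  Only finiteness matters here; it makes the smoothed cumulant integrable for every sample in the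
  good event.\<close>

lemma psi4_bounded:
  assumes h: "0 < h" and good: "good_event \<phi> h n x"
  shows "\<exists>B\<ge>0. \<forall>u\<in>square (1 / h). cmod (psi4 1 x n u + psi4 2 x n u) \<le> B \<and>
    cmod (fourier_measure \<mu> u - (psi4 1 x n u + psi4 2 x n u)) \<le> B"
proof -
  define A where "A = max 1 (max (emp_quartic x n) (quartic_moment P))"
  have A: "1 \<le> A" "emp_quartic x n \<le> A" "quartic_moment P \<le> A" by (auto simp: A_def)
  define B where "B = 3840 * A^4 * exp (10 * C / h\<^sup>2) * (\<Sum>k\<in>(UNIV :: 2 set). \<Sum>j\<le>(4::nat). 2 * A)"
  have B: "0 \<le> B" unfolding B_def using A by (intro mult_nonneg_nonneg sum_nonneg) auto
  have 1: "cmod (fourier_measure \<mu> u - (psi4 1 x n u + psi4 2 x n u)) \<le> B" if u: "u \<in> square (1 / h)" for u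
  proof (rule order_trans[OF psi4_error_square[OF A h good u]], unfold B_def, intro mult_left_mono sum_mono)
    fix k :: 2 and j assume "j \<in> {..4::nat}"
    then have "j \<le> 4" by simp
    from char_moment_le_quartic_moment[OF this, of k u] emp_moment_le_emp_quartic[OF this, of x n k u] A
    show "cmod (emp_moment x n k j u - char_moment P k j u) \<le> 2 * A"
      using norm_triangle_ineq4[of "emp_moment x n k j u" "char_moment P k j u"] by linarith
  qed (use A in auto)
  have 2: "cmod (psi4 1 x n u + psi4 2 x n u) \<le> c + B" if u: "u \<in> square (1 / h)" for u
  proof -
    have "cmod (fourier_measure \<mu> u) \<le> c / cross_weight u" by (rule decay)
    also have "\<dots> \<le> c / 1" using c cross_weight_ge1[of u] by (intro divide_left_mono) auto
    finally have "cmod (fourier_measure \<mu> u) \<le> c" by simp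
    with 1[OF u] show ?thesis
      using norm_triangle_ineq4[of "fourier_measure \<mu> u" "fourier_measure \<mu> u - (psi4 1 x n u + psi4 2 x n u)"] by simp
  qed
  show ?thesis
  proof (intro exI[of _ "c + B"] conjI ballI)
    show "0 \<le> c + B" using B c by simp
    fix u assume u: "u \<in> square (1 / h)"
    show "cmod (psi4 1 x n u + psi4 2 x n u) \<le> c + B" by (rule 2[OF u])
    show "cmod (fourier_measure \<mu> u - (psi4 1 x n u + psi4 2 x n u)) \<le> c + B"
      by (rule order_trans[OF 1[OF u]]) (use c in simp)
  qed
qed

lemma integrable_indicator_square: "0 < h \<Longrightarrow> integrable lborel (\<lambda>u. B * indicator (square (1 / h)) u :: real)"
  by (intro integrable_mult_right integrable_real_indicator) (auto simp: emeasure_square)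

lemma integrable_smoothed_psi4:
  assumes h: "0 < h" and good: "good_event \<phi> h n x"
  shows "integrable lborel (smoothed_psi4 h n x)"
proof -
  obtain B where B: "0 \<le> B" "\<And>u. u \<in> square (1 / h) \<Longrightarrow> cmod (psi4 1 x n u + psi4 2 x n u) \<le> B"
    using psi4_bounded[OF h good] by blast
  show ?thesis
  proof (rule Bochner_Integration.integrable_bound[OF integrable_indicator_square[OF h, of B]])
    show "smoothed_psi4 h n x \<in> borel_measurable lborel" using measurable_smoothed_psi4[OF h] by simp
    show "AE u in lborel. norm (smoothed_psi4 h n x u) \<le> norm (B * indicator (square (1 / h)) u)"
    proof (rule AE_I2)
      fix u
      show "norm (smoothed_psi4 h n x u) \<le> norm (B * indicator (square (1 / h)) u)"
      proof (cases "u \<in> square (1 / h)")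
        case True
        have "cmod (psi4 1 x n u + psi4 2 x n u) * cmod (FK (h *\<^sub>R u)) \<le> B * 1"
          by (intro mult_mono B True FK_bound) auto
        then show ?thesis using True B(1) by (simp add: smoothed_psi4_FK[OF h] norm_mult)
      qed (simp add: smoothed_psi4_def)
    qed
  qed
qed

lemma stochastic_error_finite:
  assumes h: "0 < h" and good: "good_event \<phi> h n x"
  shows "stochastic_error h x n < \<infinity>"
proof -
  obtain B where B: "0 \<le> B" "\<And>u. u \<in> square (1 / h) \<Longrightarrow> cmod (fourier_measure \<mu> u - (psi4 1 x n u + psi4 2 x n u)) \<le> B"
    using psi4_bounded[OF h good] by blast
  have "stochastic_error h x n \<le> (\<integral>\<^sup>+u. ennreal B * indicator (square (1 / h)) u \<partial>lborel)"
    unfolding stochastic_error_def by (intro nn_integral_mono) (auto simp: indicator_def simp del: ennreal_plus intro!: ennreal_leI B)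
  also have "\<dots> < \<infinity>" using h by (simp add: nn_integral_cmult_indicator emeasure_square ennreal_mult_less_top)
  finally show ?thesis .
qed

lemma N_hat_eq:
  assumes h: "0 < h" and good: "good_event \<phi> h n x" and p: "p \<in> pointed_quadrant"
  shows "N_hat K \<phi> h n x p = complex_of_real (1 / (2 * pi)\<^sup>2) *
    (\<integral>u. fourier (\<lambda>x. complex_of_real (g_fun p x)) (- u) * smoothed_psi4 h n x u \<partial>lborel)"
  using good inv_fourier_pairing[OF integrable_smoothed_psi4[OF h good] g_fun_integrable[OF p]]
  by (simp add: N_hat_def smoothed_psi4_def[abs_def])

lemma integrable_Fg_smoothed_psi4:
  assumes h: "0 < h" and good: "good_event \<phi> h n x" and p: "p \<in> pointed_quadrant"
  shows "integrable lborel (\<lambda>u. fourier (\<lambda>x. complex_of_real (g_fun p x)) (- u) * smoothed_psi4 h n x u)"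
proof (rule Bochner_Integration.integrable_bound)
  note [measurable] = measurable_smoothed_psi4[OF h]
  show "integrable lborel (\<lambda>u. g_fourier_bound (max_coord p) *\<^sub>R smoothed_psi4 h n x u)" using integrable_smoothed_psi4[OF h good] by simp
  show "(\<lambda>u. fourier (\<lambda>x. complex_of_real (g_fun p x)) (- u) * smoothed_psi4 h n x u) \<in> borel_measurable lborel" by measurable
  show "AE u in lborel. norm (fourier (\<lambda>x. complex_of_real (g_fun p x)) (- u) * smoothed_psi4 h n x u) \<le> norm (g_fourier_bound (max_coord p) *\<^sub>R smoothed_psi4 h n x u)"
  proof (rule AE_I2)
    fix u
    have "cmod (fourier (\<lambda>x. complex_of_real (g_fun p x)) (- u)) \<le> g_fourier_bound (max_coord p) / cross_weight u" by (rule Fg_bound[OF p])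
    also have "\<dots> \<le> g_fourier_bound (max_coord p) / 1"
      using cross_weight_ge1[of u] by (intro divide_left_mono) (auto simp: g_fourier_bound_def)
    finally show "norm (fourier (\<lambda>x. complex_of_real (g_fun p x)) (- u) * smoothed_psi4 h n x u) \<le> norm (g_fourier_bound (max_coord p) *\<^sub>R smoothed_psi4 h n x u)"
      by (auto simp: norm_mult g_fourier_bound_def intro!: mult_right_mono)
  qed
qed

text \<open>All dependence on \<open>p\<close> sits in the factor bounded by
  \<open>norm_weight_g_fourier_bound\<close>; here the estimate becomes uniform in
  \<open>p\<close>.\<close>

lemma norm_weight_fourier_le:
  assumes p: "p \<in> pointed_quadrant" and G [measurable]: "G \<in> borel_measurable borel"
  shows "ennreal (norm_weight p * cmod (complex_of_real (1 / (2 * pi)\<^sup>2) * (\<integral>u. fourier (\<lambda>x. complex_of_real (g_fun p x)) (- u) * G u \<partial>lborel)))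
    \<le> ennreal 32768 * (\<integral>\<^sup>+u. ennreal (cmod (G u) / cross_weight u) \<partial>lborel)"
proof -
  let ?I = "\<integral>u. fourier (\<lambda>x. complex_of_real (g_fun p x)) (- u) * G u \<partial>lborel"
  have "norm_weight p * cmod (complex_of_real (1 / (2 * pi)\<^sup>2) * ?I) = (norm_weight p * (1 / (2 * pi)\<^sup>2)) * cmod ?I"
    by (simp add: norm_mult norm_divide norm_power)
  also have "\<dots> \<le> (norm_weight p * 1) * cmod ?I"
    by (intro mult_right_mono mult_left_mono inverse_four_pi_sq_le_1 norm_weight_nonneg) auto
  also have "\<dots> = cmod (\<integral>u. norm_weight p *\<^sub>R (fourier (\<lambda>x. complex_of_real (g_fun p x)) (- u) * G u) \<partial>lborel)"
    unfolding integral_scaleR_right by (simp add: norm_weight_nonneg)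
  finally have "ennreal (norm_weight p * cmod (complex_of_real (1 / (2 * pi)\<^sup>2) * ?I)) \<le> ennreal (cmod (\<integral>u. norm_weight p *\<^sub>R (fourier (\<lambda>x. complex_of_real (g_fun p x)) (- u) * G u) \<partial>lborel))"
    by (rule ennreal_leI)
  also have "\<dots> \<le> (\<integral>\<^sup>+u. ennreal (cmod (norm_weight p *\<^sub>R (fourier (\<lambda>x. complex_of_real (g_fun p x)) (- u) * G u))) \<partial>lborel)"
    by (rule norm_integral_le_nn_integral)
  also have "\<dots> \<le> (\<integral>\<^sup>+u. ennreal 32768 * ennreal (cmod (G u) / cross_weight u) \<partial>lborel)"
  proof (intro nn_integral_mono)
    fix u
    have "cmod (norm_weight p *\<^sub>R (fourier (\<lambda>x. complex_of_real (g_fun p x)) (- u) * G u)) =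
        norm_weight p * (cmod (fourier (\<lambda>x. complex_of_real (g_fun p x)) (- u)) * cmod (G u))"
      by (simp add: norm_mult norm_weight_nonneg)
    also have "\<dots> \<le> norm_weight p * (g_fourier_bound (max_coord p) / cross_weight u * cmod (G u))"
      by (intro mult_left_mono mult_right_mono Fg_bound p norm_weight_nonneg) auto
    also have "\<dots> = (norm_weight p * g_fourier_bound (max_coord p)) * (cmod (G u) / cross_weight u)" by simp
    also have "\<dots> \<le> 32768 * (cmod (G u) / cross_weight u)"
      by (intro mult_right_mono norm_weight_g_fourier_bound p) (simp add: less_imp_le[OF cross_weight_pos])
    finally have "ennreal (cmod (norm_weight p *\<^sub>R (fourier (\<lambda>x. complex_of_real (g_fun p x)) (- u) * G u))) \<le> ennreal (32768 * (cmod (G u) / cross_weight u))"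
      by (rule ennreal_leI)
    then show "ennreal (cmod (norm_weight p *\<^sub>R (fourier (\<lambda>x. complex_of_real (g_fun p x)) (- u) * G u))) \<le> ennreal 32768 * ennreal (cmod (G u) / cross_weight u)"
      by (subst (asm) ennreal_mult) (auto simp: less_imp_le[OF cross_weight_pos])
  qed
  also have "\<dots> = ennreal 32768 * (\<integral>\<^sup>+u. ennreal (cmod (G u) / cross_weight u) \<partial>lborel)"
    by (rule nn_integral_cmult) measurable
  finally show ?thesis .
qed

text \<open>On the square the difference of the integrands is
  \<open>?F (1 - FK) + FK (?F - ?\<psi>)\<close>, bias plus stochastic error; off the square
  \<open>FK (h u)\<close> vanishes and the bias alone remains. The bias keeps
  \<open>1 / cross_weight\<close> and gains another one from \<open>decay\<close>; in the stochastic
  error that factor is bounded by 1.\<close>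

lemma est_error:
  assumes h: "0 < h" and good: "good_event \<phi> h n x" and p: "p \<in> pointed_quadrant"
  shows "ennreal (norm_weight p * cmod (complex_of_real (measure \<nu> (upper_orthant p)) - N_hat K \<phi> h n x p))
    \<le> ennreal 32768 * (ennreal (c * (8 * (L * h * ln (1 + 1 / h) + 2 * h))) + stochastic_error h x n)"
proof -
  note [measurable] = measurable_smoothed_psi4[OF h]
  have nn: "0 \<le> 8 * (L * h * ln (1 + 1 / h) + 2 * h)" using h L_nonneg by auto
  let ?G = "\<lambda>u. fourier_measure \<mu> u - smoothed_psi4 h n x u"
  have eq: "complex_of_real (measure \<nu> (upper_orthant p)) - N_hat K \<phi> h n x p =
    complex_of_real (1 / (2 * pi)\<^sup>2) * (\<integral>u. fourier (\<lambda>x. complex_of_real (g_fun p x)) (- u) * ?G u \<partial>lborel)"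
    unfolding measure_orthant_parseval[OF p] N_hat_eq[OF h good p] right_diff_distrib[symmetric]
    by (subst Bochner_Integration.integral_diff[OF integrable_Fg_Fmu[OF p] integrable_Fg_smoothed_psi4[OF h good p], symmetric])
      (simp add: right_diff_distrib)
  have mG: "?G \<in> borel_measurable borel" by measurable
  have "ennreal (norm_weight p * cmod (complex_of_real (measure \<nu> (upper_orthant p)) - N_hat K \<phi> h n x p))
    \<le> ennreal 32768 * (\<integral>\<^sup>+u. ennreal (cmod (?G u) / cross_weight u) \<partial>lborel)"
    unfolding eq by (rule norm_weight_fourier_le[OF p mG])
  also have "(\<integral>\<^sup>+u. ennreal (cmod (?G u) / cross_weight u) \<partial>lborel) \<le>
    (\<integral>\<^sup>+u. ennreal c * ennreal (min 2 (L * h * norm u) / (cross_weight u)\<^sup>2) + ennreal (cmod (fourier_measure \<mu> u - (psi4 1 x n u + psi4 2 x n u))) * indicator (square (1 / h)) u \<partial>lborel)"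
  proof (intro nn_integral_mono)
    fix u
    let ?F = "fourier_measure \<mu> u" and ?\<psi> = "psi4 1 x n u + psi4 2 x n u" and ?m = "min 2 (L * h * norm u)"
    have m: "0 \<le> ?m" using h L_nonneg by auto
    have b1: "cmod (?F * (1 - FK (h *\<^sub>R u))) / cross_weight u \<le> c * (?m / (cross_weight u)\<^sup>2)"
    proof -
      have "cmod (?F * (1 - FK (h *\<^sub>R u))) \<le> c / cross_weight u * ?m"
        unfolding norm_mult using c by (intro mult_mono decay FK_diff h) (auto simp: less_imp_le[OF cross_weight_pos])
      then have "cmod (?F * (1 - FK (h *\<^sub>R u))) / cross_weight u \<le> (c / cross_weight u * ?m) / cross_weight u"
        by (intro divide_right_mono less_imp_le[OF cross_weight_pos])
      then show ?thesis by (simp add: power2_eq_square)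
    qed
    show "ennreal (cmod (?G u) / cross_weight u) \<le> ennreal c * ennreal (?m / (cross_weight u)\<^sup>2) + ennreal (cmod (?F - ?\<psi>)) * indicator (square (1 / h)) u"
    proof (cases "u \<in> square (1 / h)")
      case True
      have "?G u = ?F * (1 - FK (h *\<^sub>R u)) + FK (h *\<^sub>R u) * (?F - ?\<psi>)"
        using True by (simp add: smoothed_psi4_FK[OF h] algebra_simps)
      then have "cmod (?G u) \<le> cmod (?F * (1 - FK (h *\<^sub>R u))) + cmod (FK (h *\<^sub>R u) * (?F - ?\<psi>))"
        by (simp only: norm_triangle_ineq)
      also have "cmod (FK (h *\<^sub>R u) * (?F - ?\<psi>)) \<le> 1 * cmod (?F - ?\<psi>)"
        unfolding norm_mult by (intro mult_right_mono FK_bound) simp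
      finally have "cmod (?G u) / cross_weight u \<le> (cmod (?F * (1 - FK (h *\<^sub>R u))) + cmod (?F - ?\<psi>)) / cross_weight u"
        by (intro divide_right_mono less_imp_le[OF cross_weight_pos]) simp
      also have "\<dots> = cmod (?F * (1 - FK (h *\<^sub>R u))) / cross_weight u + cmod (?F - ?\<psi>) / cross_weight u" by (rule add_divide_distrib)
      also have "\<dots> \<le> c * (?m / (cross_weight u)\<^sup>2) + cmod (?F - ?\<psi>) / 1"
        using cross_weight_ge1[of u] cross_weight_pos[of u] by (intro add_mono b1 divide_left_mono) auto
      finally have "ennreal (cmod (?G u) / cross_weight u) \<le> ennreal (c * (?m / (cross_weight u)\<^sup>2) + cmod (?F - ?\<psi>))"
        by (intro ennreal_leI) simp
      also have "\<dots> = ennreal c * ennreal (?m / (cross_weight u)\<^sup>2) + ennreal (cmod (?F - ?\<psi>))"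
      proof -
        have "ennreal (c * (?m / (cross_weight u)\<^sup>2)) = ennreal c * ennreal (?m / (cross_weight u)\<^sup>2)"
          by (rule ennreal_mult) (use c m in auto)
        then show ?thesis using c m by (subst ennreal_plus) (simp_all only: mult_nonneg_nonneg divide_nonneg_nonneg zero_le_power2 norm_ge_zero less_imp_le)
      qed
      finally show ?thesis using True by simp
    next
      case False
      then have "h *\<^sub>R u \<notin> square 1" using h by (auto simp: square_def abs_mult field_simps)
      then have "FK (h *\<^sub>R u) = 0" by (rule K_supp)
      then have "cmod (?G u) / cross_weight u \<le> c * (?m / (cross_weight u)\<^sup>2)" using b1 False by (simp add: smoothed_psi4_def)
      then have "ennreal (cmod (?G u) / cross_weight u) \<le> ennreal (c * (?m / (cross_weight u)\<^sup>2))" by (rule ennreal_leI)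
      also have "\<dots> = ennreal c * ennreal (?m / (cross_weight u)\<^sup>2)" by (rule ennreal_mult) (use c m in auto)
      finally show ?thesis using False by (simp del: ennreal_plus)
    qed
  qed
  also have "\<dots> = ennreal c * (\<integral>\<^sup>+u. ennreal (min 2 (L * h * norm u) / (cross_weight u)\<^sup>2) \<partial>lborel) + stochastic_error h x n"
    by (simp add: nn_integral_add nn_integral_cmult stochastic_error_def del: ennreal_plus)
  also have "\<dots> \<le> ennreal c * ennreal (8 * (L * h * ln (1 + 1 / h) + 2 * h)) + stochastic_error h x n"
    by (intro add_mono mult_left_mono nn_integral_bias h L_nonneg) auto
  also have "ennreal c * ennreal (8 * (L * h * ln (1 + 1 / h) + 2 * h)) = ennreal (c * (8 * (L * h * ln (1 + 1 / h) + 2 * h)))"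
    by (rule ennreal_mult[symmetric]) (use c nn in auto)
  finally show ?thesis by (simp add: mult_left_mono)
qed

text \<open>The supremum has to be finite for every sample, because small \<open>n\<close> are
  handled by the tightness of a single finite random variable. Off the good event the estimator is 0
  and the mass of the orthant is controlled through the integral of
  \<open>c / (cross_weight u)^2\<close>.\<close>

lemma est_bounded:
  assumes h: "0 < h"
  shows "\<exists>D. \<forall>p\<in>pointed_quadrant. norm_weight p * cmod (complex_of_real (measure \<nu> (upper_orthant p)) - N_hat K \<phi> h n x p) \<le> D"
proof (cases "good_event \<phi> h n x")
  case True
  let ?R = "ennreal 32768 * (ennreal (c * (8 * (L * h * ln (1 + 1 / h) + 2 * h))) + stochastic_error h x n)"
  have "?R < \<infinity>" using stochastic_error_finite[OF h True] by (simp add: ennreal_mult_less_top)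
  then obtain r where R: "?R = ennreal r" "0 \<le> r" by (cases ?R) auto
  have "norm_weight p * cmod (complex_of_real (measure \<nu> (upper_orthant p)) - N_hat K \<phi> h n x p) \<le> r" if "p \<in> pointed_quadrant" for p
    using est_error[OF h True that] R by (simp del: ennreal_plus)
  then show ?thesis by blast
next
  case False
  let ?R = "ennreal 32768 * (\<integral>\<^sup>+u. ennreal (cmod (fourier_measure \<mu> u) / cross_weight u) \<partial>lborel)"
  have "(\<integral>\<^sup>+u. ennreal (cmod (fourier_measure \<mu> u) / cross_weight u) \<partial>lborel) \<le> (\<integral>\<^sup>+u. ennreal (c * (1 / (cross_weight u)\<^sup>2)) \<partial>lborel)"
  proof (intro nn_integral_mono ennreal_leI)
    fix u
    have "cmod (fourier_measure \<mu> u) / cross_weight u \<le> (c / cross_weight u) / cross_weight u" by (intro divide_right_mono decay less_imp_le[OF cross_weight_pos])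
    then show "cmod (fourier_measure \<mu> u) / cross_weight u \<le> c * (1 / (cross_weight u)\<^sup>2)" by (simp add: power2_eq_square)
  qed
  also have "\<dots> = ennreal (\<integral>u. c * (1 / (cross_weight u)\<^sup>2) \<partial>lborel)"
    by (rule nn_integral_eq_integral[OF integrable_mult_right[OF integrable_inverse_cross_weight_sq]]) (use c in auto)
  finally have "?R < \<infinity>" by (simp add: ennreal_mult_less_top le_less_trans)
  then obtain r where R: "?R = ennreal r" "0 \<le> r" by (cases ?R) auto
  have "norm_weight p * cmod (complex_of_real (measure \<nu> (upper_orthant p)) - N_hat K \<phi> h n x p) \<le> r" if p: "p \<in> pointed_quadrant" for p
  proof -
    have "N_hat K \<phi> h n x p = 0" using False by (simp add: N_hat_def)
    then show ?thesis
      using norm_weight_fourier_le[OF p measurable_Fmu] unfolding measure_orthant_parseval[OF p, symmetric] R(1)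
      using R(2) by simp
  qed
  then show ?thesis by blast
qed

end

subsection \<open>Measurability of the supremum\<close>

lemma measurable_pair_emp_moment:
  assumes Y [measurable]: "\<And>t. (\<lambda>\<omega>. Y \<omega> t) \<in> borel_measurable M" and u: "u \<in> borel_measurable N"
  shows "(\<lambda>z. emp_moment (Y (fst z)) n k j (u (snd z))) \<in> borel_measurable (M \<Otimes>\<^sub>M N)"
proof -
  have [measurable]: "u \<in> borel_measurable N" by (rule u)
  have "(\<lambda>z. incr (Y (fst z)) t) \<in> borel_measurable (M \<Otimes>\<^sub>M N)" for t
    unfolding incr_def by measurable
  note [measurable] = this
  show ?thesis unfolding emp_moment_def by measurable
qed

lemma measurable_pair_psi4:
  assumes Y: "\<And>t. (\<lambda>\<omega>. Y \<omega> t) \<in> borel_measurable M" and u: "u \<in> borel_measurable N"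
  shows "(\<lambda>z. psi4 k (Y (fst z)) n (u (snd z))) \<in> borel_measurable (M \<Otimes>\<^sub>M N)"
proof -
  note [measurable] = measurable_pair_emp_moment[OF Y u]
  show ?thesis unfolding psi4_cumulant4 cumulant4_def by measurable
qed

lemma g_fun_mono_left:
  assumes "p' $ 1 \<le> p $ 1" "p' $ 2 \<le> p $ 2"
  shows "g_fun p x \<le> g_fun p' x"
proof -
  have "indicator (upper_orthant p) x \<le> (indicator (upper_orthant p') x :: real)"
    by (rule indicator_leI) (use assms in \<open>auto simp: upper_orthant_def\<close>)
  then show ?thesis unfolding g_fun_def by (rule divide_right_mono) simp
qed

text \<open>Rational points below \<open>p\<close>; at \<open>n = 0\<close> division by zero gives
  the origin.\<close>

definition left_approx :: "real^2 \<Rightarrow> nat \<Rightarrow> real^2" where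
  "left_approx p n = vec2 (of_int \<lfloor>real n * p $ 1\<rfloor> / real n, of_int \<lfloor>real n * p $ 2\<rfloor> / real n)"

text \<open>The eventual lower bound \<open>a / 2\<close> keeps the approximations away from the
  origin, so that they stay in the index set and share one majorant.\<close>

lemma floor_approx:
  fixes a :: real
  assumes a: "0 \<le> a"
  shows "of_int \<lfloor>real n * a\<rfloor> / real n \<le> a" "0 \<le> of_int \<lfloor>real n * a\<rfloor> / real n"
    "(\<lambda>n. of_int \<lfloor>real n * a\<rfloor> / real n) \<longlonglongrightarrow> a"
    "eventually (\<lambda>n. a / 2 \<le> of_int \<lfloor>real n * a\<rfloor> / real n) sequentially"
proof -
  show le: "of_int \<lfloor>real n * a\<rfloor> / real n \<le> a" for n
  proof (cases "n = 0")
    case False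
    have "of_int \<lfloor>real n * a\<rfloor> / real n \<le> real n * a / real n" by (rule divide_right_mono) auto
    then show ?thesis using False by simp
  qed (use a in simp)
  show "0 \<le> of_int \<lfloor>real n * a\<rfloor> / real n" using a by simp
  have ge: "a - 1 / real n \<le> of_int \<lfloor>real n * a\<rfloor> / real n" if "0 < n" for n
  proof -
    have "real n * a - 1 \<le> of_int \<lfloor>real n * a\<rfloor>" by linarith
    then have "(real n * a - 1) / real n \<le> of_int \<lfloor>real n * a\<rfloor> / real n" by (rule divide_right_mono) simp
    then show ?thesis using that by (simp add: diff_divide_distrib)
  qed
  have "(\<lambda>n. a - 1 / real n) \<longlonglongrightarrow> a - 0"
    by (intro tendsto_diff tendsto_const lim_1_over_n)
  then have lim0: "(\<lambda>n. a - 1 / real n) \<longlonglongrightarrow> a" by simp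
  show lim: "(\<lambda>n. of_int \<lfloor>real n * a\<rfloor> / real n) \<longlonglongrightarrow> a"
  proof (rule tendsto_sandwich[OF _ _ _ tendsto_const[of a]])
    show "eventually (\<lambda>n. a - 1 / real n \<le> of_int \<lfloor>real n * a\<rfloor> / real n) sequentially"
      using ge by (intro eventually_sequentiallyI[of 1]) simp
  qed (use le lim0 in simp_all)
  show "eventually (\<lambda>n. a / 2 \<le> of_int \<lfloor>real n * a\<rfloor> / real n) sequentially"
  proof (cases "a = 0")
    case False
    then have "a / 2 < a" using a by simp
    from order_tendstoD(1)[OF lim this] show ?thesis by eventually_elim simp
  qed simp
qed

context levy_est
begin

definition weighted_error :: "real \<Rightarrow> nat \<Rightarrow> (nat \<Rightarrow> real^2) \<Rightarrow> real^2 \<Rightarrow> real" where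
  "weighted_error h n x p = norm_weight p * cmod (complex_of_real (measure \<nu> (upper_orthant p)) - N_hat K \<phi> h n x p)"

text \<open>The orthants are closed, so everything is left continuous in \<open>p\<close>; together with rational
  approximation from below this makes the supremum a countable one.\<close>

lemma weighted_error_left_limit:
  assumes h: "0 < h" and p: "p \<in> pointed_quadrant"
    and q: "\<And>n. q n \<in> pointed_quadrant" "\<And>n. q n $ 1 \<le> p $ 1" "\<And>n. q n $ 2 \<le> p $ 2"
    "\<And>n. p $ 1 / 2 \<le> q n $ 1" "\<And>n. p $ 2 / 2 \<le> q n $ 2"
    and lim: "(\<lambda>n. q n $ 1) \<longlonglongrightarrow> p $ 1" "(\<lambda>n. q n $ 2) \<longlonglongrightarrow> p $ 2"
  shows "(\<lambda>m. weighted_error h n x (q m)) \<longlonglongrightarrow> weighted_error h n x p"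
proof -
  interpret mu: finite_measure \<mu> by (rule finite_mu)
  \<comment> \<open>\<open>g_fun\<close> decreases in \<open>p\<close>, so this point below all
    approximations gives one majorant, bounded and integrable, for both limits.\<close>
  let ?p2 = "(1 / 2) *\<^sub>R p"
  have p2: "?p2 \<in> pointed_quadrant" using p by (auto simp: pointed_quadrant_def)
  have dom: "g_fun (q m) y \<le> g_fun ?p2 y" for m y by (rule g_fun_mono_left) (use q in auto)
  \<comment> \<open>A point of the closed orthant at \<open>p\<close> lies in every orthant at
    \<open>q m\<close>; a point outside falls short strictly in one coordinate and drops out
    eventually.\<close>
  have lim_g: "(\<lambda>m. g_fun (q m) y) \<longlonglongrightarrow> g_fun p y" for y
  proof (cases "y \<in> upper_orthant p")
    case True
    then have "y \<in> upper_orthant (q m)" for m using q(2,3)[of m] by (auto simp: upper_orthant_def)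
    with True show ?thesis by (simp add: g_fun_def)
  next
    case False
    then obtain k where k: "y $ k < p $ k" by (auto simp: upper_orthant_def not_le)
    have "(\<lambda>m. q m $ k) \<longlonglongrightarrow> p $ k" using lim exhaust_2[of k] by auto
    from order_tendstoD(1)[OF this k]
    have "eventually (\<lambda>m. g_fun (q m) y = g_fun p y) sequentially"
    proof eventually_elim
      case (elim m)
      then have "y \<notin> upper_orthant (q m)" using exhaust_2[of k] by (auto simp: upper_orthant_def)
      with False show ?case by (simp add: g_fun_def)
    qed
    then show ?thesis by (rule tendsto_eventually)
  qed
  have "(\<lambda>m. \<integral>y. g_fun (q m) y \<partial>\<mu>) \<longlonglongrightarrow> (\<integral>y. g_fun p y \<partial>\<mu>)"
  proof (rule integral_dominated_convergence[where w = "\<lambda>_. 4 / (max_coord ?p2)^4"])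
    show "integrable \<mu> (\<lambda>_. 4 / (max_coord ?p2)^4)" by (rule mu.integrable_const)
    show "AE y in \<mu>. norm (g_fun (q m) y) \<le> 4 / (max_coord ?p2)^4" for m
      using order_trans[OF dom g_fun_le[OF p2]] g_fun_nonneg by (intro AE_I2) auto
  qed (use lim_g in \<open>auto simp: measurable_cong_sets[OF sets_mu refl]\<close>)
  then have L1: "(\<lambda>m. measure \<nu> (upper_orthant (q m))) \<longlonglongrightarrow> measure \<nu> (upper_orthant p)"
    by (simp only: integral_g_fun_mu[OF p] integral_g_fun_mu[OF q(1)])
  have L2: "(\<lambda>m. N_hat K \<phi> h n x (q m)) \<longlonglongrightarrow> N_hat K \<phi> h n x p"
  proof (cases "good_event \<phi> h n x")
    case True
    have [measurable]: "inv_fourier (smoothed_psi4 h n x) \<in> borel_measurable borel"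
      by (rule measurable_inv_fourier[OF measurable_smoothed_psi4[OF h]])
    define B where "B = (\<integral>u. cmod (smoothed_psi4 h n x u) \<partial>lborel)"
    have B: "cmod (inv_fourier (smoothed_psi4 h n x) y) \<le> B" for y
    proof -
      have "cmod (inv_fourier (smoothed_psi4 h n x) y) = (1 / (2 * pi)\<^sup>2) * cmod (\<integral>u. iexp (- (u \<bullet> y)) * smoothed_psi4 h n x u \<partial>lborel)"
        by (simp add: inv_fourier_def norm_mult norm_divide norm_power)
      also have "\<dots> \<le> 1 * (\<integral>u. cmod (iexp (- (u \<bullet> y)) * smoothed_psi4 h n x u) \<partial>lborel)"
        by (intro mult_mono inverse_four_pi_sq_le_1 integral_norm_bound) auto
      finally show ?thesis by (simp add: norm_mult B_def)
    qed
    have "(\<lambda>m. \<integral>y. complex_of_real (g_fun (q m) y) * inv_fourier (smoothed_psi4 h n x) y \<partial>lborel) \<longlonglongrightarrow>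
      (\<integral>y. complex_of_real (g_fun p y) * inv_fourier (smoothed_psi4 h n x) y \<partial>lborel)"
    proof (rule integral_dominated_convergence[where w = "\<lambda>y. g_fun ?p2 y * B"])
      show "integrable lborel (\<lambda>y. g_fun ?p2 y * B)" using g_fun_integrable[OF p2] by simp
      show "AE y in lborel. norm (complex_of_real (g_fun (q m) y) * inv_fourier (smoothed_psi4 h n x) y) \<le> g_fun ?p2 y * B" for m
        unfolding norm_mult by (intro AE_I2 mult_mono B) (use dom g_fun_nonneg in auto)
      show "AE y in lborel. (\<lambda>m. complex_of_real (g_fun (q m) y) * inv_fourier (smoothed_psi4 h n x) y) \<longlonglongrightarrow> complex_of_real (g_fun p y) * inv_fourier (smoothed_psi4 h n x) y"
        by (intro AE_I2 tendsto_mult tendsto_of_real tendsto_const lim_g)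
    qed auto
    then show ?thesis using True by (simp add: N_hat_def smoothed_psi4_def[abs_def])
  qed (simp add: N_hat_def)
  have "q \<longlonglongrightarrow> p"
  proof (rule vec_tendstoI)
    fix i show "(\<lambda>m. q m $ i) \<longlonglongrightarrow> p $ i" using lim exhaust_2[of i] by auto
  qed
  then have L3: "(\<lambda>m. norm_weight (q m)) \<longlonglongrightarrow> norm_weight p" unfolding norm_weight_def by (intro tendsto_intros)
  show ?thesis unfolding weighted_error_def by (intro tendsto_mult L3 tendsto_norm tendsto_diff tendsto_of_real L1 L2)
qed

definition rational_quadrant :: "(real^2) set" where
  "rational_quadrant = {p \<in> pointed_quadrant. p $ 1 \<in> \<rat> \<and> p $ 2 \<in> \<rat>}"

lemma countable_rational_quadrant: "countable rational_quadrant"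
proof -
  have "rational_quadrant \<subseteq> vec2 ` (\<rat> \<times> \<rat>)"
  proof
    fix p assume "p \<in> rational_quadrant"
    then have "(p $ 1, p $ 2) \<in> \<rat> \<times> \<rat>" by (auto simp: rational_quadrant_def)
    then show "p \<in> vec2 ` (\<rat> \<times> \<rat>)" using vec2_eta[of p] by (metis imageI)
  qed
  then show ?thesis by (rule countable_subset) (intro countable_image countable_SIGMA countable_rat)
qed

lemma SUP_weighted_error_rational:
  assumes h: "0 < h"
  shows "(SUP p\<in>pointed_quadrant. ereal (weighted_error h n x p)) = (SUP p\<in>rational_quadrant. ereal (weighted_error h n x p))"
proof (rule antisym)
  show "(SUP p\<in>rational_quadrant. ereal (weighted_error h n x p)) \<le> (SUP p\<in>pointed_quadrant. ereal (weighted_error h n x p))"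
    by (rule SUP_subset_mono) (auto simp: rational_quadrant_def)
  show "(SUP p\<in>pointed_quadrant. ereal (weighted_error h n x p)) \<le> (SUP p\<in>rational_quadrant. ereal (weighted_error h n x p))"
  proof (rule SUP_least)
    fix p :: "real^2" assume p: "p \<in> pointed_quadrant"
    then have nn: "0 \<le> p $ 1" "0 \<le> p $ 2" by (auto simp: pointed_quadrant_def)
    have "eventually (\<lambda>n. p $ 1 / 2 \<le> left_approx p n $ 1 \<and> p $ 2 / 2 \<le> left_approx p n $ 2) sequentially"
      using floor_approx(4)[OF nn(1)] floor_approx(4)[OF nn(2)]
      by eventually_elim (simp add: left_approx_def)
    then obtain m0 where m0: "\<And>m. m0 \<le> m \<Longrightarrow> p $ 1 / 2 \<le> left_approx p m $ 1 \<and> p $ 2 / 2 \<le> left_approx p m $ 2"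
      by (auto simp: eventually_sequentially)
    let ?q = "\<lambda>m. left_approx p (m + m0)"
    have half: "p $ 1 / 2 \<le> ?q m $ 1" "p $ 2 / 2 \<le> ?q m $ 2" for m using m0[of "m + m0"] by auto
    have le: "?q m $ 1 \<le> p $ 1" "?q m $ 2 \<le> p $ 2" for m
      using floor_approx(1)[OF nn(1), of "m + m0"] floor_approx(1)[OF nn(2), of "m + m0"] by (auto simp: left_approx_def)
    have pq: "?q m \<in> pointed_quadrant" for m
    proof -
      have "?q m \<noteq> 0"
      proof
        assume "?q m = 0"
        then have "p $ 1 \<le> 0" "p $ 2 \<le> 0" using half[of m] by auto
        then show False using nn p by (auto simp: pointed_quadrant_def vec_eq_iff forall_2)
      qed
      then show ?thesis using half[of m] nn by (auto simp: pointed_quadrant_def)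
    qed
    have lim: "(\<lambda>m. ?q m $ 1) \<longlonglongrightarrow> p $ 1" "(\<lambda>m. ?q m $ 2) \<longlonglongrightarrow> p $ 2"
      using LIMSEQ_ignore_initial_segment[OF floor_approx(3)[OF nn(1)], of m0]
        LIMSEQ_ignore_initial_segment[OF floor_approx(3)[OF nn(2)], of m0]
      by (simp_all add: left_approx_def)
    have rat: "?q m \<in> rational_quadrant" for m
      using pq[of m] by (auto simp: rational_quadrant_def left_approx_def)
    have "(\<lambda>m. weighted_error h n x (?q m)) \<longlonglongrightarrow> weighted_error h n x p"
      by (rule weighted_error_left_limit[OF h p pq le half lim])
    then have "(\<lambda>m. ereal (weighted_error h n x (?q m))) \<longlonglongrightarrow> ereal (weighted_error h n x p)" by simp
    then show "ereal (weighted_error h n x p) \<le> (SUP p\<in>rational_quadrant. ereal (weighted_error h n x p))"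
      by (rule LIMSEQ_le_const2) (intro exI[of _ 0] allI impI SUP_upper rat)
  qed
qed

lemma continuous_levy_char: "continuous_on UNIV \<phi>"
proof -
  have "(2 * \<bar>quartic_moment P\<bar>)-lipschitz_on UNIV \<phi>"
  proof (rule lipschitz_onI)
    fix u v
    have "cmod (\<phi> u - \<phi> v) \<le> 2 * quartic_moment P * norm (u - v)" by (rule levy_char_lipschitz)
    also have "\<dots> \<le> 2 * \<bar>quartic_moment P\<bar> * norm (u - v)" by (intro mult_right_mono mult_left_mono) auto
    finally show "dist (\<phi> u) (\<phi> v) \<le> 2 * \<bar>quartic_moment P\<bar> * dist u v" by (simp add: dist_norm)
  qed simp
  then show ?thesis by (rule lipschitz_on_continuous_on)
qed

text \<open>The event consists of uncountably many strict inequalities. On the compact square the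
  continuous difference attains its minimum, so the event is the union over \<open>k\<close> of the
  conditions that the difference is at least \<open>1 / (k + 1)\<close>, and such a closed condition
  can be tested on a countable dense set.\<close>

lemma good_event_measurable:
  assumes Y [measurable]: "\<And>t. (\<lambda>\<omega>. Y \<omega> t) \<in> borel_measurable M" and h: "0 < h"
  shows "{\<omega> \<in> space M. good_event \<phi> h n (Y \<omega>)} \<in> sets M"
proof -
  let ?f = "\<lambda>\<omega> u. cmod (emp_char (Y \<omega>) n u) - cmod (\<phi> u) / 2"
  let ?S = "square (1 / h)"
  obtain D where D: "countable D" "D \<subseteq> ?S" "?S \<subseteq> closure D" using separable by blast
  have cont: "continuous_on UNIV (?f \<omega>)" for \<omega>
    unfolding emp_moment_0[of _ _ 1, symmetric]
    by (intro continuous_intros continuous_emp_moment continuous_levy_char) auto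
  have ne: "?S \<noteq> {}" using h by (auto simp: square_def intro!: exI[of _ 0])
  have eq: "good_event \<phi> h n (Y \<omega>) \<longleftrightarrow> (\<exists>k::nat. \<forall>u\<in>D. inverse (real (Suc k)) \<le> ?f \<omega> u)" for \<omega>
  proof
    assume g: "good_event \<phi> h n (Y \<omega>)"
    obtain w where w: "w \<in> ?S" "\<And>u. u \<in> ?S \<Longrightarrow> ?f \<omega> w \<le> ?f \<omega> u"
      using continuous_attains_inf[OF compact_square ne continuous_on_subset[OF cont subset_UNIV]] by blast
    have "0 < ?f \<omega> w" using g w(1) by (auto simp: good_event_def)
    then obtain k where "inverse (real (Suc k)) < ?f \<omega> w" using reals_Archimedean by blast
    note k = this
    show "\<exists>k::nat. \<forall>u\<in>D. inverse (real (Suc k)) \<le> ?f \<omega> u"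
    proof (intro exI[of _ k] ballI)
      fix u assume "u \<in> D"
      then have "?f \<omega> w \<le> ?f \<omega> u" using w(2) D(2) by blast
      with k show "inverse (real (Suc k)) \<le> ?f \<omega> u" by linarith
    qed
  next
    assume "\<exists>k::nat. \<forall>u\<in>D. inverse (real (Suc k)) \<le> ?f \<omega> u"
    then obtain k :: nat where k: "\<And>u. u \<in> D \<Longrightarrow> inverse (real (Suc k)) \<le> ?f \<omega> u" by blast
    have "closed {u. inverse (real (Suc k)) \<le> ?f \<omega> u}"
      by (intro closed_Collect_le continuous_on_const cont)
    then have "closure D \<subseteq> {u. inverse (real (Suc k)) \<le> ?f \<omega> u}"
      by (rule closure_minimal[rotated]) (use k in auto)
    then have ge: "inverse (real (Suc k)) \<le> ?f \<omega> u" if "u \<in> ?S" for u using D(3) that by blast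
    have pos: "0 < inverse (real (Suc k))" by simp
    have "0 < ?f \<omega> u" if "u \<in> ?S" for u using less_le_trans[OF pos ge[OF that]] .
    then show "good_event \<phi> h n (Y \<omega>)" by (auto simp: good_event_def)
  qed
  have [measurable]: "(\<lambda>\<omega>. incr (Y \<omega>) t) \<in> borel_measurable M" for t unfolding incr_def by measurable
  have [measurable]: "(\<lambda>\<omega>. emp_char (Y \<omega>) n u) \<in> borel_measurable M" for u
    unfolding emp_moment_0[of _ _ 1, symmetric] emp_moment_def by measurable
  have "{\<omega> \<in> space M. good_event \<phi> h n (Y \<omega>)} = (\<Union>k::nat. {\<omega> \<in> space M. \<forall>u\<in>D. inverse (real (Suc k)) \<le> ?f \<omega> u})"
    unfolding eq by auto
  also have "\<dots> \<in> sets M"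
  proof (rule sets.countable_UN, rule image_subsetI)
    fix k :: nat
    show "{\<omega> \<in> space M. \<forall>u\<in>D. inverse (real (Suc k)) \<le> ?f \<omega> u} \<in> sets M"
      by (rule sets.sets_Collect_countable_All'[OF _ D(1)]) measurable
  qed
  finally show ?thesis .
qed

lemma N_hat_smoothed_psi4: "N_hat K \<phi> h n x p =
    (if good_event \<phi> h n x then \<integral>y. complex_of_real (g_fun p y) * inv_fourier (smoothed_psi4 h n x) y \<partial>lborel else 0)"
proof -
  have "smoothed_psi4 h n x = (\<lambda>u. indicator (square (1 / h)) u * ((psi4 1 x n u + psi4 2 x n u) *
      fourier (\<lambda>z. complex_of_real (kernel_scale K h z)) u))"
    by (rule ext) (rule smoothed_psi4_def)
  then show ?thesis by (simp only: N_hat_def)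
qed

text \<open>Joint measurability in sample point, space variable and frequency, followed by two
  integrals with parameters.\<close>

lemma N_hat_measurable:
  assumes Y: "\<And>t. (\<lambda>\<omega>. Y \<omega> t) \<in> borel_measurable M" and h: "0 < h"
  shows "(\<lambda>\<omega>. N_hat K \<phi> h n (Y \<omega>) p) \<in> borel_measurable M"
proof -
  have 1: "(\<lambda>z. psi4 k (Y (fst (fst z))) n (snd z)) \<in> borel_measurable ((M \<Otimes>\<^sub>M (lborel :: (real^2) measure)) \<Otimes>\<^sub>M lborel)" for k
  proof -
    have "(\<lambda>\<omega>. Y (fst \<omega>) t) \<in> borel_measurable (M \<Otimes>\<^sub>M (lborel :: (real^2) measure))" for t
      using measurable_compose[OF measurable_fst Y] .
    from measurable_pair_psi4[of "\<lambda>\<omega>. Y (fst \<omega>)", OF this, where u = "\<lambda>u. u" and N = lborel and k = k and n = n] show ?thesis by simp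
  qed
  note [measurable] = this
  have 2: "(\<lambda>z. \<integral>u. iexp (- (u \<bullet> snd z)) * (indicator (square (1 / h)) u * ((psi4 1 (Y (fst z)) n u + psi4 2 (Y (fst z)) n u) * FK (h *\<^sub>R u))) \<partial>lborel) \<in> borel_measurable (M \<Otimes>\<^sub>M lborel)"
    by (rule lborel.borel_measurable_lebesgue_integral) (simp add: case_prod_beta', measurable)
  have 3: "(\<lambda>\<omega>. \<integral>y. complex_of_real (g_fun p y) * inv_fourier (smoothed_psi4 h n (Y \<omega>)) y \<partial>lborel) \<in> borel_measurable M"
  proof (rule lborel.borel_measurable_lebesgue_integral)
    show "(\<lambda>(\<omega>, y). complex_of_real (g_fun p y) * inv_fourier (smoothed_psi4 h n (Y \<omega>)) y) \<in> borel_measurable (M \<Otimes>\<^sub>M lborel)"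
      unfolding inv_fourier_def smoothed_psi4_FK[OF h] case_prod_beta'
      by (intro borel_measurable_times 2 borel_measurable_const) measurable
  qed
  show ?thesis
    unfolding N_hat_smoothed_psi4 by (rule measurable_If[OF 3 _ good_event_measurable[OF Y h]]) simp
qed

lemma SUP_weighted_error_measurable:
  assumes Y: "\<And>t. (\<lambda>\<omega>. Y \<omega> t) \<in> borel_measurable M" and h: "0 < h"
  shows "(\<lambda>\<omega>. SUP p\<in>pointed_quadrant. ereal (weighted_error h n (Y \<omega>) p)) \<in> borel_measurable M"
  unfolding SUP_weighted_error_rational[OF h]
proof (rule borel_measurable_SUP[OF countable_rational_quadrant])
  fix p
  have [measurable]: "(\<lambda>\<omega>. N_hat K \<phi> h n (Y \<omega>) p) \<in> borel_measurable M" by (rule N_hat_measurable[OF Y h])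
  show "(\<lambda>\<omega>. ereal (weighted_error h n (Y \<omega>) p)) \<in> borel_measurable M" unfolding weighted_error_def by measurable
qed

end

subsection \<open>Deviation of the empirical moments\<close>

lemma (in prob_space) integral_mult_indep_vars:
  fixes D :: "nat \<Rightarrow> 'a \<Rightarrow> real^2" and f g :: "real^2 \<Rightarrow> complex"
  assumes ind: "indep_vars (\<lambda>_. borel) D I" and st: "s \<in> I" "t \<in> I" "s \<noteq> t"
    and [measurable]: "f \<in> borel_measurable borel" "g \<in> borel_measurable borel"
    and int: "integrable M (\<lambda>\<omega>. f (D s \<omega>))" "integrable M (\<lambda>\<omega>. g (D t \<omega>))"
  shows "(\<integral>\<omega>. f (D s \<omega>) * g (D t \<omega>) \<partial>M) = (\<integral>\<omega>. f (D s \<omega>) \<partial>M) * (\<integral>\<omega>. g (D t \<omega>) \<partial>M)"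
    and "integrable M (\<lambda>\<omega>. f (D s \<omega>) * g (D t \<omega>))"
proof -
  have "indep_vars (\<lambda>_. borel) D {s, t}"
    using ind by (rule indep_vars_subset) (use st in auto)
  then have iv: "indep_vars (\<lambda>_. borel) (\<lambda>i \<omega>. (if i = s then f else g) (D i \<omega>)) {s, t}"
    by (rule indep_vars_compose2) auto
  have i: "\<And>i. i \<in> {s, t} \<Longrightarrow> integrable M (\<lambda>\<omega>. (if i = s then f else g) (D i \<omega>))"
    using int st by auto
  note res = indep_vars_lebesgue_integral[OF _ iv i] indep_vars_integrable[OF _ iv i]
  show "(\<integral>\<omega>. f (D s \<omega>) * g (D t \<omega>) \<partial>M) = (\<integral>\<omega>. f (D s \<omega>) \<partial>M) * (\<integral>\<omega>. g (D t \<omega>) \<partial>M)"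
    using res(1) st by simp
  show "integrable M (\<lambda>\<omega>. f (D s \<omega>) * g (D t \<omega>))"
    using res(2) st by simp
qed

text \<open>The variance of an average: independence removes the mixed terms of the double sum, and
  centring can only lower the second moment of each diagonal term. The independent family is indexed
  from 0 and the sum from 1, hence \<open>Suc\<close>.\<close>

lemma (in prob_space) mean_square_deviation:
  fixes D :: "nat \<Rightarrow> 'a \<Rightarrow> real^2" and f :: "real^2 \<Rightarrow> complex"
  assumes ind: "indep_vars (\<lambda>_. borel) (\<lambda>i. D (Suc i)) {..<n}" and n: "1 \<le> n"
    and [measurable]: "f \<in> borel_measurable borel"
    and int: "\<And>t. t \<in> {1..n} \<Longrightarrow> integrable M (\<lambda>\<omega>. f (D t \<omega>))"
    and mean: "\<And>t. t \<in> {1..n} \<Longrightarrow> (\<integral>\<omega>. f (D t \<omega>) \<partial>M) = m"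
    and int2: "\<And>t. t \<in> {1..n} \<Longrightarrow> integrable M (\<lambda>\<omega>. (cmod (f (D t \<omega>)))\<^sup>2)"
    and second: "\<And>t. t \<in> {1..n} \<Longrightarrow> (\<integral>\<omega>. (cmod (f (D t \<omega>)))\<^sup>2 \<partial>M) \<le> V"
  shows "(\<integral>\<^sup>+\<omega>. ennreal ((cmod ((\<Sum>t=1..n. f (D t \<omega>)) / of_nat n - m))\<^sup>2) \<partial>M) \<le> ennreal (V / real n)"
proof -
  define g where "g t \<omega> = f (D t \<omega>) - m" for t \<omega>
  have Dm [measurable]: "random_variable borel (D t)" if "t \<in> {1..n}" for t
  proof -
    have "random_variable borel (D (Suc (t - 1)))" 
    proof -
      have "t - 1 \<in> {..<n}" using that by auto
      then show ?thesis using ind unfolding indep_vars_def by blast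
    qed
    then show ?thesis using that by simp
  qed
  have gm: "random_variable borel (g t)" if "t \<in> {1..n}" for t
    unfolding g_def using Dm[OF that] by measurable
  have gi: "integrable M (g t)" "(\<integral>\<omega>. g t \<omega> \<partial>M) = 0" if "t \<in> {1..n}" for t
    using int[OF that] mean[OF that] by (auto simp: g_def[abs_def] prob_space)
  have diag: "integrable M (\<lambda>\<omega>. g t \<omega> * cnj (g t \<omega>)) \<and> Re (\<integral>\<omega>. g t \<omega> * cnj (g t \<omega>) \<partial>M) \<le> V" if t: "t \<in> {1..n}" for t
  proof -
    have i1: "integrable M (\<lambda>\<omega>. complex_of_real ((cmod (f (D t \<omega>)))\<^sup>2))" using int2[OF t] by (rule integrable_of_real)
    have eq: "g t \<omega> * cnj (g t \<omega>) = complex_of_real ((cmod (f (D t \<omega>)))\<^sup>2) - f (D t \<omega>) * cnj m - m * cnj (f (D t \<omega>)) + m * cnj m" for \<omega>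
      unfolding complex_norm_square by (simp add: g_def algebra_simps)
    have ic: "integrable M (\<lambda>\<omega>. f (D t \<omega>) * cnj m)" "integrable M (\<lambda>\<omega>. m * cnj (f (D t \<omega>)))"
      using int[OF t] by auto
    have "(\<integral>\<omega>. g t \<omega> * cnj (g t \<omega>) \<partial>M) = complex_of_real (\<integral>\<omega>. (cmod (f (D t \<omega>)))\<^sup>2 \<partial>M) - m * cnj m - m * cnj m + m * cnj m"
      unfolding eq using i1 ic int[OF t] mean[OF t] integral_complex_of_real[of M "\<lambda>\<omega>. (cmod (f (D t \<omega>)))\<^sup>2"]
      by (simp add: prob_space del: of_real_power)
    then have "Re (\<integral>\<omega>. g t \<omega> * cnj (g t \<omega>) \<partial>M) = (\<integral>\<omega>. (cmod (f (D t \<omega>)))\<^sup>2 \<partial>M) - (Re m * Re m + Im m * Im m)"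
      by simp
    moreover have "0 \<le> Re m * Re m + Im m * Im m" by simp
    ultimately have "Re (\<integral>\<omega>. g t \<omega> * cnj (g t \<omega>) \<partial>M) \<le> V" using second[OF t] by linarith
    moreover have "integrable M (\<lambda>\<omega>. g t \<omega> * cnj (g t \<omega>))" unfolding eq using i1 ic by simp
    ultimately show ?thesis by simp
  qed
  have off: "integrable M (\<lambda>\<omega>. g s \<omega> * cnj (g t \<omega>)) \<and> (\<integral>\<omega>. g s \<omega> * cnj (g t \<omega>) \<partial>M) = 0" if st: "s \<in> {1..n}" "t \<in> {1..n}" "s \<noteq> t" for s t
  proof -
    have m1: "(\<lambda>x. f x - m) \<in> borel_measurable borel" by measurable
    have "cnj \<in> borel_measurable borel" by (intro borel_measurable_continuous_onI continuous_intros)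
    note f1 = m1 measurable_compose[OF m1 this]
    have i1: "integrable M (\<lambda>\<omega>. (\<lambda>x. f x - m) (D s \<omega>))" using gi(1)[OF st(1)] by (simp add: g_def[abs_def])
    have i2: "integrable M (\<lambda>\<omega>. (\<lambda>x. cnj (f x - m)) (D t \<omega>))"
      using gi(1)[OF st(2)] by (intro integrable_cnj) (simp add: g_def[abs_def])
    have st': "s - 1 \<in> {..<n}" "t - 1 \<in> {..<n}" "s - 1 \<noteq> t - 1" "Suc (s - 1) = s" "Suc (t - 1) = t"
      using st by auto
    note r = integral_mult_indep_vars[OF ind st'(1-3) f1, unfolded st'(4,5), OF i1 i2]
    show ?thesis using r gi(2)[OF st(1)] by (simp add: g_def[abs_def])
  qed
  have all: "integrable M (\<lambda>\<omega>. g s \<omega> * cnj (g t \<omega>))" if "s \<in> {1..n}" "t \<in> {1..n}" for s t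
    using diag off that by (cases "s = t") auto
  have sq: "complex_of_real ((cmod (\<Sum>t=1..n. g t \<omega>))\<^sup>2) = (\<Sum>s=1..n. \<Sum>t=1..n. g s \<omega> * cnj (g t \<omega>))" for \<omega>
    unfolding complex_norm_square by (simp add: sum_product cnj_sum)
  have iS: "integrable M (\<lambda>\<omega>. \<Sum>s=1..n. \<Sum>t=1..n. g s \<omega> * cnj (g t \<omega>))"
    by (intro Bochner_Integration.integrable_sum all)
  then have "integrable M (\<lambda>\<omega>. Re (complex_of_real ((cmod (\<Sum>t=1..n. g t \<omega>))\<^sup>2)))"
    unfolding sq by (rule integrable_Re)
  then have iR: "integrable M (\<lambda>\<omega>. (cmod (\<Sum>t=1..n. g t \<omega>))\<^sup>2)"
    by (simp only: Re_complex_of_real)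
  have "(\<integral>\<omega>. (cmod (\<Sum>t=1..n. g t \<omega>))\<^sup>2 \<partial>M) = Re (\<integral>\<omega>. complex_of_real ((cmod (\<Sum>t=1..n. g t \<omega>))\<^sup>2) \<partial>M)"
    by (subst integral_complex_of_real) simp
  also have "(\<integral>\<omega>. complex_of_real ((cmod (\<Sum>t=1..n. g t \<omega>))\<^sup>2) \<partial>M) = (\<Sum>s=1..n. \<Sum>t=1..n. \<integral>\<omega>. g s \<omega> * cnj (g t \<omega>) \<partial>M)"
  proof -
    have "(\<integral>\<omega>. (\<Sum>s=1..n. \<Sum>t=1..n. g s \<omega> * cnj (g t \<omega>)) \<partial>M) = (\<Sum>s=1..n. \<integral>\<omega>. (\<Sum>t=1..n. g s \<omega> * cnj (g t \<omega>)) \<partial>M)"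
      by (rule Bochner_Integration.integral_sum) (intro Bochner_Integration.integrable_sum all)
    also have "\<dots> = (\<Sum>s=1..n. \<Sum>t=1..n. \<integral>\<omega>. g s \<omega> * cnj (g t \<omega>) \<partial>M)"
      by (rule sum.cong[OF refl], rule Bochner_Integration.integral_sum, rule all)
    finally show ?thesis unfolding sq .
  qed
  also have "\<dots> = (\<Sum>s=1..n. \<integral>\<omega>. g s \<omega> * cnj (g s \<omega>) \<partial>M)"
  proof (intro sum.cong refl)
    fix s assume s: "s \<in> {1..n}"
    have "(\<Sum>t=1..n. \<integral>\<omega>. g s \<omega> * cnj (g t \<omega>) \<partial>M) = (\<Sum>t=1..n. if t = s then \<integral>\<omega>. g s \<omega> * cnj (g s \<omega>) \<partial>M else 0)"
      using off s by (intro sum.cong) auto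
    then show "(\<Sum>t=1..n. \<integral>\<omega>. g s \<omega> * cnj (g t \<omega>) \<partial>M) = (\<integral>\<omega>. g s \<omega> * cnj (g s \<omega>) \<partial>M)"
      using s by simp
  qed
  also have "Re \<dots> \<le> (\<Sum>s=1..n. V)" unfolding Re_sum by (intro sum_mono) (use diag in auto)
  finally have E: "(\<integral>\<omega>. (cmod (\<Sum>t=1..n. g t \<omega>))\<^sup>2 \<partial>M) \<le> real n * V" by simp
  have "(cmod ((\<Sum>t=1..n. f (D t \<omega>)) / of_nat n - m))\<^sup>2 = (1 / (real n)\<^sup>2) * (cmod (\<Sum>t=1..n. g t \<omega>))\<^sup>2" for \<omega>
  proof -
    have "(\<Sum>t=1..n. f (D t \<omega>)) / of_nat n - m = (\<Sum>t=1..n. g t \<omega>) / of_nat n"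
      using n by (simp add: g_def sum_subtractf diff_divide_distrib)
    then show ?thesis by (simp add: norm_divide power_divide)
  qed
  then have "(\<integral>\<^sup>+\<omega>. ennreal ((cmod ((\<Sum>t=1..n. f (D t \<omega>)) / of_nat n - m))\<^sup>2) \<partial>M) =
      (\<integral>\<^sup>+\<omega>. ennreal ((1 / (real n)\<^sup>2) * (cmod (\<Sum>t=1..n. g t \<omega>))\<^sup>2) \<partial>M)" by simp
  also have "\<dots> = ennreal (\<integral>\<omega>. (1 / (real n)\<^sup>2) * (cmod (\<Sum>t=1..n. g t \<omega>))\<^sup>2 \<partial>M)"
    by (rule nn_integral_eq_integral[OF integrable_mult_right[OF iR]]) auto
  also have "(\<integral>\<omega>. (1 / (real n)\<^sup>2) * (cmod (\<Sum>t=1..n. g t \<omega>))\<^sup>2 \<partial>M) \<le> (1 / (real n)\<^sup>2) * (real n * V)"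
    unfolding integral_mult_right_zero by (intro mult_left_mono E) simp
  also have "\<dots> = V / real n" using n by (simp add: power2_eq_square)
  finally show ?thesis by (simp add: ennreal_leI)
qed

text \<open>\<open>Y\<close> is set to 0 at time 0, whereas \<open>X 0\<close> vanishes only almost surely; hence the increments
  agree with the independent family \<open>D\<close> only almost surely.\<close>

locale iid_sample = levy_est \<Sigma> \<nu> \<alpha> P K L c C + M: prob_space M
  for \<Sigma> \<nu> \<alpha> P K L c C and M :: "'w measure" +
  fixes Y D :: "'w \<Rightarrow> nat \<Rightarrow> real^2"
  assumes Y_measurable [measurable]: "\<And>t. (\<lambda>\<omega>. Y \<omega> t) \<in> borel_measurable M"
    and D_AE: "\<And>t. 1 \<le> t \<Longrightarrow> AE \<omega> in M. incr (Y \<omega>) t = D \<omega> t"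
    and D_indep: "\<And>n. M.indep_vars (\<lambda>_. borel) (\<lambda>i \<omega>. D \<omega> (Suc i)) {..<n}"
    and D_distr: "\<And>t. 1 \<le> t \<Longrightarrow> distr M borel (\<lambda>\<omega>. D \<omega> t) = P"
begin

interpretation P: prob_space P by (rule prob_P)

text \<open>The summands of the empirical derivatives have squares
  \<open>\<bar>x $ k\<bar>^(2 * j)\<close> with \<open>j \<le> 4\<close>, all dominated by this
  integrand.\<close>

definition octic_moment :: real where "octic_moment = (\<integral>x. 1 + ((x $ 1)^8 + (x $ 2)^8) \<partial>P)"

lemma integrable_octic_moment: "integrable P (\<lambda>x. 1 + ((x $ 1)^8 + (x $ 2)^8))"
  using P_moment8[of 1] P_moment8[of 2] by simp

lemma octic_moment_nonneg: "0 \<le> octic_moment" unfolding octic_moment_def by (intro Bochner_Integration.integral_nonneg) auto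

lemma D_measurable: "1 \<le> t \<Longrightarrow> (\<lambda>\<omega>. D \<omega> t) \<in> borel_measurable M"
proof -
  assume t: "1 \<le> t"
  have "(\<lambda>\<omega>. D \<omega> (Suc (t - 1))) \<in> borel_measurable M"
    using D_indep[of t] t unfolding M.indep_vars_def by (meson diff_less lessThan_iff less_le_trans zero_less_one)
  then show ?thesis using t by simp
qed

lemma AE_incr: "AE \<omega> in M. \<forall>t\<in>{1..n}. incr (Y \<omega>) t = D \<omega> t"
  by (subst AE_ball_countable) (auto intro: D_AE)

lemma sq_deviation_expectation:
  assumes n: "1 \<le> n" and j: "j \<le> 4"
  shows "(\<integral>\<^sup>+\<omega>. ennreal ((cmod (emp_moment (Y \<omega>) n k j u - char_moment P k j u))\<^sup>2) \<partial>M) \<le> ennreal (octic_moment / real n)"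
proof -
  let ?f = "\<lambda>x :: real^2. (\<i> * complex_of_real (x $ k))^j * iexp (u \<bullet> x)"
  have [measurable]: "?f \<in> borel_measurable borel" by measurable
  have nf: "(cmod (?f x))\<^sup>2 = \<bar>x $ k\<bar>^(2 * j)" for x
    by (simp add: norm_mult norm_power power_mult[symmetric] mult.commute)
  have le8: "\<bar>x $ k\<bar>^(2 * j) \<le> 1 + ((x $ 1)^8 + (x $ 2)^8)" for x :: "real^2"
  proof -
    have "\<bar>x $ k\<bar>^(2 * j) \<le> 1 + (x $ k)^8"
    proof (cases "\<bar>x $ k\<bar> \<le> 1")
      case True
      then have "\<bar>x $ k\<bar>^(2 * j) \<le> 1" by (simp add: power_le_one)
      then show ?thesis by (simp add: add_increasing2)
    next
      case False
      then have "\<bar>x $ k\<bar>^(2 * j) \<le> \<bar>x $ k\<bar>^8" using j by (intro power_increasing) auto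
      then show ?thesis by simp
    qed
    also have "\<dots> \<le> 1 + ((x $ 1)^8 + (x $ 2)^8)" using exhaust_2[of k] by auto
    finally show ?thesis .
  qed
  have iP: "integrable P ?f" by (rule integrable_char_moment[OF sets_P P_moment]) (use j in simp)
  have iP2: "integrable P (\<lambda>x. (cmod (?f x))\<^sup>2)" unfolding nf by (rule P_moment) (use j in simp)
  have V: "(\<integral>x. (cmod (?f x))\<^sup>2 \<partial>P) \<le> octic_moment"
    unfolding octic_moment_def by (rule integral_mono[OF iP2 integrable_octic_moment]) (simp only: nf le8)
  have "(\<integral>\<^sup>+\<omega>. ennreal ((cmod (emp_moment (Y \<omega>) n k j u - char_moment P k j u))\<^sup>2) \<partial>M) =
    (\<integral>\<^sup>+\<omega>. ennreal ((cmod ((\<Sum>t=1..n. ?f (D \<omega> t)) / of_nat n - char_moment P k j u))\<^sup>2) \<partial>M)"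
  proof (rule nn_integral_cong_AE)
    show "AE \<omega> in M. ennreal ((cmod (emp_moment (Y \<omega>) n k j u - char_moment P k j u))\<^sup>2) =
        ennreal ((cmod ((\<Sum>t=1..n. ?f (D \<omega> t)) / of_nat n - char_moment P k j u))\<^sup>2)"
      using AE_incr[of n]
    proof eventually_elim
      case (elim \<omega>)
      have "(\<Sum>t=1..n. ?f (incr (Y \<omega>) t)) = (\<Sum>t=1..n. ?f (D \<omega> t))"
        by (rule sum.cong[OF refl]) (use elim in simp)
      then show ?case by (simp only: emp_moment_def)
    qed
  qed
  also have "\<dots> \<le> ennreal (octic_moment / real n)"
  proof (rule M.mean_square_deviation[OF D_indep n])
    fix t assume t: "t \<in> {1..n}"
    then have t1: "1 \<le> t" by simp
    note [measurable] = D_measurable[OF t1]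
    have d: "P = distr M borel (\<lambda>\<omega>. D \<omega> t)" using D_distr[OF t1] by simp
    show "integrable M (\<lambda>\<omega>. ?f (D \<omega> t))" using iP unfolding d by (subst (asm) integrable_distr_eq) auto
    show "(\<integral>\<omega>. ?f (D \<omega> t) \<partial>M) = char_moment P k j u" unfolding char_moment_def d by (subst integral_distr) auto
    show "integrable M (\<lambda>\<omega>. (cmod (?f (D \<omega> t)))\<^sup>2)" using iP2 unfolding d by (subst (asm) integrable_distr_eq) auto
    show "(\<integral>\<omega>. (cmod (?f (D \<omega> t)))\<^sup>2 \<partial>M) \<le> octic_moment" using V unfolding d by (subst (asm) integral_distr) auto
  qed measurable
  finally show ?thesis .
qed

lemma measurable_pair_sq_deviation:
  "(\<lambda>z. sq_deviation P (Y (fst z)) n (snd z)) \<in> borel_measurable (M \<Otimes>\<^sub>M lborel)"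
proof -
  have e: "(\<lambda>z. emp_moment (Y (fst z)) n k j (snd z)) \<in> borel_measurable (M \<Otimes>\<^sub>M lborel)" for k j
    by (rule measurable_pair_emp_moment[where u = "\<lambda>u. u"]) (rule Y_measurable, simp)
  have c: "(\<lambda>z. char_moment P k j (snd z)) \<in> borel_measurable (M \<Otimes>\<^sub>M lborel)" for k j
    by (rule measurable_compose[OF measurable_snd]) (simp add: measurable_char_moment_P)
  show ?thesis unfolding sq_deviation_def
    by (intro borel_measurable_sum borel_measurable_power measurable_compose[OF borel_measurable_diff[OF e c] borel_measurable_norm])
qed

lemma total_deviation_measurable: "(\<lambda>\<omega>. total_deviation P h (Y \<omega>) n) \<in> borel_measurable M"
proof -
  note [measurable] = measurable_pair_sq_deviation[of n]
  show ?thesis unfolding total_deviation_def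
    by (rule lborel.borel_measurable_nn_integral) (simp add: case_prod_beta', measurable)
qed

text \<open>Tonelli reduces the claim to the variance bound at each frequency; ten deviations and
  the area \<open>4 (1 / h + 1)^2\<close> give the factor 40.\<close>

lemma total_deviation_expectation:
  assumes n: "1 \<le> n" and h: "0 < h"
  shows "(\<integral>\<^sup>+\<omega>. total_deviation P h (Y \<omega>) n \<partial>M) \<le> ennreal (40 * octic_moment * (1 / h + 1)\<^sup>2 / real n)"
proof -
  interpret Q: pair_sigma_finite M "lborel :: (real^2) measure" ..
  note [measurable] = measurable_pair_sq_deviation[of n]
  have [measurable]: "(\<lambda>\<omega>. emp_moment (Y \<omega>) n k j u) \<in> borel_measurable M" for k j u
    unfolding emp_moment_def incr_def by measurable
  have "(\<integral>\<^sup>+\<omega>. total_deviation P h (Y \<omega>) n \<partial>M) = (\<integral>\<^sup>+u. \<integral>\<^sup>+\<omega>. ennreal (sq_deviation P (Y \<omega>) n u) * indicator (square (1 / h + 1)) u \<partial>M \<partial>lborel)"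
    unfolding total_deviation_def by (rule Q.Fubini'[symmetric]) (simp add: case_prod_beta', measurable)
  also have "\<dots> \<le> (\<integral>\<^sup>+u. ennreal (10 * octic_moment / real n) * indicator (square (1 / h + 1)) u \<partial>lborel)"
  proof (intro nn_integral_mono)
    fix u :: "real^2"
    have "(\<integral>\<^sup>+\<omega>. ennreal (sq_deviation P (Y \<omega>) n u) \<partial>M) = (\<Sum>k\<in>UNIV. \<Sum>j\<le>4. \<integral>\<^sup>+\<omega>. ennreal ((cmod (emp_moment (Y \<omega>) n k j u - char_moment P k j u))\<^sup>2) \<partial>M)"
    proof -
      have "ennreal (sq_deviation P (Y \<omega>) n u) = (\<Sum>k\<in>UNIV. \<Sum>j\<le>4. ennreal ((cmod (emp_moment (Y \<omega>) n k j u - char_moment P k j u))\<^sup>2))" for \<omega>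
        by (simp add: sq_deviation_def sum_nonneg)
      then have "(\<integral>\<^sup>+\<omega>. ennreal (sq_deviation P (Y \<omega>) n u) \<partial>M) = (\<integral>\<^sup>+\<omega>. (\<Sum>k\<in>UNIV. \<Sum>j\<le>4. ennreal ((cmod (emp_moment (Y \<omega>) n k j u - char_moment P k j u))\<^sup>2)) \<partial>M)"
        by simp
      also have "\<dots> = (\<Sum>k\<in>UNIV. \<integral>\<^sup>+\<omega>. (\<Sum>j\<le>4. ennreal ((cmod (emp_moment (Y \<omega>) n k j u - char_moment P k j u))\<^sup>2)) \<partial>M)"
        by (rule nn_integral_sum) measurable
      also have "\<dots> = (\<Sum>k\<in>UNIV. \<Sum>j\<le>4. \<integral>\<^sup>+\<omega>. ennreal ((cmod (emp_moment (Y \<omega>) n k j u - char_moment P k j u))\<^sup>2) \<partial>M)"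
        by (rule sum.cong[OF refl], rule nn_integral_sum) measurable
      finally show ?thesis .
    qed
    also have "\<dots> \<le> (\<Sum>k\<in>(UNIV :: 2 set). \<Sum>j\<le>(4::nat). ennreal (octic_moment / real n))"
      by (intro sum_mono sq_deviation_expectation n) auto
    also have "\<dots> = ennreal (\<Sum>k\<in>(UNIV :: 2 set). \<Sum>j\<le>(4::nat). octic_moment / real n)"
      using octic_moment_nonneg by (simp add: sum_nonneg del: sum_constant)
    also have "(\<Sum>k\<in>(UNIV :: 2 set). \<Sum>j\<le>(4::nat). octic_moment / real n) = 10 * octic_moment / real n"
      by simp
    finally have "(\<integral>\<^sup>+\<omega>. ennreal (sq_deviation P (Y \<omega>) n u) \<partial>M) \<le> ennreal (10 * octic_moment / real n)" .
    then show "(\<integral>\<^sup>+\<omega>. ennreal (sq_deviation P (Y \<omega>) n u) * indicator (square (1 / h + 1)) u \<partial>M) \<le> ennreal (10 * octic_moment / real n) * indicator (square (1 / h + 1)) u"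
      by (cases "u \<in> square (1 / h + 1)") auto
  qed
  also have "\<dots> = ennreal (10 * octic_moment / real n) * ennreal (4 * (1 / h + 1)\<^sup>2)"
    using h by (simp add: nn_integral_cmult_indicator emeasure_square)
  also have "\<dots> = ennreal (40 * octic_moment * (1 / h + 1)\<^sup>2 / real n)"
    using octic_moment_nonneg by (subst ennreal_mult[symmetric]) auto
  finally show ?thesis .
qed

lemma emp_quartic_measurable: "(\<lambda>\<omega>. emp_quartic (Y \<omega>) n) \<in> borel_measurable M"
  unfolding emp_quartic_def incr_def by measurable

lemma emp_quartic_expectation:
  assumes n: "1 \<le> n"
  shows "(\<integral>\<^sup>+\<omega>. ennreal (emp_quartic (Y \<omega>) n) \<partial>M) = ennreal (quartic_moment P)"
proof -
  let ?q = "\<lambda>x :: real^2. 1 + ((x $ 1)^4 + (x $ 2)^4)"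
  have iq: "integrable M (\<lambda>\<omega>. ?q (D \<omega> t))" "(\<integral>\<omega>. ?q (D \<omega> t) \<partial>M) = quartic_moment P" if t: "1 \<le> t" for t
  proof -
    note [measurable] = D_measurable[OF t]
    have d: "P = distr M borel (\<lambda>\<omega>. D \<omega> t)" using D_distr[OF t] by simp
    show "integrable M (\<lambda>\<omega>. ?q (D \<omega> t))" using integrable_quartic_moment unfolding d by (subst (asm) integrable_distr_eq) auto
    show "(\<integral>\<omega>. ?q (D \<omega> t) \<partial>M) = quartic_moment P" unfolding quartic_moment_def d by (subst integral_distr) auto
  qed
  have "(\<integral>\<^sup>+\<omega>. ennreal (emp_quartic (Y \<omega>) n) \<partial>M) = (\<integral>\<^sup>+\<omega>. ennreal ((\<Sum>t=1..n. ?q (D \<omega> t)) / real n) \<partial>M)"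
  proof (rule nn_integral_cong_AE)
    show "AE \<omega> in M. ennreal (emp_quartic (Y \<omega>) n) = ennreal ((\<Sum>t=1..n. ?q (D \<omega> t)) / real n)"
      using AE_incr[of n]
    proof eventually_elim
      case (elim \<omega>)
      have "(\<Sum>t=1..n. ?q (incr (Y \<omega>) t)) = (\<Sum>t=1..n. ?q (D \<omega> t))"
        by (rule sum.cong[OF refl]) (use elim in simp)
      then show ?case by (simp only: emp_quartic_def)
    qed
  qed
  also have "\<dots> = ennreal (\<integral>\<omega>. (\<Sum>t=1..n. ?q (D \<omega> t)) / real n \<partial>M)"
  proof (rule nn_integral_eq_integral)
    have "integrable M (\<lambda>\<omega>. \<Sum>t=1..n. ?q (D \<omega> t))"
      by (rule Bochner_Integration.integrable_sum) (rule iq, simp)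
    then show "integrable M (\<lambda>\<omega>. (\<Sum>t=1..n. ?q (D \<omega> t)) / real n)" by (rule integrable_divide_zero)
    show "AE \<omega> in M. 0 \<le> (\<Sum>t=1..n. ?q (D \<omega> t)) / real n"
      by (intro AE_I2 divide_nonneg_nonneg sum_nonneg) auto
  qed
  also have "(\<integral>\<omega>. (\<Sum>t=1..n. ?q (D \<omega> t)) / real n \<partial>M) = (\<Sum>t=1..n. \<integral>\<omega>. ?q (D \<omega> t) \<partial>M) / real n"
    unfolding integral_divide_zero
    by (rule arg_cong[where f = "\<lambda>x. x / real n"], rule Bochner_Integration.integral_sum) (rule iq, simp)
  also have "\<dots> = quartic_moment P" using n iq(2) by simp
  finally show ?thesis .
qed

text \<open>Markov's inequality for each of the two variables and a union bound.\<close>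

lemma tail_bound:
  assumes n: "1 \<le> n" and h: "0 < h" and A: "0 < A" and \<tau>: "0 < \<tau>"
  shows "measure M {\<omega> \<in> space M. \<not> (emp_quartic (Y \<omega>) n \<le> A \<and> total_deviation P h (Y \<omega>) n \<le> ennreal \<tau>)} \<le>
    quartic_moment P / A + 40 * octic_moment * (1 / h + 1)\<^sup>2 / (real n * \<tau>)"
proof -
  note [measurable] = emp_quartic_measurable[of n] total_deviation_measurable[of h n]
  let ?E1 = "{\<omega> \<in> space M. 1 \<le> ennreal (1 / A) * ennreal (emp_quartic (Y \<omega>) n)}"
  let ?E2 = "{\<omega> \<in> space M. 1 \<le> ennreal (1 / \<tau>) * total_deviation P h (Y \<omega>) n}"
  have pm: "0 \<le> quartic_moment P" unfolding quartic_moment_def by (intro Bochner_Integration.integral_nonneg) auto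
  have "emeasure M ?E1 \<le> ennreal (1 / A) * (\<integral>\<^sup>+\<omega>. ennreal (emp_quartic (Y \<omega>) n) * indicator (space M) \<omega> \<partial>M)"
    by (rule nn_integral_Markov_inequality) auto
  also have "(\<integral>\<^sup>+\<omega>. ennreal (emp_quartic (Y \<omega>) n) * indicator (space M) \<omega> \<partial>M) = ennreal (quartic_moment P)"
    unfolding emp_quartic_expectation[OF n, symmetric] by (intro nn_integral_cong) simp
  also have "ennreal (1 / A) * ennreal (quartic_moment P) = ennreal (quartic_moment P / A)"
    using A pm by (subst ennreal_mult[symmetric]) auto
  finally have 1: "measure M ?E1 \<le> quartic_moment P / A"
    using A pm by (simp add: M.emeasure_eq_measure)
  have "emeasure M ?E2 \<le> ennreal (1 / \<tau>) * (\<integral>\<^sup>+\<omega>. total_deviation P h (Y \<omega>) n * indicator (space M) \<omega> \<partial>M)"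
    by (rule nn_integral_Markov_inequality) auto
  also have "(\<integral>\<^sup>+\<omega>. total_deviation P h (Y \<omega>) n * indicator (space M) \<omega> \<partial>M) = (\<integral>\<^sup>+\<omega>. total_deviation P h (Y \<omega>) n \<partial>M)"
    by (intro nn_integral_cong) simp
  also have "ennreal (1 / \<tau>) * \<dots> \<le> ennreal (1 / \<tau>) * ennreal (40 * octic_moment * (1 / h + 1)\<^sup>2 / real n)"
    by (intro mult_left_mono total_deviation_expectation n h) simp
  also have "\<dots> = ennreal (40 * octic_moment * (1 / h + 1)\<^sup>2 / (real n * \<tau>))"
    using \<tau> octic_moment_nonneg by (subst ennreal_mult[symmetric]) auto
  finally have 2: "measure M ?E2 \<le> 40 * octic_moment * (1 / h + 1)\<^sup>2 / (real n * \<tau>)"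
    using octic_moment_nonneg \<tau> by (simp add: M.emeasure_eq_measure)
  have "{\<omega> \<in> space M. \<not> (emp_quartic (Y \<omega>) n \<le> A \<and> total_deviation P h (Y \<omega>) n \<le> ennreal \<tau>)} \<subseteq> ?E1 \<union> ?E2"
  proof
    fix \<omega> assume w: "\<omega> \<in> {\<omega> \<in> space M. \<not> (emp_quartic (Y \<omega>) n \<le> A \<and> total_deviation P h (Y \<omega>) n \<le> ennreal \<tau>)}"
    then consider "A < emp_quartic (Y \<omega>) n" | "ennreal \<tau> < total_deviation P h (Y \<omega>) n" by (auto simp: not_le)
    then show "\<omega> \<in> ?E1 \<union> ?E2"
    proof cases
      case 1
      then have "1 \<le> 1 / A * emp_quartic (Y \<omega>) n" using A by (simp add: field_simps)
      then have "ennreal 1 \<le> ennreal (1 / A * emp_quartic (Y \<omega>) n)" by (rule ennreal_leI)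
      also have "\<dots> = ennreal (1 / A) * ennreal (emp_quartic (Y \<omega>) n)" using A by (intro ennreal_mult') simp
      finally show ?thesis using w by simp
    next
      case 2
      have "1 = ennreal (1 / \<tau>) * ennreal \<tau>" using \<tau> by (simp flip: ennreal_mult)
      also have "\<dots> \<le> ennreal (1 / \<tau>) * total_deviation P h (Y \<omega>) n" using 2 by (intro mult_left_mono) auto
      finally show ?thesis using w by simp
    qed
  qed
  then have "measure M {\<omega> \<in> space M. \<not> (emp_quartic (Y \<omega>) n \<le> A \<and> total_deviation P h (Y \<omega>) n \<le> ennreal \<tau>)} \<le> measure M (?E1 \<union> ?E2)"
    by (rule M.finite_measure_mono) measurable
  also have "\<dots> \<le> measure M ?E1 + measure M ?E2" by (rule measure_Un_le) measurable
  finally show ?thesis using 1 2 by linarith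
qed

end

subsection \<open>Rates\<close>

definition bandwidth_seq :: "nat \<Rightarrow> real" where "bandwidth_seq n = ln (ln (real n)) / sqrt (ln (real n))"

definition rate :: "nat \<Rightarrow> real" where "rate n = (ln (ln (real n)))\<^sup>2 / sqrt (ln (real n))"

text \<open>3 exceeds the base of the natural logarithm, so from \<open>n = 3\<close> on bandwidth
  and rate are positive.\<close>

lemma ln_pos: "3 \<le> n \<Longrightarrow> 1 < ln (real n)" "3 \<le> n \<Longrightarrow> 0 < ln (ln (real n))"
proof -
  assume "3 \<le> n"
  then have "ln 3 \<le> ln (real n)" by simp
  then show "1 < ln (real n)" using ln3_gt_1 by linarith
  then show "0 < ln (ln (real n))" by simp
qed

lemma bandwidth_seq_pos: "3 \<le> n \<Longrightarrow> 0 < bandwidth_seq n"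
  using ln_pos[of n] by (simp add: bandwidth_seq_def)

lemma rate_pos: "3 \<le> n \<Longrightarrow> 0 < rate n"
  using ln_pos[of n] by (simp add: rate_def)

text \<open>Since \<open>1 / h^2 = ln n / (ln ln n)^2\<close>, the left side is \<open>n\<close> to
  the power \<open>B / (ln ln n)^2\<close>, an exponent that tends to 0. The value
  \<open>1/8\<close> only has to stay below the gain \<open>1/4\<close> of
  \<open>stochastic_error_eventually\<close>.\<close>

lemma exp_bandwidth_seq_eventually: "eventually (\<lambda>n. exp (B / (bandwidth_seq n)\<^sup>2) \<le> real n powr (1 / 8)) sequentially"
proof -
  have "(\<lambda>n. B / (ln (ln (real n)))\<^sup>2) \<longlonglongrightarrow> 0" by real_asymp
  then have "eventually (\<lambda>n. B / (ln (ln (real n)))\<^sup>2 < 1 / 8) sequentially"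
    by (rule order_tendstoD) simp
  moreover have "eventually (\<lambda>n. 3 \<le> n) sequentially" by (rule eventually_ge_at_top)
  ultimately show ?thesis
  proof eventually_elim
    case (elim n)
    note l = ln_pos[OF elim(2)]
    have "B / (bandwidth_seq n)\<^sup>2 = B / (ln (ln (real n)))\<^sup>2 * ln (real n)"
      using l by (simp add: bandwidth_seq_def power_divide)
    also have "\<dots> \<le> 1 / 8 * ln (real n)" using elim(1) l by (intro mult_right_mono) auto
    finally show ?case using elim(2) by (simp add: powr_def)
  qed
qed

text \<open>In \<open>stochastic_error_bound\<close> the choices
  \<open>\<tau> = n powr (-1/2)\<close> and \<open>l = n powr (-1/4)\<close> give \<open>l\<close>
  and \<open>\<tau> / l\<close> the same size; this beats \<open>n powr (1/8)\<close> and the powers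
  of \<open>1 / h\<close>.\<close>

lemma stochastic_error_eventually:
  assumes D: "0 \<le> D"
  shows "eventually (\<lambda>n. D * exp (B / (bandwidth_seq n)\<^sup>2) * (20 * real n powr (-1/4) / (bandwidth_seq n)\<^sup>2 + real n powr (-1/2) / (2 * real n powr (-1/4))) \<le> rate n) sequentially"
proof -
  have "(\<lambda>n. D * real n powr (1 / 8) * (20 * real n powr (-1/4) / (bandwidth_seq n)\<^sup>2 + real n powr (-1/2) / (2 * real n powr (-1/4))) / rate n) \<longlonglongrightarrow> 0"
    unfolding bandwidth_seq_def rate_def by real_asymp
  then have "eventually (\<lambda>n. D * real n powr (1 / 8) * (20 * real n powr (-1/4) / (bandwidth_seq n)\<^sup>2 + real n powr (-1/2) / (2 * real n powr (-1/4))) / rate n < 1) sequentially"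
    by (rule order_tendstoD) simp
  moreover note exp_bandwidth_seq_eventually[of B]
  moreover have "eventually (\<lambda>n. 3 \<le> n) sequentially" by (rule eventually_ge_at_top)
  ultimately show ?thesis
  proof eventually_elim
    case (elim n)
    let ?X = "20 * real n powr (-1/4) / (bandwidth_seq n)\<^sup>2 + real n powr (-1/2) / (2 * real n powr (-1/4))"
    have "D * exp (B / (bandwidth_seq n)\<^sup>2) * ?X \<le> D * real n powr (1 / 8) * ?X"
      by (intro mult_right_mono mult_left_mono elim(2) D) auto
    also have "\<dots> \<le> rate n" using elim(1) rate_pos[OF elim(3)] by (simp add: divide_less_eq)
    finally show ?case .
  qed
qed

text \<open>Compares the level chosen for \<open>total_deviation\<close> with the threshold of
  \<open>good_event_of_total_deviation\<close>; the exponential costs at most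
  \<open>n powr (1/8)\<close>.\<close>

lemma threshold_eventually:
  assumes D: "0 < D"
  shows "eventually (\<lambda>n. real n powr (-1/2) < exp (- (B / (bandwidth_seq n)\<^sup>2)) / D) sequentially"
proof -
  have "(\<lambda>n. D * real n powr (1 / 8) * real n powr (-1/2)) \<longlonglongrightarrow> 0" by real_asymp
  then have "eventually (\<lambda>n. D * real n powr (1 / 8) * real n powr (-1/2) < 1) sequentially"
    by (rule order_tendstoD) simp
  with exp_bandwidth_seq_eventually[of B] show ?thesis
  proof eventually_elim
    case (elim n)
    have "D * exp (B / (bandwidth_seq n)\<^sup>2) * real n powr (-1/2) \<le> D * real n powr (1 / 8) * real n powr (-1/2)"
      by (intro mult_right_mono mult_left_mono elim(1)) (use D in auto)
    also have "\<dots> < 1" by (rule elim(2))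
    finally have "real n powr (-1/2) < 1 / (D * exp (B / (bandwidth_seq n)\<^sup>2))"
      using D by (simp add: field_simps)
    then show ?case by (simp add: exp_minus field_simps)
  qed
qed

text \<open>\<open>ln (1 + 1 / h)\<close> is of the order of half of \<open>ln ln n\<close>, and
  \<open>rate n\<close> is \<open>h\<close> times \<open>ln ln n\<close>: the logarithm from the
  bias integral is the factor by which the rate exceeds the bandwidth.\<close>

lemma bias_eventually:
  assumes L: "0 \<le> L"
  shows "eventually (\<lambda>n. L * bandwidth_seq n * ln (1 + 1 / bandwidth_seq n) + 2 * bandwidth_seq n \<le> (L + 2) * rate n) sequentially"
proof -
  have "eventually (\<lambda>n. ln (1 + 1 / bandwidth_seq n) \<le> ln (ln (real n))) sequentially"
    unfolding bandwidth_seq_def by real_asymp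
  moreover have "eventually (\<lambda>n. 1 \<le> ln (ln (real n))) sequentially" by real_asymp
  moreover have "eventually (\<lambda>n. 3 \<le> n) sequentially" by (rule eventually_ge_at_top)
  ultimately show ?thesis
  proof eventually_elim
    case (elim n)
    note b = bandwidth_seq_pos[OF elim(3)]
    have r: "rate n = bandwidth_seq n * ln (ln (real n))" by (simp add: rate_def bandwidth_seq_def power2_eq_square)
    have "L * bandwidth_seq n * ln (1 + 1 / bandwidth_seq n) \<le> L * bandwidth_seq n * ln (ln (real n))"
      using L b elim(1) by (intro mult_left_mono) auto
    moreover have "2 * bandwidth_seq n * 1 \<le> 2 * bandwidth_seq n * ln (ln (real n))"
      using b elim(2) by (intro mult_left_mono) auto
    ultimately show ?case by (simp add: r algebra_simps)
  qed
qed

text \<open>At the level \<open>n powr (-1/2)\<close> Markov's inequality leaves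
  \<open>sqrt n\<close> in the denominator, against at most a power of \<open>ln n\<close>.\<close>

lemma tail_eventually:
  assumes "0 < \<delta>"
  shows "eventually (\<lambda>n. V * (1 / bandwidth_seq n + 1)\<^sup>2 / (real n * real n powr (-1/2)) < \<delta>) sequentially"
proof -
  have "(\<lambda>n. V * (1 / bandwidth_seq n + 1)\<^sup>2 / (real n * real n powr (-1/2))) \<longlonglongrightarrow> 0"
    unfolding bandwidth_seq_def by real_asymp
  then show ?thesis by (rule order_tendstoD) fact
qed

text \<open>Continuity from above: the tail events decrease to the empty set because the variable is
  finite everywhere.\<close>

lemma (in prob_space) finite_tail:
  fixes Z :: "'a \<Rightarrow> ereal"
  assumes [measurable]: "Z \<in> borel_measurable M" and fin: "\<And>\<omega>. \<bar>Z \<omega>\<bar> \<noteq> \<infinity>" and d: "0 < \<delta>"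
  shows "\<exists>C>0. prob {\<omega> \<in> space M. ereal C \<le> \<bar>Z \<omega>\<bar>} \<le> \<delta>"
proof -
  let ?A = "\<lambda>k :: nat. {\<omega> \<in> space M. ereal (real k) \<le> \<bar>Z \<omega>\<bar>}"
  have "(\<lambda>k. prob (?A k)) \<longlonglongrightarrow> prob (\<Inter>k. ?A k)"
  proof (rule finite_Lim_measure_decseq)
    show "range ?A \<subseteq> sets M" by auto
    show "decseq ?A"
      by (rule decseq_SucI) (auto intro: order_trans[rotated])
  qed
  moreover have "(\<Inter>k. ?A k) = {}"
  proof (rule equals0I)
    fix \<omega> assume "\<omega> \<in> (\<Inter>k. ?A k)"
    then have ge: "ereal (real k) \<le> \<bar>Z \<omega>\<bar>" for k by blast
    obtain r where r: "\<bar>Z \<omega>\<bar> = ereal r" using fin[of \<omega>] by (cases "Z \<omega>") auto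
    obtain k :: nat where "r < real k" using reals_Archimedean2 by blast
    with ge[of k] show False by (simp add: r)
  qed
  ultimately have "(\<lambda>k. prob (?A k)) \<longlonglongrightarrow> 0" by simp
  then have "eventually (\<lambda>k. prob (?A k) < \<delta>) sequentially" by (rule order_tendstoD) (rule d)
  with eventually_gt_at_top[of 0] have "eventually (\<lambda>k. 0 < k \<and> prob (?A k) < \<delta>) sequentially"
    by eventually_elim simp
  then obtain k where "0 < k" "prob (?A k) < \<delta>" by (auto simp: eventually_sequentially)
  then show ?thesis by (intro exI[of _ "real k"]) auto
qed

lemma pointed_quadrant_nonempty: "axis 1 1 \<in> pointed_quadrant"
  by (auto simp: pointed_quadrant_def axis_def vec_eq_iff)

section \<open>Combination of bias, stochastic error and tail bounds\<close>

context iid_sample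
begin

definition sup_error :: "nat \<Rightarrow> 'w \<Rightarrow> ereal" where
  "sup_error n \<omega> = (SUP p\<in>pointed_quadrant. ereal (weighted_error (bandwidth_seq n) n (Y \<omega>) p))"

lemma weighted_error_nonneg: "0 \<le> weighted_error h n x p" by (simp add: weighted_error_def norm_weight_nonneg)

lemma sup_error_nonneg: "0 \<le> sup_error n \<omega>"
  unfolding sup_error_def by (rule SUP_upper2[OF pointed_quadrant_nonempty]) (simp add: weighted_error_nonneg)

lemma sup_error_le: "(\<And>p. p \<in> pointed_quadrant \<Longrightarrow> weighted_error (bandwidth_seq n) n (Y \<omega>) p \<le> B) \<Longrightarrow> sup_error n \<omega> \<le> ereal B"
  unfolding sup_error_def by (rule SUP_least) simp

lemma sup_error_finite: "3 \<le> n \<Longrightarrow> \<bar>sup_error n \<omega>\<bar> \<noteq> \<infinity>"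
proof -
  assume "3 \<le> n"
  then obtain B where "\<And>p. p \<in> pointed_quadrant \<Longrightarrow> weighted_error (bandwidth_seq n) n (Y \<omega>) p \<le> B"
    using est_bounded[OF bandwidth_seq_pos, of n n "Y \<omega>"] by (auto simp: weighted_error_def)
  from sup_error_le[OF this] have "sup_error n \<omega> \<le> ereal B" .
  with sup_error_nonneg[of n \<omega>] show ?thesis by auto
qed

lemma sup_error_measurable: "3 \<le> n \<Longrightarrow> sup_error n \<in> borel_measurable M"
  unfolding sup_error_def[abs_def] by (rule SUP_weighted_error_measurable[OF Y_measurable bandwidth_seq_pos])

text \<open>A statement about one sample. In the constant \<open>8 * c * (L + 2)\<close> stands for
  the bias and 1 for the stochastic error, both measured in \<open>rate n\<close>; 32768 comes from
  \<open>norm_weight_fourier_le\<close>.\<close>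

lemma sup_error_good:
  assumes n: "3 \<le> n" and A: "1 \<le> A" "emp_quartic (Y \<omega>) n \<le> A" "quartic_moment P \<le> A"
    and T: "total_deviation P (bandwidth_seq n) (Y \<omega>) n \<le> ennreal (real n powr (-1/2))"
    and thr: "real n powr (-1/2) < exp (- (8 * C / (bandwidth_seq n)\<^sup>2)) / (4096 * A\<^sup>2)"
    and st: "3840 * A^4 * exp (10 * C / (bandwidth_seq n)\<^sup>2) * (20 * real n powr (-1/4) / (bandwidth_seq n)\<^sup>2 + real n powr (-1/2) / (2 * real n powr (-1/4))) \<le> rate n"
    and bi: "L * bandwidth_seq n * ln (1 + 1 / bandwidth_seq n) + 2 * bandwidth_seq n \<le> (L + 2) * rate n"
  shows "sup_error n \<omega> \<le> ereal (32768 * (8 * c * (L + 2) + 1) * rate n)"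
proof (rule sup_error_le)
  fix p :: "real^2" assume p: "p \<in> pointed_quadrant"
  note h = bandwidth_seq_pos[OF n] and r = rate_pos[OF n]
  have "total_deviation P (bandwidth_seq n) (Y \<omega>) n < ennreal (exp (- (8 * C / (bandwidth_seq n)\<^sup>2)) / (4096 * A\<^sup>2))"
    by (rule le_less_trans[OF T], rule ennreal_lessI[OF _ thr]) (use A in simp)
  then have good: "good_event \<phi> (bandwidth_seq n) n (Y \<omega>)" by (rule good_event_of_total_deviation[OF A h])
  have "stochastic_error (bandwidth_seq n) (Y \<omega>) n \<le> ennreal (3840 * A^4 * exp (10 * C / (bandwidth_seq n)\<^sup>2) * (20 * real n powr (-1/4) / (bandwidth_seq n)\<^sup>2 + real n powr (-1/2) / (2 * real n powr (-1/4))))"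
    by (rule stochastic_error_bound[OF A h _ good T]) (use n in auto)
  also have "\<dots> \<le> ennreal (rate n)" by (rule ennreal_leI[OF st])
  finally have s: "stochastic_error (bandwidth_seq n) (Y \<omega>) n \<le> ennreal (rate n)" .
  have b: "c * (8 * (L * bandwidth_seq n * ln (1 + 1 / bandwidth_seq n) + 2 * bandwidth_seq n)) \<le> c * (8 * ((L + 2) * rate n))"
    using c by (intro mult_left_mono bi) auto
  have "ennreal (weighted_error (bandwidth_seq n) n (Y \<omega>) p) \<le> ennreal 32768 * (ennreal (c * (8 * (L * bandwidth_seq n * ln (1 + 1 / bandwidth_seq n) + 2 * bandwidth_seq n))) + stochastic_error (bandwidth_seq n) (Y \<omega>) n)"
    unfolding weighted_error_def by (rule est_error[OF h good p])
  also have "\<dots> \<le> ennreal 32768 * (ennreal (c * (8 * ((L + 2) * rate n))) + ennreal (rate n))"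
    by (intro mult_left_mono add_mono ennreal_leI b s) simp
  also have "\<dots> = ennreal 32768 * ennreal (c * (8 * ((L + 2) * rate n)) + rate n)"
    using c r L_nonneg by (subst ennreal_plus) auto
  also have "\<dots> = ennreal (32768 * (c * (8 * ((L + 2) * rate n)) + rate n))"
    by (rule ennreal_mult[symmetric]) (use c r L_nonneg in auto)
  also have "32768 * (c * (8 * ((L + 2) * rate n)) + rate n) = 32768 * (8 * c * (L + 2) + 1) * rate n"
    by (simp add: algebra_simps)
  finally show "weighted_error (bandwidth_seq n) n (Y \<omega>) p \<le> 32768 * (8 * c * (L + 2) + 1) * rate n"
    using c r L_nonneg by (subst (asm) ennreal_le_iff) auto
qed

theorem sup_error_bigO: "bigO_P M 3 sup_error rate"
  unfolding bigO_P_def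
proof (intro conjI allI impI)
  fix n :: nat assume "3 \<le> n"
  then show "sup_error n \<in> borel_measurable M" by (rule sup_error_measurable)
next
  fix \<delta> :: real assume d: "0 < \<delta>"
  have pm: "0 \<le> quartic_moment P" unfolding quartic_moment_def by (intro Bochner_Integration.integral_nonneg) auto
  \<comment> \<open>Chosen so that the Markov term of \<open>emp_quartic\<close> is at most
    \<open>\<delta> / 2\<close>; it does not depend on \<open>n\<close>.\<close>
  define A where "A = max (max 1 (quartic_moment P)) (2 * quartic_moment P / \<delta>)"
  have A: "1 \<le> A" "quartic_moment P \<le> A" "2 * quartic_moment P / \<delta> \<le> A" by (auto simp: A_def)
  have A2: "quartic_moment P / A \<le> \<delta> / 2" using A d by (simp add: field_simps)
  \<comment> \<open>The added 1 leaves a gap above the bound of \<open>sup_error_good\<close>, since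
    \<open>bigO_P\<close> counts equality as an exceedance.\<close>
  define C1 where "C1 = 32768 * (8 * c * (L + 2) + 1) + 1"
  have C1: "0 < C1" using c L_nonneg by (simp add: C1_def add_nonneg_pos)
  let ?good = "\<lambda>n. real n powr (-1/2) < exp (- (8 * C / (bandwidth_seq n)\<^sup>2)) / (4096 * A\<^sup>2) \<and>
      3840 * A^4 * exp (10 * C / (bandwidth_seq n)\<^sup>2) * (20 * real n powr (-1/4) / (bandwidth_seq n)\<^sup>2 + real n powr (-1/2) / (2 * real n powr (-1/4))) \<le> rate n \<and>
      L * bandwidth_seq n * ln (1 + 1 / bandwidth_seq n) + 2 * bandwidth_seq n \<le> (L + 2) * rate n \<and>
      40 * octic_moment * (1 / bandwidth_seq n + 1)\<^sup>2 / (real n * real n powr (-1/2)) < \<delta> / 2"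
  have "eventually ?good sequentially"
    by (intro eventually_conj threshold_eventually stochastic_error_eventually bias_eventually tail_eventually L_nonneg) (use A d in auto)
  then obtain n0 where n0: "\<And>n. n0 \<le> n \<Longrightarrow> ?good n" by (auto simp: eventually_sequentially)
  have large: "measure M {\<omega> \<in> space M. ereal C1 \<le> \<bar>sup_error n \<omega> / ereal (rate n)\<bar>} \<le> \<delta>" if n: "3 \<le> n" "n0 \<le> n" for n
  proof -
    note g = n0[OF n(2)] and r = rate_pos[OF n(1)]
    let ?E = "{\<omega> \<in> space M. \<not> (emp_quartic (Y \<omega>) n \<le> A \<and> total_deviation P (bandwidth_seq n) (Y \<omega>) n \<le> ennreal (real n powr (-1/2)))}"
    note [measurable] = emp_quartic_measurable[of n] total_deviation_measurable[of "bandwidth_seq n" n]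
    have "{\<omega> \<in> space M. ereal C1 \<le> \<bar>sup_error n \<omega> / ereal (rate n)\<bar>} \<subseteq> ?E"
    proof (rule subsetI, rule ccontr)
      fix \<omega> assume w: "\<omega> \<in> {\<omega> \<in> space M. ereal C1 \<le> \<bar>sup_error n \<omega> / ereal (rate n)\<bar>}" "\<omega> \<notin> ?E"
      then have sT: "emp_quartic (Y \<omega>) n \<le> A" "total_deviation P (bandwidth_seq n) (Y \<omega>) n \<le> ennreal (real n powr (-1/2))" by auto
      have le: "sup_error n \<omega> \<le> ereal ((C1 - 1) * rate n)"
      proof -
        have e: "C1 - 1 = 32768 * (8 * c * (L + 2) + 1)" by (simp add: C1_def)
        show ?thesis unfolding e by (rule sup_error_good[OF n(1) A(1) sT(1) A(2) sT(2)]) (use g in blast)+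
      qed
      obtain x where x: "sup_error n \<omega> = ereal x" using sup_error_finite[OF n(1), of \<omega>] by (cases "sup_error n \<omega>") auto
      have "0 \<le> x" "x \<le> (C1 - 1) * rate n" using le sup_error_nonneg[of n \<omega>] by (auto simp: x)
      moreover have "C1 \<le> \<bar>x / rate n\<bar>" using w(1) r by (simp add: x)
      ultimately have "C1 * rate n \<le> (C1 - 1) * rate n" using r by (simp add: field_simps)
      then show False using r by (simp add: algebra_simps)
    qed
    then have "measure M {\<omega> \<in> space M. ereal C1 \<le> \<bar>sup_error n \<omega> / ereal (rate n)\<bar>} \<le> measure M ?E"
      by (rule M.finite_measure_mono) measurable
    also have "\<dots> \<le> quartic_moment P / A + 40 * octic_moment * (1 / bandwidth_seq n + 1)\<^sup>2 / (real n * real n powr (-1/2))"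
      by (rule tail_bound) (use n A bandwidth_seq_pos[OF n(1)] in auto)
    also have "\<dots> \<le> \<delta>" using A2 g by linarith
    finally show ?thesis .
  qed
  \<comment> \<open>Each of the finitely many \<open>n\<close> below \<open>n0\<close> gets a
    constant of its own.\<close>
  have "\<exists>B>0. measure M {\<omega> \<in> space M. ereal B \<le> \<bar>sup_error n \<omega> / ereal (rate n)\<bar>} \<le> \<delta>" if n: "3 \<le> n" for n
  proof (rule M.finite_tail[OF _ _ d])
    note [measurable] = sup_error_measurable[OF n]
    show "(\<lambda>\<omega>. sup_error n \<omega> / ereal (rate n)) \<in> borel_measurable M" by measurable
    show "\<bar>sup_error n \<omega> / ereal (rate n)\<bar> \<noteq> \<infinity>" for \<omega>
      using sup_error_finite[OF n, of \<omega>] rate_pos[OF n] by (cases "sup_error n \<omega>") auto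
  qed
  then obtain B where B: "\<And>n. 3 \<le> n \<Longrightarrow> 0 < B n" "\<And>n. 3 \<le> n \<Longrightarrow> measure M {\<omega> \<in> space M. ereal (B n) \<le> \<bar>sup_error n \<omega> / ereal (rate n)\<bar>} \<le> \<delta>"
    by metis
  \<comment> \<open>A sum of positive constants majorises each of them.\<close>
  define C2 where "C2 = C1 + (\<Sum>n\<in>{3..<n0}. B n)"
  have sB: "0 \<le> (\<Sum>n\<in>{3..<n0}. B n)" by (rule sum_nonneg, rule less_imp_le, rule B(1)) simp
  have mono: "measure M {\<omega> \<in> space M. ereal C2 \<le> \<bar>sup_error n \<omega> / ereal (rate n)\<bar>} \<le> measure M {\<omega> \<in> space M. ereal b \<le> \<bar>sup_error n \<omega> / ereal (rate n)\<bar>}"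
    if n: "3 \<le> n" and b: "b \<le> C2" for n b
  proof (rule M.finite_measure_mono)
    note [measurable] = sup_error_measurable[OF n]
    show "{\<omega> \<in> space M. ereal b \<le> \<bar>sup_error n \<omega> / ereal (rate n)\<bar>} \<in> sets M" by measurable
    show "{\<omega> \<in> space M. ereal C2 \<le> \<bar>sup_error n \<omega> / ereal (rate n)\<bar>} \<subseteq> {\<omega> \<in> space M. ereal b \<le> \<bar>sup_error n \<omega> / ereal (rate n)\<bar>}"
      using b by (auto intro: order_trans[of "ereal b" "ereal C2"])
  qed
  show "\<exists>C>0. \<forall>n\<ge>3. measure M {\<omega> \<in> space M. ereal C \<le> \<bar>sup_error n \<omega> / ereal (rate n)\<bar>} \<le> \<delta>"
  proof (intro exI[of _ C2] conjI allI impI)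
    show "0 < C2" using C1 sB by (simp add: C2_def)
    fix n :: nat assume n: "3 \<le> n"
    show "measure M {\<omega> \<in> space M. ereal C2 \<le> \<bar>sup_error n \<omega> / ereal (rate n)\<bar>} \<le> \<delta>"
    proof (cases "n0 \<le> n")
      case True
      have "C1 \<le> C2" using sB by (simp add: C2_def)
      from mono[OF n this] large[OF n True] show ?thesis by (rule order_trans)
    next
      case False
      then have "B n \<le> (\<Sum>n\<in>{3..<n0}. B n)"
        using n by (intro member_le_sum) (auto simp: less_imp_le[OF B(1)])
      then have "B n \<le> C2" using C1 by (simp add: C2_def)
      from mono[OF n this] B(2)[OF n] show ?thesis by (rule order_trans)
    qed
  qed
qed

end

text \<open>In the unit ball \<open>t^j \<le> t^2\<close> is controlled by the defining integral of
  a Levy measure, outside it by the moment of order \<open>8 + \<gamma>\<close>.\<close>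

lemma nu_norm_moments:
  assumes lm: "levy_measure \<nu>" and g: "0 < \<gamma>" "(\<integral>\<^sup>+x. ennreal (norm x powr (8 + \<gamma>)) \<partial>\<nu>) < \<infinity>" and j: "2 \<le> j" "j \<le> 8"
  shows "integrable \<nu> (\<lambda>x. norm x ^ j)"
proof (rule integrableI_bounded)
  have s [measurable_cong]: "sets \<nu> = sets borel" using lm by (simp add: levy_measure_def)
  show "(\<lambda>x. norm x ^ j) \<in> borel_measurable \<nu>" by measurable
  have le: "t ^ j \<le> min 1 (t\<^sup>2) + t powr (8 + \<gamma>)" if t: "0 \<le> t" for t :: real
  proof (cases "t \<le> 1")
    case True
    have "t ^ j \<le> t\<^sup>2" by (rule power_decreasing[OF j(1) t True])
    moreover have "t\<^sup>2 \<le> 1" by (rule power_le_one[OF t True])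
    ultimately show ?thesis by (simp add: add_increasing2)
  next
    case False
    then have "t ^ j = t powr real j" by (simp add: powr_realpow)
    also have "\<dots> \<le> t powr (8 + \<gamma>)" using False j g by (intro powr_mono) auto
    finally show ?thesis by (simp add: add_increasing)
  qed
  have "(\<integral>\<^sup>+x. ennreal (norm (norm x ^ j)) \<partial>\<nu>) \<le> (\<integral>\<^sup>+x. ennreal (min 1 ((norm x)\<^sup>2)) + ennreal (norm x powr (8 + \<gamma>)) \<partial>\<nu>)"
    by (intro nn_integral_mono) (simp add: le flip: ennreal_plus)
  also have "\<dots> = (\<integral>\<^sup>+x. ennreal (min 1 ((norm x)\<^sup>2)) \<partial>\<nu>) + (\<integral>\<^sup>+x. ennreal (norm x powr (8 + \<gamma>)) \<partial>\<nu>)"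
    by (rule nn_integral_add) measurable
  also have "\<dots> < \<infinity>" using lm g by (simp add: levy_measure_def)
  finally show "(\<integral>\<^sup>+x. ennreal (norm (norm x ^ j)) \<partial>\<nu>) < \<infinity>" .
qed

theorem theorem3p11:
  fixes M :: "'a measure" and X :: "real \<Rightarrow> 'a \<Rightarrow> real^2"
    and \<Sigma> :: "real^2^2" and \<nu> :: "(real^2) measure" and \<alpha> :: "real^2"
    and K :: "real^2 \<Rightarrow> real" and h :: "nat \<Rightarrow> real"
  assumes K_nonneg: "\<And>x. 0 \<le> K x"
    and K_L1: "integrable lborel K"
    and K_L2: "integrable lborel (\<lambda>x. (K x)\<^sup>2)"
    and K_int: "(\<integral>x. K x \<partial>lborel) = 1"
    and K_supp: "closure {u. fourier (\<lambda>x. complex_of_real (K x)) u \<noteq> 0} \<subseteq> square 1"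
    and K_lipschitz: "\<exists>L. L-lipschitz_on UNIV (fourier (\<lambda>x. complex_of_real (K x)))"
    and levy: "levy_process M X"
    and triplet: "levy_triplet M X \<Sigma> \<nu> \<alpha>"
    and quadrant: "emeasure \<nu> (- {x. 0 \<le> x $ 1 \<and> 0 \<le> x $ 2}) = 0"
    and moment: "\<exists>\<gamma>>0. (\<integral>\<^sup>+x. ennreal (norm x powr (8 + \<gamma>)) \<partial>\<nu>) < \<infinity>"
    and decay: "\<exists>c>0. \<forall>u.
      cmod (fourier_measure (density \<nu> (\<lambda>x. ennreal ((x $ 1)^4 + (x $ 2)^4))) u)
        \<le> c * inverse (1 + \<bar>u $ 1\<bar>) * inverse (1 + \<bar>u $ 2\<bar>)"
    and bandwidth: "\<And>n. h n = ln (ln (real n)) / sqrt (ln (real n))"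
  shows "bigO_P M 3
    (\<lambda>n \<omega>. SUP p\<in>pointed_quadrant.
       ereal (min ((norm p)^2) ((norm p)^4) *
         cmod (complex_of_real (measure \<nu> (upper_orthant p))
           - N_hat K (levy_char \<Sigma> \<nu> \<alpha>) (h n) n (\<lambda>t. if t = 0 then 0 else X (real t) \<omega>) p)))
    (\<lambda>n. (ln (ln (real n)))\<^sup>2 / sqrt (ln (real n)))"
proof -
  interpret X: levy_process M X by (rule levy)
  define P where "P = distr M borel (X 1)"
  have X_rv [measurable]: "X t \<in> borel_measurable M" if "0 \<le> t" for t by (rule X.random_variable[OF that])
  have lm: "levy_measure \<nu>" and law: "\<And>u. fourier_measure P u = levy_char \<Sigma> \<nu> \<alpha> u"
    using triplet by (auto simp: levy_triplet_def P_def)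
  obtain \<gamma> where \<gamma>: "0 < \<gamma>" "(\<integral>\<^sup>+x. ennreal (norm x powr (8 + \<gamma>)) \<partial>\<nu>) < \<infinity>" using moment by blast
  have ll: "levy_law \<Sigma> \<nu> \<alpha> P"
  proof (rule levy_law.intro)
    show "sets \<nu> = sets borel" using lm by (simp add: levy_measure_def)
    show "integrable \<nu> (\<lambda>x. norm x ^ j)" if "2 \<le> j" "j \<le> 8" for j by (rule nu_norm_moments[OF lm \<gamma> that])
    show "prob_space P" unfolding P_def by (rule X.prob_space_distr) simp
    show "sets P = sets borel" by (simp add: P_def)
  qed (rule law)
  obtain C where C: "0 \<le> C" "\<And>u. exp (- (C * (norm u)\<^sup>2)) \<le> cmod (levy_char \<Sigma> \<nu> \<alpha> u)"
    using levy_law.levy_char_lower_bound[OF ll] by blast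
  obtain L where L: "L-lipschitz_on UNIV (fourier (\<lambda>x. complex_of_real (K x)))" using K_lipschitz by blast
  obtain c where c: "0 < c" "\<And>u. cmod (fourier_measure (density \<nu> (\<lambda>x. ennreal ((x $ 1)^4 + (x $ 2)^4))) u)
        \<le> c * inverse (1 + \<bar>u $ 1\<bar>) * inverse (1 + \<bar>u $ 2\<bar>)" using decay by blast
  define Y where "Y \<omega> t = (if t = 0 then 0 else X (real t) \<omega>)" for \<omega> and t :: nat
  define D where "D \<omega> t = X (real t) \<omega> - X (real (t - 1)) \<omega>" for \<omega> and t :: nat
  have est: "levy_est \<Sigma> \<nu> \<alpha> P K L c C"
  proof (intro levy_est.intro ll levy_est_axioms.intro K_nonneg K_L1 K_int L c(1) C)
    show "fourier (\<lambda>x. complex_of_real (K x)) u = 0" if "u \<notin> square 1" for u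
      using that order_trans[OF closure_subset K_supp] by auto
    show "cmod (fourier_measure (density \<nu> (\<lambda>x. ennreal ((x $ 1)^4 + (x $ 2)^4))) u) \<le> c / cross_weight u" for u
      using c(2)[of u] by (simp only: cross_weight_def divide_inverse inverse_mult_distrib mult.assoc)
  qed
  have "iid_sample \<Sigma> \<nu> \<alpha> P K L c C M Y D"
  proof (intro iid_sample.intro est X.prob_space_axioms iid_sample_axioms.intro)
    show "(\<lambda>\<omega>. Y \<omega> t) \<in> borel_measurable M" for t
      unfolding Y_def by (cases "t = 0") simp_all
    \<comment> \<open>Only the first increment involves time 0, where \<open>Y\<close> is exactly 0
      and \<open>X 0\<close> is 0 almost surely.\<close>
    show "AE \<omega> in M. incr (Y \<omega>) t = D \<omega> t" if t: "1 \<le> t" for t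
    proof (cases "t = 1")
      case True
      show ?thesis using X.start by eventually_elim (simp add: True incr_def Y_def D_def)
    qed (use t in \<open>simp add: incr_def Y_def D_def\<close>)
    show "X.indep_vars (\<lambda>_. borel) (\<lambda>i \<omega>. D \<omega> (Suc i)) {..<n}" for n
      using X.independent_increments[where t = real and m = n] by (simp add: D_def)
    show "distr M borel (\<lambda>\<omega>. D \<omega> t) = P" if t: "1 \<le> t" for t
      using X.stationary_increments[of "real (t - 1)" 1] t by (simp add: D_def P_def of_nat_diff)
  qed
  then interpret S: iid_sample \<Sigma> \<nu> \<alpha> P K L c C M Y D .
  have "h = bandwidth_seq" using bandwidth by (simp add: fun_eq_iff bandwidth_seq_def)
  have Y: "Y \<omega> = (\<lambda>t. if t = 0 then 0 else X (real t) \<omega>)" for \<omega>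
    by (rule ext) (rule Y_def)
  have sup: "S.sup_error = (\<lambda>n \<omega>. SUP p\<in>pointed_quadrant.
       ereal (min ((norm p)^2) ((norm p)^4) *
         cmod (complex_of_real (measure \<nu> (upper_orthant p))
           - N_hat K (levy_char \<Sigma> \<nu> \<alpha>) (h n) n (\<lambda>t. if t = 0 then 0 else X (real t) \<omega>) p)))"
    by (intro ext) (simp only: S.sup_error_def S.weighted_error_def norm_weight_def Y \<open>h = bandwidth_seq\<close>)
  have rate: "rate = (\<lambda>n. (ln (ln (real n)))\<^sup>2 / sqrt (ln (real n)))"
    by (rule ext) (rule rate_def)
  from S.sup_error_bigO show ?thesis unfolding sup rate .
qed

end
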